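(* Let $\lambda,\lambda'\in P^\vee_{++}$ and $\mu\in P^\vee$ with $\lambda\ge\lambda'\ge\mu$, and assume that $\lambda'$ satisfies the conicity condition for $\lambda$. Put $\mathsf v_i=\langle\lambda-\mu,\Lambda_i\rangle$ and $\mathsf v'_i=\langle\lambda'-\mu,\Lambda_i\rangle$ for $i\in I$. Then there is a closed embedding of Kac–Moody affine Grassmannian slices $$\overline{\mathcal W}^{\lambda'}_\mu\hookrightarrow\overline{\mathcal W}^{\lambda}_\mu$$ such that the corresponding restriction map $\Bbbk[\overline{\mathcal W}^{\lambda}_\mu]\to\Bbbk[\overline{\mathcal W}^{\lambda'}_\mu]$ acts on fundamental monopole operators as follows: for every $\mathbf m\in\mathbb Z^I$ with $\mathbf 0\le\mathbf m\le\mathbf v$ and every $f\in\Lambda^{\mathbf v}_{\mathbf m}$, $$\mathsf M^{\pm}_{\mathbf m}(f)\ \longmapsto\ \begin{cases}\mathsf M^{\pm}_{\mathbf m}(\tilde f)&\text{if }\mathbf m\le\mathbf v',\\ 0&\text{otherwise,}\end{cases}$$ where, for $\mathbf m\le\mathbf v'$, $\tilde f\in\Lambda^{\mathbf v'}_{\mathbf m}$ is obtained from $f$ by setting $w_{i,r}=0$ for all $i\in I$ and $r>\mathsf v'_i$.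
   Context: $\Bbbk$ is a field; $[n]=\{1,\dots,n\}$; for tuples in $\mathbb Z^I$, $\mathbf m\le\mathbf v$ means $\mathsf m_i\le\mathsf v_i$ for all $i$; $\cdot$ is the dot product on $\mathbb Z^I$. Root data. Fix a finite quiver $(I,E)$ with source and target maps $\mathsf s,\mathsf t:E\to I$ and no edge loops (multiple edges allowed), viewed as an orientation of a Dynkin diagram of symmetric Kac–Moody type. $C$ is its symmetric Cartan matrix: $C_{ii}=2$, and for $i\ne j$, $-C_{ij}$ is the number of arrows between $i$ and $j$ (in either direction). $P^\vee$ is the coweight lattice, with simple coroots $\alpha_i^\vee\in P^\vee$ (linearly independent), simple roots $\alpha_i$ and fundamental weights $\Lambda_i$ satisfying $\langle\alpha_j^\vee,\alpha_i\rangle=C_{ij}$, $\langle\alpha^\vee_j,\Lambda_i\rangle=\delta_{ij}$. $P^\vee_{++}=\{\lambda:\langle\lambda,\alpha_i\rangle\ge0\ \forall i\}$, and $\lambda\ge\mu$ means $\lambda-\mu\in\bigoplus_i\mathbb Z_{\ge0}\alpha_i^\vee$. Conicity condition. For $\lambda\ge\lambda'$ dominant put $\mathsf w_i=\langle\lambda,\alpha_i\rangle$, $\mathsf v''_i=\langle\lambda-\lambda',\Lambda_i\rangle$. Then $\lambda'$ satisfies the conicity condition for $\lambda$ if $\mathbf u\cdot(\mathbf w-C\mathbf v'')+\mathbf u\cdot(C\mathbf u)\ge1$ for all non-zero $\mathbf u\in\mathbb Z^I$ with $\mathbf 0\le\mathbf u\le\mathbf v''$. Slices. For $\lambda\in P^\vee_{++}$,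 $\mu\in P^\vee$, $\lambda\ge\mu$, put $\mathsf v_i=\langle\lambda-\mu,\Lambda_i\rangle$, $\mathsf w_i=\langle\lambda,\alpha_i\rangle$, take complex vector spaces $V_i,W_i$ of dimensions $\mathsf v_i,\mathsf w_i$ with bases chosen for the $V_i$, and set $$\mathbf G=\prod_i\mathbf{GL}(V_i),\qquad\mathbf N=\bigoplus_{a\in E}\mathrm{Hom}(V_{\mathsf s(a)},V_{\mathsf t(a)})\oplus\bigoplus_i\mathrm{Hom}(W_i,V_i).$$ With $\mathcal K=\mathbb C((t))$, $\mathcal O=\mathbb C[[t]]$, let $\mathcal R_{\mathbf G,\mathbf N}=\{(g,n)\in\mathbf G(\mathcal K)/\mathbf G(\mathcal O)\times\mathbf N(\mathcal O): gn\in\mathbf N(\mathcal O)\}$. The Braverman–Finkelberg–Nakajima (BFN) Coulomb branch algebra $\mathcal A(\mathbf G,\mathbf N)=H^{\mathbf G(\mathcal O)}_\bullet(\mathcal R_{\mathbf G,\mathbf N})$ (equivariant Borel–Moore homology with coefficients in $\Bbbk$, with the BFN convolution product) is a commutative finitely generated domain. The Kac–Moody affine Grassmannian slice is $\overline{\mathcal W}^\lambda_\mu=\mathrm{Spec}\,\mathcal A(\mathbf G,\mathbf N)$. GKLO embedding and FMOs. Let $\widetilde{\mathcal A}_{loc}$ be the localization of $\Bbbk[w_{i,r},\mathsf u_{i,r}^{\pm1}]_{i\in I,r\in[\mathsf v_i]}$ inverting all $w_{i,r}-w_{i,s}$, $r\neq s$. Equivariant localization to the diagonal torus $\mathbf T\subset\mathbf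 G$, followed by forgetting $\mathbf N$, gives an embedding $\mathcal A(\mathbf G,\mathbf N)\hookrightarrow(\widetilde{\mathcal A}_{loc})^{\prod_iS_{\mathsf v_i}}$, where the $w_{i,r}$ are the equivariant parameters of $\mathbf T$ and $\Bbbk[w_{i,r},\mathsf u_{i,r}^{\pm1}]=\mathcal A(\mathbf T,0)$. For $\mathbf 0\le\mathbf m\le\mathbf v$ let $\Lambda^{\mathbf v}_{\mathbf m}=\bigotimes_{i}\Bbbk[w_{i,1},\dots,w_{i,\mathsf v_i}]^{S_{\mathsf m_i}\times S_{\mathsf v_i-\mathsf m_i}}$. For $\Gamma=(\Gamma_i)$ with $\Gamma_i\subseteq[\mathsf v_i]$, $\#\Gamma_i=\mathsf m_i$, let $f|_\Gamma=\sigma(f)$ for any $\sigma\in\prod_iS_{\mathsf v_i}$ with $\sigma_i([\mathsf m_i])=\Gamma_i$, and $\mathsf u_\Gamma=\prod_i\prod_{r\in\Gamma_i}\mathsf u_{i,r}$. The FMOs are $$\mathsf M^+_{\mathbf m}(f)=\sum_\Gamma f|_\Gamma\frac{\prod_{a\in E}\prod_{r\in\Gamma_{\mathsf s(a)},s\notin\Gamma_{\mathsf t(a)}}(w_{\mathsf t(a),s}-w_{\mathsf s(a),r})}{\prod_i\prod_{r\in\Gamma_i,s\notin\Gamma_i}(w_{i,r}-w_{i,s})}\mathsf u_\Gamma,$$ $$\mathsf M^-_{\mathbf m}(f)=(-1)^{\sum_i\mathsf m_i\mathsf v_i+\sum_{a\in E}\mathsf m_{\mathsf s(a)}\mathsf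 v_{\mathsf t(a)}}\sum_\Gamma f|_\Gamma\frac{\prod_j\prod_{t\in\Gamma_j}w_{j,t}^{\mathsf w_j}\prod_{a\in E}\prod_{r\in\Gamma_{\mathsf t(a)},s\notin\Gamma_{\mathsf s(a)}}(w_{\mathsf t(a),r}-w_{\mathsf s(a),s})}{\prod_i\prod_{r\in\Gamma_i,s\notin\Gamma_i}(w_{i,s}-w_{i,r})}\mathsf u_\Gamma^{-1}.$$ It is known (BFN, Weekes) that the FMOs lie in, and generate, $\mathcal A(\mathbf G,\mathbf N)$; thus $\Bbbk[\overline{\mathcal W}^\lambda_\mu]$ is identified with the subalgebra of $\widetilde{\mathcal A}_{loc}$ generated by all FMOs. For $\overline{\mathcal W}^{\lambda'}_\mu$ the same definitions are used with $\lambda'$, $\mathbf v'$, $\mathsf w_i'=\langle\lambda',\alpha_i\rangle$ and the same quiver orientation. *)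

theory Defs
  imports
    "HOL-Library.FuncSet"
    "HOL-Library.Poly_Mapping"
    "HOL-Computational_Algebra.Fraction_Field"
    "HOL-Combinatorics.Permutations"
    "HOL-Algebra.RingHom"
    "HOL-Analysis.Abstract_Topology"
    "Graph_Theory.Digraph"
begin

section \<open>Root data\<close>

text \<open>
  A quiver is a \<open>pre_digraph\<close>: vertex set \<open>verts Q\<close>, arrow set \<open>arcs Q\<close>, source map \<open>tail Q\<close> and
  target map \<open>head Q\<close>.
\<close>

definition cartan :: "('i, 'e) pre_digraph \<Rightarrow> 'i \<Rightarrow> 'i \<Rightarrow> int" where
  "cartan Q i j =
     (if i = j then 2 else - int (card {a \<in> arcs Q. {tail Q a, head Q a} = {i, j}}))"

text \<open>
  The coweight lattice is the type \<open>'p\<close>, \<open>scale\<close> being its (unique) structure of \<open>\<int>\<close>-module.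
  Simple roots \<open>\<alpha> i\<close> and fundamental weights \<open>\<Lambda> i\<close> enter as linear forms on it, so
  \<open>\<alpha> i lam\<close> is the pairing of \<open>lam\<close> with the simple root, and \<open>coroot i\<close> is the simple coroot.
\<close>

locale root_datum = fin_digraph Q + loopfree_digraph Q + module scale
  for Q :: "('i, 'e) pre_digraph"
    and scale :: "int \<Rightarrow> 'p::ab_group_add \<Rightarrow> 'p" +
  fixes coroot :: "'i \<Rightarrow> 'p"
    and \<alpha> \<Lambda> :: "'i \<Rightarrow> 'p \<Rightarrow> int"
  assumes lattice: "\<exists>B. finite B \<and> independent B \<and> span B = UNIV"
    and coroot_inj: "inj_on coroot (verts Q)"
    and coroot_independent: "independent (coroot ` verts Q)"
    and simple_root_linear: "i \<in> verts Q \<Longrightarrow> module_hom scale (*) (\<alpha> i)"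
    and fund_weight_linear: "i \<in> verts Q \<Longrightarrow> module_hom scale (*) (\<Lambda> i)"
    and simple_root_coroot: "i \<in> verts Q \<Longrightarrow> j \<in> verts Q \<Longrightarrow> \<alpha> i (coroot j) = cartan Q i j"
    and fund_weight_coroot:
      "i \<in> verts Q \<Longrightarrow> j \<in> verts Q \<Longrightarrow> \<Lambda> i (coroot j) = (if i = j then 1 else 0)"

definition dominant :: "('i, 'e) pre_digraph \<Rightarrow> ('i \<Rightarrow> 'p \<Rightarrow> int) \<Rightarrow> 'p \<Rightarrow> bool" where
  "dominant Q \<alpha> lam \<longleftrightarrow> (\<forall>i\<in>verts Q. 0 \<le> \<alpha> i lam)"

definition dominance_le ::
  "('i, 'e) pre_digraph \<Rightarrow> (int \<Rightarrow> 'p \<Rightarrow> 'p) \<Rightarrow> ('i \<Rightarrow> 'p) \<Rightarrow> 'p \<Rightarrow> 'p::ab_group_add \<Rightarrow> bool" where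
  "dominance_le Q scale coroot mu lam \<longleftrightarrow>
     (\<exists>n :: 'i \<Rightarrow> nat. lam - mu = (\<Sum>i\<in>verts Q. scale (int (n i)) (coroot i)))"

definition conicity ::
  "('i, 'e) pre_digraph \<Rightarrow> ('i \<Rightarrow> 'p \<Rightarrow> int) \<Rightarrow> ('i \<Rightarrow> 'p \<Rightarrow> int) \<Rightarrow> 'p \<Rightarrow> 'p::ab_group_add \<Rightarrow> bool" where
  "conicity Q \<alpha> \<Lambda> lam lam' \<longleftrightarrow>
     (let w = (\<lambda>i. \<alpha> i lam); v'' = (\<lambda>i. \<Lambda> i (lam - lam'))
      in \<forall>u :: 'i \<Rightarrow> int.
           (\<forall>i\<in>verts Q. 0 \<le> u i \<and> u i \<le> v'' i) \<and> (\<exists>i\<in>verts Q. u i \<noteq> 0) \<longrightarrow>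
           (\<Sum>i\<in>verts Q. u i * (w i - (\<Sum>j\<in>verts Q. cartan Q i j * v'' j)))
             + (\<Sum>i\<in>verts Q. u i * (\<Sum>j\<in>verts Q. cartan Q i j * u j)) \<ge> 1)"


section \<open>The ambient algebra of the GKLO embedding\<close>

text \<open>
  \<open>Idx i r\<close> labels the variables \<open>w\<^bsub>i,r\<^esub>\<close> and \<open>u\<^bsub>i,r\<^esub>\<close>.  The library proves that polynomials over
  a domain form a domain only for linearly ordered variables, hence the arbitrary linear order
  below; nothing else depends on it.
\<close>

datatype 'i idx = Idx 'i nat

instantiation idx :: (type) linorder
begin

definition less_eq_idx :: "'a idx \<Rightarrow> 'a idx \<Rightarrow> bool" where
  "less_eq_idx x y \<longleftrightarrow> (x, y) \<in> (SOME R. well_order_on UNIV R)"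

definition less_idx :: "'a idx \<Rightarrow> 'a idx \<Rightarrow> bool" where
  "less_idx x y \<longleftrightarrow> x \<le> y \<and> \<not> y \<le> x"

instance
proof -
  define R :: "'a idx rel" where "R = (SOME R. well_order_on UNIV R)"
  have le: "x \<le> y \<longleftrightarrow> (x, y) \<in> R" for x y
    by (simp only: less_eq_idx_def R_def)
  have "well_order_on UNIV R"
    unfolding R_def by (rule someI_ex) (rule well_order_on)
  then have R: "refl R" "trans R" "antisym R" "total R"
    by (auto simp: order_on_defs)
  show "OFCLASS('a idx, linorder_class)"
  proof
    fix x y z :: "'a idx"
    show "x < y \<longleftrightarrow> x \<le> y \<and> \<not> y \<le> x" by (rule less_idx_def)
    show "x \<le> x" using R(1) by (simp add: le refl_on_def)
    show "x \<le> y \<Longrightarrow> y \<le> z \<Longrightarrow> x \<le> z" using R(2) by (auto simp: le elim: transE)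
    show "x \<le> y \<Longrightarrow> y \<le> x \<Longrightarrow> x = y" using R(3) by (auto simp: le dest: antisymD)
    show "x \<le> y \<or> y \<le> x" using R(1,4) by (cases "x = y") (auto simp: le total_on_def refl_on_def)
  qed
qed

end

text \<open>
  \<open>('i, 'k) wpoly\<close> is the polynomial ring over \<open>'k\<close> in all variables \<open>w\<^bsub>i,r\<^esub>\<close>, and \<open>('i, 'k) loc\<close>
  is the ring of Laurent polynomials in all \<open>u\<^bsub>i,r\<^esub>\<close> over its field of fractions.  It contains, for
  every dimension vector, the localization of \<open>'k[w\<^bsub>i,r\<^esub>, u\<^bsub>i,r\<^esub>\<^sup>\<plusminus>]\<close> at the differences
  \<open>w\<^bsub>i,r\<^esub> - w\<^bsub>i,s\<^esub>\<close>; the only denominators used below are products of such differences, so all the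
  subalgebras considered are subalgebras of that localization.
\<close>

type_synonym ('i, 'k) wpoly = "('i idx \<Rightarrow>\<^sub>0 nat) \<Rightarrow>\<^sub>0 'k"
type_synonym ('i, 'k) loc = "('i idx \<Rightarrow>\<^sub>0 int) \<Rightarrow>\<^sub>0 ('i, 'k) wpoly fract"

definition pconst :: "'k::field \<Rightarrow> ('i, 'k) wpoly" where
  "pconst c = Poly_Mapping.single 0 c"

definition wvar :: "'i \<Rightarrow> nat \<Rightarrow> ('i, 'k::field) wpoly" where
  "wvar i r = Poly_Mapping.single (Poly_Mapping.single (Idx i r) 1) 1"

definition pvars :: "('i, 'k::field) wpoly \<Rightarrow> 'i idx set" where
  "pvars p = (\<Union>mon\<in>Poly_Mapping.keys p. Poly_Mapping.keys mon)"

definition psubst ::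
  "('i \<Rightarrow> nat \<Rightarrow> ('i, 'k) wpoly) \<Rightarrow> ('i, 'k::field) wpoly \<Rightarrow> ('i, 'k) wpoly" where
  "psubst \<theta> p =
     (\<Sum>mon\<in>Poly_Mapping.keys p. pconst (Poly_Mapping.lookup p mon) *
        (\<Prod>x\<in>Poly_Mapping.keys mon. (case x of Idx i r \<Rightarrow> \<theta> i r) ^ Poly_Mapping.lookup mon x))"

definition scalar :: "'k::field \<Rightarrow> ('i, 'k) loc" where
  "scalar c = Poly_Mapping.single 0 (Fraction_Field.Fract (pconst c) 1)"

inductive_set subalgebra_gen :: "('i, 'k::field) loc set \<Rightarrow> ('i, 'k) loc set"
  for S :: "('i, 'k) loc set" where
  "scalar c \<in> subalgebra_gen S"
| "x \<in> S \<Longrightarrow> x \<in> subalgebra_gen S"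
| "x \<in> subalgebra_gen S \<Longrightarrow> y \<in> subalgebra_gen S \<Longrightarrow> x + y \<in> subalgebra_gen S"
| "x \<in> subalgebra_gen S \<Longrightarrow> y \<in> subalgebra_gen S \<Longrightarrow> x * y \<in> subalgebra_gen S"


section \<open>Fundamental monopole operators\<close>

definition partially_symmetric :: "nat \<Rightarrow> nat \<Rightarrow> 'i \<Rightarrow> ('i, 'k::field) wpoly set" where
  "partially_symmetric n k i =
     {p. pvars p \<subseteq> Idx i ` {1..n} \<and>
         (\<forall>\<sigma>. \<sigma> permutes {1..n} \<and> \<sigma> ` {1..k} = {1..k} \<longrightarrow> psubst (\<lambda>j r. wvar j (\<sigma> r)) p = p)}"

text \<open>
  The tensor product over the vertices of these rings, realised by multiplication inside the
  polynomial ring in all the variables.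
\<close>

definition Lambda_ring ::
  "('i, 'e) pre_digraph \<Rightarrow> ('i \<Rightarrow> nat) \<Rightarrow> ('i \<Rightarrow> nat) \<Rightarrow> ('i, 'k::field) wpoly set" where
  "Lambda_ring Q v m =
     {(\<Sum>l<n. pconst (c l) * (\<Prod>i\<in>verts Q. g l i)) | (n::nat) c g.
        \<forall>l<n. \<forall>i\<in>verts Q. g l i \<in> partially_symmetric (v i) (m i) i}"

definition subset_tuples ::
  "('i, 'e) pre_digraph \<Rightarrow> ('i \<Rightarrow> nat) \<Rightarrow> ('i \<Rightarrow> nat) \<Rightarrow> ('i \<Rightarrow> nat set) set" where
  "subset_tuples Q v m = (\<Pi>\<^sub>E i\<in>verts Q. {S. S \<subseteq> {1..v i} \<and> card S = m i})"

text \<open>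
  For \<open>f\<close> in \<open>Lambda_ring Q v m\<close> the result does not depend on the permutation chosen.
\<close>

definition restrict_poly ::
  "('i, 'e) pre_digraph \<Rightarrow> ('i \<Rightarrow> nat) \<Rightarrow> ('i \<Rightarrow> nat) \<Rightarrow> ('i \<Rightarrow> nat set) \<Rightarrow>
     ('i, 'k::field) wpoly \<Rightarrow> ('i, 'k) wpoly" where
  "restrict_poly Q v m \<Gamma> f =
     (let \<sigma> = SOME \<sigma>. \<forall>i\<in>verts Q. \<sigma> i permutes {1..v i} \<and> \<sigma> i ` {1..m i} = \<Gamma> i
      in psubst (\<lambda>i r. wvar i (\<sigma> i r)) f)"

definition uexp :: "('i, 'e) pre_digraph \<Rightarrow> ('i \<Rightarrow> nat set) \<Rightarrow> ('i idx \<Rightarrow>\<^sub>0 int)" where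
  "uexp Q \<Gamma> = (\<Sum>i\<in>verts Q. \<Sum>r\<in>\<Gamma> i. Poly_Mapping.single (Idx i r) 1)"

definition fmo_plus ::
  "('i, 'e) pre_digraph \<Rightarrow> ('i \<Rightarrow> nat) \<Rightarrow> ('i \<Rightarrow> nat) \<Rightarrow> ('i, 'k::field) wpoly \<Rightarrow> ('i, 'k) loc" where
  "fmo_plus Q v m f =
     (\<Sum>\<Gamma>\<in>subset_tuples Q v m.
        Poly_Mapping.single (uexp Q \<Gamma>)
          (Fraction_Field.Fract
            (restrict_poly Q v m \<Gamma> f *
             (\<Prod>a\<in>arcs Q. \<Prod>r\<in>\<Gamma> (tail Q a). \<Prod>s\<in>{1..v (head Q a)} - \<Gamma> (head Q a).
                wvar (head Q a) s - wvar (tail Q a) r))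
            (\<Prod>i\<in>verts Q. \<Prod>r\<in>\<Gamma> i. \<Prod>s\<in>{1..v i} - \<Gamma> i. wvar i r - wvar i s)))"

definition fmo_minus ::
  "('i, 'e) pre_digraph \<Rightarrow> ('i \<Rightarrow> nat) \<Rightarrow> ('i \<Rightarrow> nat) \<Rightarrow> ('i \<Rightarrow> nat) \<Rightarrow>
     ('i, 'k::field) wpoly \<Rightarrow> ('i, 'k) loc" where
  "fmo_minus Q v w m f =
     (-1) ^ ((\<Sum>i\<in>verts Q. m i * v i) + (\<Sum>a\<in>arcs Q. m (tail Q a) * v (head Q a))) *
     (\<Sum>\<Gamma>\<in>subset_tuples Q v m.
        Poly_Mapping.single (- uexp Q \<Gamma>)
          (Fraction_Field.Fract
            (restrict_poly Q v m \<Gamma> f *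
             (\<Prod>j\<in>verts Q. \<Prod>t\<in>\<Gamma> j. wvar j t ^ w j) *
             (\<Prod>a\<in>arcs Q. \<Prod>r\<in>\<Gamma> (head Q a). \<Prod>s\<in>{1..v (tail Q a)} - \<Gamma> (tail Q a).
                wvar (head Q a) r - wvar (tail Q a) s))
            (\<Prod>i\<in>verts Q. \<Prod>r\<in>\<Gamma> i. \<Prod>s\<in>{1..v i} - \<Gamma> i. wvar i s - wvar i r)))"

text \<open>
  The coordinate ring of the slice with dimension vectors \<open>v\<close>, \<open>w\<close>: the Coulomb branch algebra in
  its GKLO realisation, that is, the subalgebra generated by all fundamental monopole operators.
\<close>

definition slice_ring ::
  "('i, 'e) pre_digraph \<Rightarrow> ('i \<Rightarrow> nat) \<Rightarrow> ('i \<Rightarrow> nat) \<Rightarrow> ('i, 'k::field) loc ring" where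
  "slice_ring Q v w =
     \<lparr>carrier = subalgebra_gen
        (\<Union>m\<in>{m. \<forall>i\<in>verts Q. m i \<le> v i}.
           fmo_plus Q v m ` Lambda_ring Q v m \<union> fmo_minus Q v w m ` Lambda_ring Q v m),
      mult = (*), one = 1, zero = 0, add = (+)\<rparr>"

text \<open>The specialisation setting \<open>w\<^bsub>i,r\<^esub> = 0\<close> for \<open>r > v' i\<close>.\<close>

definition truncate_poly :: "('i \<Rightarrow> nat) \<Rightarrow> ('i, 'k::field) wpoly \<Rightarrow> ('i, 'k) wpoly" where
  "truncate_poly v' f = psubst (\<lambda>i r. if r > v' i then 0 else wvar i r) f"


section \<open>Closed embeddings of affine schemes\<close>

definition zariski :: "('a, 'm) ring_scheme \<Rightarrow> 'a set topology" where
  "zariski R =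
     topology (\<lambda>U. \<exists>E. E \<subseteq> carrier R \<and> U = {P. primeideal P R \<and> \<not> E \<subseteq> P})"

lemma openin_zariski:
  "openin (zariski R) U \<longleftrightarrow> (\<exists>E. E \<subseteq> carrier R \<and> U = {P. primeideal P R \<and> \<not> E \<subseteq> P})"
proof -
  let ?D = "\<lambda>E. {P. primeideal P R \<and> \<not> E \<subseteq> P}"
  let ?L = "\<lambda>U. \<exists>E. E \<subseteq> carrier R \<and> U = ?D E"
  have "istopology ?L"
    unfolding istopology_def
  proof (intro conjI allI impI)
    fix S T assume "?L S" "?L T"
    then obtain E F where E: "E \<subseteq> carrier R" "S = ?D E" and F: "F \<subseteq> carrier R" "T = ?D F"
      by blast
    show "?L (S \<inter> T)"
    proof (cases "\<exists>P. primeideal P R")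
      case False
      then show ?thesis using E by blast
    next
      case True
      then obtain P0 where "primeideal P0 R" by blast
      then interpret cring R by (simp add: primeideal_def)
      let ?G = "{a \<otimes>\<^bsub>R\<^esub> b | a b. a \<in> E \<and> b \<in> F}"
      have "?G \<subseteq> carrier R" using E(1) F(1) by auto
      moreover have G: "(\<not> ?G \<subseteq> P) \<longleftrightarrow> \<not> E \<subseteq> P \<and> \<not> F \<subseteq> P" if "primeideal P R" for P
      proof -
        interpret P: primeideal P R by fact
        show ?thesis
        proof
          assume "\<not> ?G \<subseteq> P"
          then show "\<not> E \<subseteq> P \<and> \<not> F \<subseteq> P"
            using E(1) F(1) P.I_l_closed P.I_r_closed by blast
        next
          assume "\<not> E \<subseteq> P \<and> \<not> F \<subseteq> P"
          then obtain a b where "a \<in> E" "a \<notin> P" "b \<in> F" "b \<notin> P" by blast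
          then have "a \<otimes>\<^bsub>R\<^esub> b \<notin> P" using P.I_prime E(1) F(1) by blast
          then show "\<not> ?G \<subseteq> P" using \<open>a \<in> E\<close> \<open>b \<in> F\<close> by blast
        qed
      qed
      moreover have "S \<inter> T = ?D ?G" unfolding E(2) F(2) using G by blast
      ultimately show ?thesis by blast
    qed
  next
    fix \<K> assume "\<forall>K\<in>\<K>. ?L K"
    then obtain e where e: "\<And>K. K \<in> \<K> \<Longrightarrow> e K \<subseteq> carrier R \<and> K = ?D (e K)"
      by metis
    have "\<Union>\<K> = ?D (\<Union>K\<in>\<K>. e K)"
    proof (rule Set.set_eqI)
      fix P
      have "P \<in> \<Union>\<K> \<longleftrightarrow> (\<exists>K\<in>\<K>. P \<in> ?D (e K))" using e by blast
      then show "P \<in> \<Union>\<K> \<longleftrightarrow> P \<in> ?D (\<Union>K\<in>\<K>. e K)" by blast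
    qed
    then show "?L (\<Union>\<K>)" using e by (intro exI[of _ "\<Union>K\<in>\<K>. e K"]) auto
  qed
  then show ?thesis
    by (simp add: zariski_def topology_inverse')
qed

text \<open>
  A morphism from \<open>Spec B\<close> to \<open>Spec A\<close> is given by its restriction map \<open>\<phi>\<close> from \<open>A\<close> to \<open>B\<close>, and
  sends a prime \<open>q\<close> to its preimage.
\<close>

definition spec_map :: "('a, 'm) ring_scheme \<Rightarrow> ('a \<Rightarrow> 'b) \<Rightarrow> 'b set \<Rightarrow> 'a set" where
  "spec_map A \<phi> q = {a \<in> carrier A. \<phi> a \<in> q}"

text \<open>
  Surjectivity of the map of stalks at \<open>q\<close>, from the localization of \<open>A\<close> at the preimage of \<open>q\<close> to
  the localization of \<open>B\<close> at \<open>q\<close>: every fraction \<open>b / s\<close> equals some \<open>\<phi> a / \<phi> t\<close> in the latter.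
\<close>

definition stalk_surjective ::
  "('a, 'm) ring_scheme \<Rightarrow> ('b, 'n) ring_scheme \<Rightarrow> ('a \<Rightarrow> 'b) \<Rightarrow> 'b set \<Rightarrow> bool" where
  "stalk_surjective A B \<phi> q \<longleftrightarrow>
     (\<forall>b\<in>carrier B. \<forall>s\<in>carrier B - q. \<exists>a\<in>carrier A. \<exists>t\<in>carrier A - spec_map A \<phi> q.
        \<exists>x\<in>carrier B - q. x \<otimes>\<^bsub>B\<^esub> (\<phi> a \<otimes>\<^bsub>B\<^esub> s) = x \<otimes>\<^bsub>B\<^esub> (\<phi> t \<otimes>\<^bsub>B\<^esub> b))"

text \<open>
  A closed immersion of schemes is a morphism which is a homeomorphism onto a closed subset and for
  which the map from the structure sheaf of the target to the pushforward of the structure sheaf of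
  the source is surjective.  The stalks of the pushforward vanish off the closed image, so it
  suffices to look at the stalks at points of the source.
\<close>

definition closed_immersion ::
  "('a, 'm) ring_scheme \<Rightarrow> ('b, 'n) ring_scheme \<Rightarrow> ('a \<Rightarrow> 'b) \<Rightarrow> bool" where
  "closed_immersion A B \<phi> \<longleftrightarrow>
     \<phi> \<in> ring_hom A B \<and>
     embedding_map (zariski B) (zariski A) (spec_map A \<phi>) \<and>
     closedin (zariski A) (spec_map A \<phi> ` topspace (zariski B)) \<and>
     (\<forall>q. primeideal q B \<longrightarrow> stalk_surjective A B \<phi> q)"

end

theory Submission
  imports Defs "HOL-Computational_Algebra.Formal_Laurent_Series"
begin

text \<open>
  Call an index \<open>r\<close> at a vertex \<open>i\<close> visible if \<open>r \<le> v' i\<close> and hidden otherwise.  The restriction map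
  is the limit \<open>t \<rightarrow> 0\<close> of the substitution which fixes the visible variables and sends the hidden ones
  to \<open>t\<^sup>2 w\<^bsub>i,r\<^esub>\<close> and \<open>t^c\<^bsub>i\<^esub> u\<^bsub>i,r\<^esub>\<close>, for suitable integers \<open>c\<^bsub>i\<^esub>\<close>.  Such a limit is automatically a
  ring homomorphism on the elements that have no pole at \<open>t = 0\<close> (\<open>regular_mult\<close>, \<open>limit_mult\<close>), so
  that no relation between monopole operators has to be known.

  The summands of a monopole operator are considered one at a time.  In the summand of a tuple \<open>\<Gamma>\<close> that
  has \<open>d\<^bsub>i\<^esub>\<close> hidden elements at the vertex \<open>i\<close>, the linear factors that are divisible by \<open>t\<close> are those
  which involve hidden indices only, and counting them gives an order in \<open>t\<close> which is quadratic in \<open>d\<close>.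
  Put \<open>v'' = v - v'\<close>.  The orders for \<open>M\<^sup>+\<close> and for \<open>M\<^sup>-\<close> add up to twice the form
  \<open>d \<cdot> (w - C v'') + d \<cdot> C d\<close> of the conicity condition, and their difference is linear in \<open>d\<close>.  The
  charges \<open>c\<^bsub>i\<^esub>\<close> are chosen to balance this difference; then both orders are equal to that form
  (\<open>plus_order\<close>, \<open>minus_order\<close>).  The conicity condition therefore says that every summand with a
  hidden index tends to \<open>0\<close>, while the others have no pole.

  A summand with visible \<open>\<Gamma>\<close> tends to the corresponding summand for \<open>v'\<close>, up to factors
  \<open>\<plusminus>w\<^bsub>i,r\<^esub>\<close> that come from the differences with one hidden index.  These factors are multiplicative in the
  exponent of \<open>u\<close> and are removed by rescaling the \<open>u\<^bsub>i,r\<^esub>\<close>.  One rescaling serves both signs because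
  \<open>w' = w - C v''\<close> (\<open>framing_shift\<close>).  Hence the limit sends monopole operators to monopole operators or
  to \<open>0\<close>.  It is surjective since partially symmetric polynomials lift
  (\<open>partially_symmetric_lift\<close>), and a surjective ring homomorphism induces a closed immersion of
  spectra.
\<close>

section \<open>Evaluating polynomials\<close>

locale ring_map =
  fixes F :: "'a::comm_ring_1 \<Rightarrow> 'b::comm_ring_1"
  assumes map_one: "F 1 = 1"
    and map_add: "F (x + y) = F x + F y"
    and map_mult: "F (x * y) = F x * F y"
begin

lemma map_zero: "F 0 = 0"
  using map_add[of 0 0] by simp

lemma map_uminus: "F (- x) = - F x"
  using map_add[of x "- x"] by (simp add: map_zero eq_neg_iff_add_eq_0 add.commute)

lemma map_diff: "F (x - y) = F x - F y"
  using map_add[of x "- y"] by (simp add: map_uminus)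

lemma map_power: "F (x ^ n) = F x ^ n"
  by (induction n) (simp_all add: map_one map_mult)

lemma map_sum: "F (sum g A) = (\<Sum>a\<in>A. F (g a))"
  by (induction A rule: infinite_finite_induct) (simp_all add: map_zero map_add)

lemma map_prod: "F (prod g A) = (\<Prod>a\<in>A. F (g a))"
  by (induction A rule: infinite_finite_induct) (simp_all add: map_one map_mult)

end

lemma ring_map_comp: "ring_map F \<Longrightarrow> ring_map G \<Longrightarrow> ring_map (\<lambda>x. F (G x))"
  by (simp add: ring_map_def)

definition mono_eval :: "('x \<Rightarrow> 'a::comm_ring_1) \<Rightarrow> ('x \<Rightarrow>\<^sub>0 nat) \<Rightarrow> 'a" where
  "mono_eval \<theta> e = (\<Prod>x\<in>Poly_Mapping.keys e. \<theta> x ^ Poly_Mapping.lookup e x)"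

definition poly_eval ::
  "('k \<Rightarrow> 'a) \<Rightarrow> ('x \<Rightarrow> 'a) \<Rightarrow> (('x \<Rightarrow>\<^sub>0 nat) \<Rightarrow>\<^sub>0 'k::comm_ring_1) \<Rightarrow> 'a::comm_ring_1" where
  "poly_eval h \<theta> p = (\<Sum>e\<in>Poly_Mapping.keys p. h (Poly_Mapping.lookup p e) * mono_eval \<theta> e)"

lemma mono_eval_superset:
  assumes "finite A" "Poly_Mapping.keys e \<subseteq> A"
  shows "mono_eval \<theta> e = (\<Prod>x\<in>A. \<theta> x ^ Poly_Mapping.lookup e x)"
  unfolding mono_eval_def by (rule prod.mono_neutral_left) (use assms in \<open>auto simp: in_keys_iff\<close>)

lemma mono_eval_zero [simp]: "mono_eval \<theta> 0 = 1"
  by (simp add: mono_eval_def)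

lemma mono_eval_single [simp]: "mono_eval \<theta> (Poly_Mapping.single x n) = \<theta> x ^ n"
  by (cases "n = 0") (simp_all add: mono_eval_def)

lemma mono_eval_add: "mono_eval \<theta> (a + b) = mono_eval \<theta> a * mono_eval \<theta> b"
proof -
  let ?A = "Poly_Mapping.keys a \<union> Poly_Mapping.keys b"
  have "mono_eval \<theta> c = (\<Prod>x\<in>?A. \<theta> x ^ Poly_Mapping.lookup c x)" if "c \<in> {a, b, a + b}" for c
    by (rule mono_eval_superset) (use that keys_add[of a b] in auto)
  then show ?thesis
    by (simp add: lookup_add power_add prod.distrib)
qed

lemma poly_eval_superset:
  assumes "finite A" "Poly_Mapping.keys p \<subseteq> A" "h 0 = 0"
  shows "poly_eval h \<theta> p = (\<Sum>e\<in>A. h (Poly_Mapping.lookup p e) * mono_eval \<theta> e)"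
  unfolding poly_eval_def
  by (rule sum.mono_neutral_left) (use assms in \<open>auto simp: in_keys_iff\<close>)

lemma poly_mapping_sum_single:
  "(p :: 'a \<Rightarrow>\<^sub>0 'b::comm_monoid_add) = (\<Sum>e\<in>Poly_Mapping.keys p. Poly_Mapping.single e (Poly_Mapping.lookup p e))"
proof (rule poly_mapping_eqI)
  fix k
  have "Poly_Mapping.lookup (\<Sum>e\<in>Poly_Mapping.keys p. Poly_Mapping.single e (Poly_Mapping.lookup p e)) k
     = (\<Sum>e\<in>Poly_Mapping.keys p. if e = k then Poly_Mapping.lookup p e else 0)"
    by (simp add: lookup_sum lookup_single when_def)
  then show "Poly_Mapping.lookup p k = Poly_Mapping.lookup (\<Sum>e\<in>Poly_Mapping.keys p. Poly_Mapping.single e (Poly_Mapping.lookup p e)) k"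
    by (simp add: in_keys_iff)
qed

lemma poly_mapping_induct_single:
  fixes p :: "'a \<Rightarrow>\<^sub>0 'b::comm_monoid_add"
  assumes "P 0" "\<And>a c. P (Poly_Mapping.single a c)" "\<And>p q. P p \<Longrightarrow> P q \<Longrightarrow> P (p + q)"
  shows "P p"
proof -
  have "P (\<Sum>a\<in>A. Poly_Mapping.single a (f a))" for A f
    by (induction A rule: infinite_finite_induct) (use assms in auto)
  from this[of "Poly_Mapping.lookup p" "Poly_Mapping.keys p"] show ?thesis
    by (simp only: poly_mapping_sum_single[symmetric])
qed

text \<open>
  Multiplicativity of an additive map can be checked on monomials, by distributivity in each argument.
\<close>

lemma additive_mult_from_singles:
  fixes F :: "('a::monoid_add \<Rightarrow>\<^sub>0 'b::comm_ring_1) \<Rightarrow> 'c::comm_ring_1"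
  assumes add: "\<And>x y. F (x + y) = F x + F y"
    and single: "\<And>a b c d. F (Poly_Mapping.single (a + b) (c * d)) =
      F (Poly_Mapping.single a c) * F (Poly_Mapping.single b d)"
  shows "F (x * y) = F x * F y"
proof -
  have zero: "F 0 = 0" using add[of 0 0] by simp
  have left: "F (Poly_Mapping.single a c * y) = F (Poly_Mapping.single a c) * F y" for a c
    by (induction y rule: poly_mapping_induct_single)
       (simp_all add: zero mult_single single add distrib_left)
  show ?thesis
    by (induction x rule: poly_mapping_induct_single)
       (simp_all add: zero left add distrib_right)
qed

lemma poly_eval_single:
  assumes "h 0 = 0"
  shows "poly_eval h \<theta> (Poly_Mapping.single e c) = h c * mono_eval \<theta> e"
  by (cases "c = 0") (simp_all add: poly_eval_def assms)

lemma ring_map_poly_eval: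
  assumes "ring_map h"
  shows "ring_map (poly_eval h \<theta>)"
proof -
  interpret h: ring_map h by fact
  have add: "poly_eval h \<theta> (p + q) = poly_eval h \<theta> p + poly_eval h \<theta> q" for p q
  proof -
    let ?A = "Poly_Mapping.keys p \<union> Poly_Mapping.keys q"
    have "poly_eval h \<theta> c = (\<Sum>e\<in>?A. h (Poly_Mapping.lookup c e) * mono_eval \<theta> e)"
      if "c \<in> {p, q, p + q}" for c
      by (rule poly_eval_superset) (use that keys_add[of p q] h.map_zero in auto)
    then show ?thesis
      by (simp add: lookup_add h.map_add distrib_right sum.distrib)
  qed
  show ?thesis
  proof
    show "poly_eval h \<theta> 1 = 1"
      by (simp add: poly_eval_def h.map_one)
    show "poly_eval h \<theta> (p * q) = poly_eval h \<theta> p * poly_eval h \<theta> q" for p q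
      by (rule additive_mult_from_singles)
         (simp_all add: add poly_eval_single h.map_zero h.map_mult mono_eval_add mult_ac)
  qed (rule add)
qed

lemma single_mult_mono:
  "Poly_Mapping.single (a + b) (1::'k::comm_ring_1) = Poly_Mapping.single a 1 * Poly_Mapping.single b 1"
  by (simp add: mult_single)

lemma single_eq_pconst_mult: "Poly_Mapping.single e c = pconst c * Poly_Mapping.single e 1"
  by (simp add: mult_single pconst_def)

lemma single_single_eq_wvar_power:
  "Poly_Mapping.single (Poly_Mapping.single (Idx i r) n) 1 = (wvar i r :: ('i, 'k::field) wpoly) ^ n"
proof (induction n)
  case (Suc n)
  have "Poly_Mapping.single (Idx i r) (Suc n) = Poly_Mapping.single (Idx i r) (1::nat) + Poly_Mapping.single (Idx i r) n"
    by (simp add: single_add[symmetric])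
  then show ?case by (simp only: single_mult_mono Suc power_Suc wvar_def)
qed simp

lemma wpoly_induct [case_names pconst wvar add mult]:
  fixes p :: "('i, 'k::field) wpoly"
  assumes pconst: "\<And>c. P (pconst c)" and wvar: "\<And>i r. P (wvar i r)"
    and add: "\<And>p q. P p \<Longrightarrow> P q \<Longrightarrow> P (p + q)" and mult: "\<And>p q. P p \<Longrightarrow> P q \<Longrightarrow> P (p * q)"
  shows "P p"
proof -
  have one: "P 1" using pconst[of 1] by (simp add: pconst_def)
  have mono: "P (Poly_Mapping.single e 1)" for e
  proof (induction e rule: poly_mapping_induct_single)
    case (2 x n)
    obtain i r where x: "x = Idx i r" by (cases x)
    have "P (wvar i r ^ n)" by (induction n) (simp_all add: one mult wvar)
    then show ?case by (simp only: x single_single_eq_wvar_power)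
  qed (simp_all only: one single_mult_mono mult single_one)
  show ?thesis
  proof (induction p rule: poly_mapping_induct_single)
    case 1
    then show ?case using pconst[of 0] by (simp add: pconst_def)
  next
    case (2 e c)
    then show ?case by (subst single_eq_pconst_mult) (intro mult pconst mono)
  qed (rule add)
qed

lemma ring_map_poly_eqI:
  fixes F G :: "('i, 'k::field) wpoly \<Rightarrow> 'a::comm_ring_1"
  assumes "ring_map F" "ring_map G"
    and "\<And>c. F (pconst c) = G (pconst c)" "\<And>i r. F (wvar i r) = G (wvar i r)"
  shows "F p = G p"
  by (induction p rule: wpoly_induct)
     (simp_all add: assms(3,4) ring_map.map_add[OF assms(1)] ring_map.map_add[OF assms(2)]
       ring_map.map_mult[OF assms(1)] ring_map.map_mult[OF assms(2)])

lemma psubst_eq_poly_eval: "psubst \<theta> = poly_eval pconst (\<lambda>x. case x of Idx i r \<Rightarrow> \<theta> i r)"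
  by (intro ext) (simp add: psubst_def poly_eval_def mono_eval_def)

lemma ring_map_pconst: "ring_map (pconst :: 'k::field \<Rightarrow> ('i, 'k) wpoly)"
  by unfold_locales (simp_all add: pconst_def single_add mult_single)

lemma ring_map_psubst: "ring_map (psubst \<theta>)"
  unfolding psubst_eq_poly_eval by (rule ring_map_poly_eval) (rule ring_map_pconst)

lemma poly_eval_pconst [simp]: "h 0 = 0 \<Longrightarrow> poly_eval h \<theta> (pconst c) = h c"
  by (simp add: pconst_def poly_eval_single)

lemma poly_eval_wvar [simp]: "ring_map h \<Longrightarrow> poly_eval h \<theta> (wvar i r) = \<theta> (Idx i r)"
  by (simp add: wvar_def poly_eval_single ring_map.map_zero ring_map.map_one)

lemma psubst_pconst [simp]: "psubst \<theta> (pconst c) = pconst c"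
  by (simp add: psubst_eq_poly_eval pconst_def poly_eval_single)

lemma psubst_wvar [simp]: "psubst \<theta> (wvar i r) = \<theta> i r"
  by (simp add: psubst_eq_poly_eval ring_map_pconst)

lemma psubst_psubst: "psubst \<theta> (psubst \<eta> p) = psubst (\<lambda>i r. psubst \<theta> (\<eta> i r)) p"
  by (rule ring_map_poly_eqI)
     (simp_all add: ring_map_psubst ring_map_comp[OF ring_map_psubst ring_map_psubst])

lemma psubst_cong:
  assumes "\<And>i r. Idx i r \<in> pvars p \<Longrightarrow> \<theta> i r = \<eta> i r"
  shows "psubst \<theta> p = psubst \<eta> p"
  unfolding psubst_def
proof (intro sum.cong refl arg_cong2[where f = times] prod.cong)
  fix e x
  assume "e \<in> Poly_Mapping.keys p" "x \<in> Poly_Mapping.keys e"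
  then have "x \<in> pvars p" by (auto simp: pvars_def)
  then show "(case x of Idx i r \<Rightarrow> \<theta> i r) ^ Poly_Mapping.lookup e x = (case x of Idx i r \<Rightarrow> \<eta> i r) ^ Poly_Mapping.lookup e x"
    using assms by (cases x) auto
qed

lemma psubst_id: "psubst wvar p = p"
  by (rule ring_map_poly_eqI[OF ring_map_psubst]) (simp_all add: ring_map_def)

abbreviation to_fract :: "'a::idom \<Rightarrow> 'a fract" where
  "to_fract p \<equiv> Fraction_Field.Fract p 1"

lemma ring_map_to_fract: "ring_map to_fract"
  by unfold_locales (simp_all add: One_fract_def)

lemma to_fract_eq_0_iff [simp]: "to_fract p = 0 \<longleftrightarrow> p = 0"
  by (simp add: Zero_fract_def eq_fract)

lemma Fract_eq_divide: "Fraction_Field.Fract p q = to_fract p / to_fract q"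
  by simp

lemma wvar_eq_iff: "(wvar i r :: ('i, 'k::field) wpoly) = wvar j s \<longleftrightarrow> i = j \<and> r = s"
proof
  assume "(wvar i r :: ('i, 'k) wpoly) = wvar j s"
  then have "Poly_Mapping.keys (wvar i r :: ('i, 'k) wpoly) = Poly_Mapping.keys (wvar j s :: ('i, 'k) wpoly)"
    by (rule arg_cong)
  then have "Poly_Mapping.single (Idx i r) (1::nat) = Poly_Mapping.single (Idx j s) 1"
    by (simp add: wvar_def)
  then have "Poly_Mapping.keys (Poly_Mapping.single (Idx i r) (1::nat)) = Poly_Mapping.keys (Poly_Mapping.single (Idx j s) (1::nat))"
    by (rule arg_cong)
  then have "Idx i r = Idx j s" by simp
  then show "i = j \<and> r = s" by simp
qed simp

lemma wvar_ne_0 [simp]: "(wvar i r :: ('i, 'k::field) wpoly) \<noteq> 0"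
  by (metis lookup_single_eq lookup_zero wvar_def zero_neq_one)


unbundle fps_syntax

section \<open>Leading coefficients of Laurent series\<close>

text \<open>
  The coefficient \<open>c\<close> may be \<open>0\<close>, so that \<open>n\<close> is only a lower bound for the order of \<open>x\<close>.  With this
  convention the relation is compatible with sums, products and, for nonzero \<open>c\<close> in the denominator,
  quotients, without case distinctions on cancellation.
\<close>

definition leading :: "int \<Rightarrow> 'a::field fls \<Rightarrow> 'a \<Rightarrow> bool" where
  "leading n x c \<longleftrightarrow> (\<forall>k<n. x $$ k = 0) \<and> x $$ n = c"

lemma leadingD: "leading n x c \<Longrightarrow> x $$ n = c"
  by (simp add: leading_def)

lemma leading_add: "leading n x c \<Longrightarrow> leading n y d \<Longrightarrow> leading n (x + y) (c + d)"
  by (simp add: leading_def)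

lemma leading_uminus: "leading n x c \<Longrightarrow> leading n (- x) (- c)"
  by (simp add: leading_def)

lemma leading_diff: "leading n x c \<Longrightarrow> leading n y d \<Longrightarrow> leading n (x - y) (c - d)"
  by (simp add: leading_def)

lemma leading_zero: "leading n 0 0"
  by (simp add: leading_def)

lemma leading_weaken: "leading n x c \<Longrightarrow> m < n \<Longrightarrow> leading m x 0"
  by (simp add: leading_def)

lemma leading_const: "leading 0 (fls_const c) c"
  by (simp add: leading_def)

lemma leading_one: "leading 0 1 1"
  by (simp add: leading_def)

lemma leading_subdegree:
  assumes "leading n x c" "x \<noteq> 0"
  shows "n \<le> fls_subdegree x" "c \<noteq> 0 \<Longrightarrow> fls_subdegree x = n"
  using assms fls_subdegree_geI[of x n] fls_subdegree_eqI[of x n] by (auto simp: leading_def)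

lemma leading_mult:
  assumes x: "leading a x c" and y: "leading b y d"
  shows "leading (a + b) (x * y) (c * d)"
proof (cases "x = 0 \<or> y = 0")
  case True
  then show ?thesis using assms by (auto simp: leading_def)
next
  case False
  then have le: "a \<le> fls_subdegree x" "b \<le> fls_subdegree y"
    using leading_subdegree x y by auto
  have "(x * y) $$ (a + b) = c * d"
  proof (cases "fls_subdegree x = a \<and> fls_subdegree y = b")
    case True
    then show ?thesis
      using fls_times_base[of x y] leadingD[OF x] leadingD[OF y] by simp
  next
    case False
    then have "a + b < fls_subdegree x + fls_subdegree y" and "c = 0 \<or> d = 0"
      using le leadingD[OF x] leadingD[OF y] by auto
    then show ?thesis using fls_times_nth_eq0[of "a + b" x y] by auto
  qed
  moreover have "(x * y) $$ k = 0" if "k < a + b" for k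
    using that le by (intro fls_times_nth_eq0) linarith
  ultimately show ?thesis by (simp add: leading_def)
qed

lemma leading_inverse:
  assumes y: "leading b y d" and "d \<noteq> 0"
  shows "leading (- b) (inverse y) (inverse d)"
proof -
  have "y \<noteq> 0" using assms by (auto simp: leading_def)
  then have deg: "fls_subdegree y = b" using assms leading_subdegree by blast
  have "leading (- b) (inverse y) (inverse y $$ (- b))"
    using \<open>y \<noteq> 0\<close> deg by (auto simp: leading_def intro!: fls_eq0_below_subdegree)
  from leading_mult[OF this y] have "inverse y $$ (- b) * d = 1"
    using \<open>y \<noteq> 0\<close> by (simp add: leading_def)
  then have "inverse y $$ (- b) = inverse d"
    using \<open>d \<noteq> 0\<close> by (simp add: field_simps)
  with \<open>leading (- b) (inverse y) (inverse y $$ (- b))\<close> show ?thesis by simp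
qed

lemma leading_divide:
  "leading a x c \<Longrightarrow> leading b y d \<Longrightarrow> d \<noteq> 0 \<Longrightarrow> leading (a - b) (x / y) (c / d)"
  using leading_mult[OF _ leading_inverse, of a x c b y d] by (simp add: divide_inverse)

lemma leading_prod:
  assumes "\<And>i. i \<in> A \<Longrightarrow> leading (n i) (x i) (c i)"
  shows "leading (\<Sum>i\<in>A. n i) (\<Prod>i\<in>A. x i) (\<Prod>i\<in>A. c i)"
  using assms
  by (induction A rule: infinite_finite_induct) (simp_all add: leading_mult leading_one)

lemma leading_power: "leading n x c \<Longrightarrow> leading (int k * n) (x ^ k) (c ^ k)"
  using leading_prod[of "{..<k}" "\<lambda>_. n" "\<lambda>_. x" "\<lambda>_. c"] by simp


section \<open>Specialising Laurent polynomials in a degeneration\<close>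

text \<open>
  The homomorphism \<open>D\<close> expands coefficients as Laurent series in a parameter, \<open>wt\<close> is the power of the
  parameter by which a monomial is multiplied, and \<open>h\<close> is a change of scale of the monomials that is
  applied after passing to the limit.  Both \<open>wt\<close> and \<open>h\<close> are characters of the exponent monoid.
\<close>

locale degeneration = ring_map D
  for D :: "'a::field \<Rightarrow> 'a fls" +
  fixes wt :: "'g::comm_monoid_add \<Rightarrow> int" and h :: "'g \<Rightarrow> 'a"
  assumes wt_add: "wt (a + b) = wt a + wt b"
    and h_zero: "h 0 = 1" and h_add: "h (a + b) = h a * h b"
begin

text \<open>
  The coefficient of the monomial \<open>e\<close>, multiplied by the power \<open>wt e\<close> of the parameter, has no pole.
\<close>

definition regular :: "('g \<Rightarrow>\<^sub>0 'a) \<Rightarrow> bool" where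
  "regular x \<longleftrightarrow> (\<forall>e. \<exists>c. leading (- wt e) (D (Poly_Mapping.lookup x e)) c)"

definition limit :: "('g \<Rightarrow>\<^sub>0 'a) \<Rightarrow> ('g \<Rightarrow>\<^sub>0 'a)" where
  "limit x = (\<Sum>e\<in>Poly_Mapping.keys x.
     Poly_Mapping.single e (h e * (D (Poly_Mapping.lookup x e) $$ (- wt e))))"

lemma lookup_limit: "Poly_Mapping.lookup (limit x) e = h e * (D (Poly_Mapping.lookup x e) $$ (- wt e))"
proof -
  have "Poly_Mapping.lookup (limit x) e =
     (\<Sum>a\<in>Poly_Mapping.keys x. if a = e then h e * (D (Poly_Mapping.lookup x e) $$ (- wt e)) else 0)"
    unfolding limit_def lookup_sum lookup_single when_def by (rule sum.cong) auto
  then show ?thesis by (simp add: in_keys_iff map_zero)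
qed

lemma limit_add: "limit (x + y) = limit x + limit y"
  by (rule poly_mapping_eqI) (simp add: lookup_limit lookup_add map_add distrib_left)

lemma limit_zero: "limit 0 = 0"
  by (simp add: limit_def)

lemma limit_uminus: "limit (- x) = - limit x"
  by (rule poly_mapping_eqI) (simp add: lookup_limit map_uminus)

lemma limit_sum: "limit (\<Sum>i\<in>A. x i) = (\<Sum>i\<in>A. limit (x i))"
  by (induction A rule: infinite_finite_induct) (simp_all add: limit_zero limit_add)

lemma limit_single:
  assumes "leading (- wt e) (D c) d"
  shows "limit (Poly_Mapping.single e c) = Poly_Mapping.single e (h e * d)"
  by (rule poly_mapping_eqI)
     (use assms in \<open>auto simp: lookup_limit lookup_single when_def map_zero leading_def\<close>)

lemma regular_add: "regular x \<Longrightarrow> regular y \<Longrightarrow> regular (x + y)"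
  unfolding regular_def lookup_add map_add using leading_add by blast

lemma regular_uminus: "regular x \<Longrightarrow> regular (- x)"
  unfolding regular_def lookup_uminus map_uminus using leading_uminus by blast

lemma regular_zero: "regular 0"
  by (auto simp: regular_def map_zero intro: leading_zero)

lemma regular_sum: "(\<And>i. i \<in> A \<Longrightarrow> regular (x i)) \<Longrightarrow> regular (\<Sum>i\<in>A. x i)"
  by (induction A rule: infinite_finite_induct) (simp_all add: regular_zero regular_add)

lemma regular_single:
  assumes "leading (- wt e) (D c) d"
  shows "regular (Poly_Mapping.single e c)"
  unfolding regular_def
proof
  fix a
  show "\<exists>b. leading (- wt a) (D (Poly_Mapping.lookup (Poly_Mapping.single e c) a)) b"
    using assms leading_zero by (cases "a = e") (auto simp: lookup_single map_zero)
qed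

text \<open>
  Each product of two coefficients contributes to the limit its lowest admissible coefficient only, and
  those multiply.
\<close>

lemma
  assumes x: "regular x" and y: "regular y"
  shows regular_mult: "regular (x * y)"
    and limit_mult: "limit (x * y) = limit x * limit y"
proof -
  let ?x = "Poly_Mapping.lookup x" and ?y = "Poly_Mapping.lookup y"
  obtain c d where c: "\<And>a. leading (- wt a) (D (?x a)) (c a)" and d: "\<And>b. leading (- wt b) (D (?y b)) (d b)"
    using x y unfolding regular_def by metis
  have xy: "x * y = (\<Sum>a\<in>Poly_Mapping.keys x. \<Sum>b\<in>Poly_Mapping.keys y.
      Poly_Mapping.single (a + b) (?x a * ?y b))"
    by (subst poly_mapping_sum_single[of x], subst poly_mapping_sum_single[of y])
       (simp add: sum_product mult_single)
  have lead: "leading (- wt (a + b)) (D (?x a * ?y b)) (c a * d b)" for a b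
    using leading_mult[OF c d, of a b] by (simp add: wt_add map_mult)
  show "regular (x * y)"
    unfolding xy by (intro regular_sum regular_single) (rule lead)
  have "limit (x * y) = (\<Sum>a\<in>Poly_Mapping.keys x. \<Sum>b\<in>Poly_Mapping.keys y.
      Poly_Mapping.single (a + b) (h (a + b) * (c a * d b)))"
    unfolding xy by (simp add: limit_sum limit_single[OF lead])
  also have "\<dots> = limit x * limit y"
    by (simp add: limit_def sum_product mult_single h_add leadingD[OF c] leadingD[OF d] mult_ac)
  finally show "limit (x * y) = limit x * limit y" .
qed

end


section \<open>The degeneration contracting part of the variables\<close>

text \<open>
  The extension of an injective map of an integral domain into a field to the field of fractions; the
  choice of a representing fraction is immaterial by \<open>fract_map_Fract\<close>.
\<close>

definition fract_map :: "('a::idom \<Rightarrow> 'b::field) \<Rightarrow> 'a fract \<Rightarrow> 'b" where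
  "fract_map F x = (let r = SOME r. snd r \<noteq> 0 \<and> x = Fraction_Field.Fract (fst r) (snd r)
     in F (fst r) / F (snd r))"

lemma fract_map_Fract:
  assumes "ring_map F" and inj: "\<And>p. F p = 0 \<Longrightarrow> p = 0"
  shows "fract_map F (Fraction_Field.Fract p q) = F p / F q"
proof -
  interpret ring_map F by fact
  let ?P = "\<lambda>r. snd r \<noteq> 0 \<and> Fraction_Field.Fract p q = Fraction_Field.Fract (fst r) (snd r)"
  define r where "r = (SOME r. ?P r)"
  have "\<exists>r. ?P r"
    by (cases "Fraction_Field.Fract p q" rule: Fract_cases) (metis fst_conv snd_conv)
  then have r: "?P r" unfolding r_def by (rule someI_ex)
  have "F (fst r) / F (snd r) = F p / F q"
  proof (cases "q = 0")
    case True
    then have "fst r = 0"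
      using r eq_fract(1)[of 1 "snd r" 0 "fst r"] by (simp add: eq_fract(2))
    then show ?thesis using True by (simp add: map_zero)
  next
    case False
    then have "p * snd r = fst r * q"
      using r eq_fract(1)[of q "snd r" p "fst r"] by blast
    then have "F p * F (snd r) = F (fst r) * F q"
      by (metis map_mult)
    moreover have "F q \<noteq> 0" "F (snd r) \<noteq> 0"
      using False r inj by auto
    ultimately show ?thesis by (simp add: field_simps)
  qed
  then show ?thesis by (simp add: fract_map_def r_def Let_def)
qed

lemma ring_map_fract_map:
  assumes F: "ring_map F" and inj: "\<And>p. F p = 0 \<Longrightarrow> p = 0"
  shows "ring_map (fract_map F)"
proof -
  interpret ring_map F by fact
  note [simp] = fract_map_Fract[OF assms]
  show ?thesis
  proof
    show "fract_map F 1 = 1"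
      by (simp add: One_fract_def map_one)
    fix x y :: "'a fract"
    obtain a b where x: "x = Fraction_Field.Fract a b" "b \<noteq> 0" by (cases x)
    obtain c d where y: "y = Fraction_Field.Fract c d" "d \<noteq> 0" by (cases y)
    have "F b \<noteq> 0" "F d \<noteq> 0" using x y inj by auto
    then show "fract_map F (x + y) = fract_map F x + fract_map F y"
      using x y by (simp add: map_add map_mult field_simps)
    show "fract_map F (x * y) = fract_map F x * fract_map F y"
      using x y by (simp add: map_mult)
  qed
qed

text \<open>
  Hidden variables get the weight \<open>2\<close> rather than \<open>1\<close> so that the charges which balance the orders of the
  two kinds of monopole operators are integers.
\<close>

definition contract_poly :: "('i \<Rightarrow> nat) \<Rightarrow> ('i, 'k::field) wpoly \<Rightarrow> ('i, 'k) wpoly fract fls" where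
  "contract_poly v' = poly_eval (\<lambda>c. fls_const (to_fract (pconst c)))
     (\<lambda>x. case x of Idx i r \<Rightarrow>
        fls_const (to_fract (wvar i r)) * fls_X ^ (if r > v' i then 2 else 0))"

lemma ring_map_fls_const: "ring_map (fls_const :: 'a::field \<Rightarrow> 'a fls)"
  by unfold_locales (simp_all add: fls_plus_const fls_const_mult_const)

lemma ring_map_fls_to_fract: "ring_map (\<lambda>p. fls_const (to_fract p))"
  by (rule ring_map_comp[OF ring_map_fls_const ring_map_to_fract])

lemma ring_map_fls_pconst: "ring_map (\<lambda>c. fls_const (to_fract (pconst c)))"
  by (rule ring_map_comp[OF ring_map_fls_to_fract ring_map_pconst])

lemma ring_map_contract_poly: "ring_map (contract_poly v')"
  unfolding contract_poly_def by (rule ring_map_poly_eval) (rule ring_map_fls_pconst)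

lemma contract_poly_pconst [simp]: "contract_poly v' (pconst c) = fls_const (to_fract (pconst c))"
  by (simp add: contract_poly_def ring_map.map_zero[OF ring_map_pconst])

lemma contract_poly_wvar:
  "contract_poly v' (wvar i r) = fls_const (to_fract (wvar i r)) * fls_X ^ (if r > v' i then 2 else 0)"
  by (simp add: contract_poly_def ring_map_fls_pconst)

lemma contract_poly_single:
  fixes v' :: "'i \<Rightarrow> nat" and e :: "'i idx \<Rightarrow>\<^sub>0 nat"
  shows "\<exists>n. \<forall>c::'k::field. contract_poly v' (Poly_Mapping.single e c) = fls_const (to_fract (Poly_Mapping.single e c)) * fls_X ^ n"
proof -
  let ?\<theta> = "\<lambda>x. fls_const (to_fract (Poly_Mapping.single (Poly_Mapping.single x 1) 1)) :: ('i, 'k) wpoly fract fls"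
  let ?m = "\<lambda>x. (case x of Idx i r \<Rightarrow> if r > v' i then 2 else 0) :: nat"
  have split: "mono_eval (\<lambda>x. ?\<theta> x * fls_X ^ ?m x) e = mono_eval ?\<theta> e * fls_X ^ (\<Sum>x\<in>Poly_Mapping.keys e. ?m x * Poly_Mapping.lookup e x)"
    by (simp add: mono_eval_def power_mult_distrib prod.distrib power_sum power_mult)
  have vars: "(\<lambda>x. case x of Idx i r \<Rightarrow> fls_const (to_fract (wvar i r)) * fls_X ^ (if r > v' i then 2 else 0))
    = (\<lambda>x. ?\<theta> x * fls_X ^ ?m x)"
    by (auto simp: fun_eq_iff wvar_def split: idx.split)
  have "fls_const (to_fract p) = poly_eval (\<lambda>c. fls_const (to_fract (pconst c))) ?\<theta> p" for p :: "('i, 'k) wpoly"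
  proof (rule ring_map_poly_eqI[OF ring_map_fls_to_fract ring_map_poly_eval[OF ring_map_fls_pconst]])
    show "fls_const (to_fract (wvar i r)) = poly_eval (\<lambda>c. fls_const (to_fract (pconst c))) ?\<theta> (wvar i r)" for i r
      unfolding poly_eval_wvar[OF ring_map_fls_pconst] by (simp only: wvar_def)
  qed (simp add: ring_map.map_zero[OF ring_map_pconst])
  from this[of "Poly_Mapping.single e _"]
  have "fls_const (to_fract (Poly_Mapping.single e c)) = fls_const (to_fract (pconst c)) * mono_eval ?\<theta> e" for c :: 'k
    by (simp add: poly_eval_single ring_map.map_zero[OF ring_map_pconst])
  then have "contract_poly v' (Poly_Mapping.single e c) = fls_const (to_fract (Poly_Mapping.single e c)) *
      fls_X ^ (\<Sum>x\<in>Poly_Mapping.keys e. ?m x * Poly_Mapping.lookup e x)" for c :: 'k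
    unfolding contract_poly_def vars
    by (subst poly_eval_single) (simp_all only: ring_map.map_zero[OF ring_map_fls_pconst] split mult.assoc)
  then show ?thesis by blast
qed

text \<open>
  Contraction is injective: it multiplies monomials by powers of the parameter, so the coefficients of
  the resulting series regroup the monomials of \<open>p\<close> and no cancellation occurs.
\<close>

lemma contract_poly_eq_0:
  fixes p :: "('i, 'k::field) wpoly"
  assumes "contract_poly v' p = 0"
  shows "p = 0"
proof (rule ccontr)
  interpret ring_map "contract_poly v'" by (rule ring_map_contract_poly)
  interpret fr: ring_map to_fract by (rule ring_map_to_fract)
  assume "p \<noteq> 0"
  then obtain e where e: "Poly_Mapping.lookup p e \<noteq> 0"
    by (metis lookup_zero poly_mapping_eqI)
  have "\<forall>e. \<exists>n. \<forall>c::'k. contract_poly v' (Poly_Mapping.single e c) =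
      fls_const (to_fract (Poly_Mapping.single e c)) * fls_X ^ n"
    using contract_poly_single by blast
  from choice[OF this] obtain n where n: "\<And>e (c::'k). contract_poly v' (Poly_Mapping.single e c) =
      fls_const (to_fract (Poly_Mapping.single e c)) * fls_X ^ n e"
    by blast
  let ?part = "\<Sum>a\<in>Poly_Mapping.keys p. if n a = n e then Poly_Mapping.single a (Poly_Mapping.lookup p a) else 0"
  have "contract_poly v' p $$ int (n e) = (\<Sum>a\<in>Poly_Mapping.keys p.
      (fls_const (to_fract (Poly_Mapping.single a (Poly_Mapping.lookup p a))) * fls_X ^ n a) $$ int (n e))"
    by (subst poly_mapping_sum_single[of p]) (simp only: map_sum fls_nth_sum n)
  also have "\<dots> = (\<Sum>a\<in>Poly_Mapping.keys p.
      to_fract (if n a = n e then Poly_Mapping.single a (Poly_Mapping.lookup p a) else 0))"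
    by (intro sum.cong refl) (auto simp: fls_mult_const_nth Zero_fract_def)
  also have "\<dots> = to_fract ?part"
    by (simp only: fr.map_sum)
  finally have "?part = 0" using assms by simp
  then have "0 = Poly_Mapping.lookup ?part e" by simp
  also have "\<dots> = (\<Sum>a\<in>Poly_Mapping.keys p. if a = e then Poly_Mapping.lookup p e else 0)"
    unfolding lookup_sum by (rule sum.cong) (auto simp: lookup_single when_def)
  also have "\<dots> = Poly_Mapping.lookup p e"
    by (simp add: in_keys_iff)
  finally show False using e by simp
qed

definition contract :: "('i \<Rightarrow> nat) \<Rightarrow> ('i, 'k::field) wpoly fract \<Rightarrow> ('i, 'k) wpoly fract fls" where
  "contract v' = fract_map (contract_poly v')"

lemma ring_map_contract: "ring_map (contract v')"
  unfolding contract_def by (rule ring_map_fract_map[OF ring_map_contract_poly contract_poly_eq_0])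

lemma contract_Fract: "contract v' (Fraction_Field.Fract p q) = contract_poly v' p / contract_poly v' q"
  unfolding contract_def by (rule fract_map_Fract[OF ring_map_contract_poly contract_poly_eq_0])

lemma ring_map_truncate_poly: "ring_map (truncate_poly v')"
  unfolding truncate_poly_def by (rule ring_map_psubst)

lemma leading_contract_poly:
  fixes p :: "('i, 'k::field) wpoly"
  shows "leading 0 (contract_poly v' p) (to_fract (truncate_poly v' p))"
proof -
  interpret c: ring_map "contract_poly v'" by (rule ring_map_contract_poly)
  interpret t: ring_map "\<lambda>p. to_fract (truncate_poly v' p)"
    by (rule ring_map_comp[OF ring_map_to_fract ring_map_truncate_poly])
  show ?thesis
  proof (induction p rule: wpoly_induct)
    case (pconst k)
    show ?case by (simp add: truncate_poly_def leading_const)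
  next
    case (wvar i r)
    show ?case
      by (simp add: truncate_poly_def contract_poly_wvar leading_const Zero_fract_def[symmetric])
         (simp add: leading_def)
  next
    case (add p q)
    then show ?case by (simp only: c.map_add t.map_add leading_add)
  next
    case (mult p q)
    then show ?case using leading_mult[OF mult] by (simp only: c.map_mult t.map_mult add_0)
  qed
qed

lemma leading_contract_wvar:
  "r \<le> v' i \<Longrightarrow> leading 0 (contract_poly v' (wvar i r)) (to_fract (wvar i r))"
  "r > v' i \<Longrightarrow> leading 2 (contract_poly v' (wvar i r)) (to_fract (wvar i r))"
  by (simp_all add: contract_poly_wvar leading_const) (simp add: leading_def)

lemma leading_contract_diff:
  assumes "v' i < r" "v' j < s"
  shows "leading 2 (contract_poly v' (wvar i r - wvar j s)) (to_fract (wvar i r - wvar j s))"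
  unfolding ring_map.map_diff[OF ring_map_contract_poly] ring_map.map_diff[OF ring_map_to_fract]
  by (intro leading_diff leading_contract_wvar(2) assms)


section \<open>Partially symmetric polynomials\<close>

lemma permutes_extend:
  assumes "finite S" "A \<subseteq> S" "inj_on f A" "f ` A \<subseteq> S"
  obtains \<sigma> where "\<sigma> permutes S" "\<And>a. a \<in> A \<Longrightarrow> \<sigma> a = f a"
proof -
  have "card (S - A) = card (S - f ` A)"
    using assms by (simp add: card_Diff_subset finite_subset card_image)
  then obtain h where h: "bij_betw h (S - A) (S - f ` A)"
    using assms(1) finite_same_card_bij by blast
  define \<sigma> where "\<sigma> x = (if x \<in> A then f x else if x \<in> S then h x else x)" for x
  have "bij_betw \<sigma> A (f ` A)"
    using assms(3) by (auto simp: bij_betw_def \<sigma>_def inj_on_def)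
  moreover have "bij_betw \<sigma> (S - A) (S - f ` A)"
    using h by (rule bij_betw_cong[THEN iffD1, rotated]) (auto simp: \<sigma>_def)
  ultimately have "bij_betw \<sigma> (A \<union> (S - A)) (f ` A \<union> (S - f ` A))"
    by (rule bij_betw_combine) auto
  then have "bij_betw \<sigma> S S"
    using assms(2,4) by (simp add: Un_absorb1)
  then have "\<sigma> permutes S"
    by (rule bij_imp_permutes) (use assms(2) in \<open>auto simp: \<sigma>_def\<close>)
  then show thesis by (rule that) (simp add: \<sigma>_def)
qed

definition relabel :: "(nat \<Rightarrow> nat) \<Rightarrow> 'i idx \<Rightarrow> 'i idx" where
  "relabel \<sigma> x = (case x of Idx j r \<Rightarrow> Idx j (\<sigma> r))"

lemma relabel_Idx [simp]: "relabel \<sigma> (Idx j r) = Idx j (\<sigma> r)"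
  by (simp add: relabel_def)

lemma relabel_comp: "relabel \<sigma> \<circ> relabel \<tau> = relabel (\<sigma> \<circ> \<tau>)"
  by (auto simp: fun_eq_iff relabel_def split: idx.split)

lemma inj_relabel: "inj \<sigma> \<Longrightarrow> inj (relabel \<sigma>)"
  by (auto simp: inj_def relabel_def split: idx.splits)

text \<open>
  Pulling an exponent back along a permutation of the indices is a right action.  It describes the
  action on polynomials through coefficients (\<open>lookup_psubst_permute\<close>).
\<close>

abbreviation pull :: "(nat \<Rightarrow> nat) \<Rightarrow> ('i idx \<Rightarrow>\<^sub>0 nat) \<Rightarrow> 'i idx \<Rightarrow>\<^sub>0 nat" where
  "pull \<sigma> \<equiv> Poly_Mapping.map_key (relabel \<sigma>)"

lemma lookup_pull: "inj \<sigma> \<Longrightarrow> Poly_Mapping.lookup (pull \<sigma> e) (Idx j r) = Poly_Mapping.lookup e (Idx j (\<sigma> r))"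
  by (simp add: map_key.rep_eq inj_relabel)

lemma pull_pull:
  assumes "inj \<sigma>" "inj \<tau>"
  shows "pull \<tau> (pull \<sigma> e) = pull (\<sigma> \<circ> \<tau>) e"
  using assms map_key_compose[of "relabel \<tau>" "relabel \<sigma>" e]
  by (simp add: inj_relabel relabel_comp inj_compose)

lemma pull_id: "pull id e = e"
proof -
  have "relabel id = (id :: 'a idx \<Rightarrow> 'a idx)"
    by (auto simp: fun_eq_iff relabel_def split: idx.split)
  then show ?thesis by (simp add: map_key_id[unfolded id_def] id_def)
qed

lemma in_keys_pull: "inj \<sigma> \<Longrightarrow> Idx j r \<in> Poly_Mapping.keys (pull \<sigma> e) \<longleftrightarrow> Idx j (\<sigma> r) \<in> Poly_Mapping.keys e"
  by (simp add: in_keys_iff lookup_pull)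

lemma lookup_psubst_permute:
  fixes p :: "('i, 'k::field) wpoly"
  assumes "bij \<sigma>"
  shows "Poly_Mapping.lookup (psubst (\<lambda>j r. wvar j (\<sigma> r)) p) e = Poly_Mapping.lookup p (pull \<sigma> e)"
proof -
  interpret ring_map "psubst (\<lambda>j r. wvar j (\<sigma> r) :: ('i, 'k) wpoly)" by (rule ring_map_psubst)
  have inj: "inj \<sigma>" "inj (inv_into UNIV \<sigma>)" and inv: "\<sigma> (inv_into UNIV \<sigma> r) = r" for r
    using assms by (simp_all add: bij_is_inj bij_imp_bij_inv surj_f_inv_f bij_is_surj)
  have cancel: "\<sigma> \<circ> inv_into UNIV \<sigma> = id" "inv_into UNIV \<sigma> \<circ> \<sigma> = id"
    using assms by (auto simp: fun_eq_iff inv bij_is_inj)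
  have mono: "psubst (\<lambda>j r. wvar j (\<sigma> r)) (Poly_Mapping.single a (1::'k)) = Poly_Mapping.single (pull (inv_into UNIV \<sigma>) a) 1"
    for a :: "'i idx \<Rightarrow>\<^sub>0 nat"
  proof (induction a rule: poly_mapping_induct_single)
    case 1
    then show ?case by (simp add: map_one inj map_key_zero inj_relabel)
  next
    case (2 x n)
    obtain j r where x: "x = Idx j r" by (cases x)
    have "pull (inv_into UNIV \<sigma>) (Poly_Mapping.single x n) = Poly_Mapping.single (Idx j (\<sigma> r)) n"
    proof (rule poly_mapping_eqI)
      fix y :: "'i idx"
      obtain j' s where y: "y = Idx j' s" by (cases y)
      show "Poly_Mapping.lookup (pull (inv_into UNIV \<sigma>) (Poly_Mapping.single x n)) y = Poly_Mapping.lookup (Poly_Mapping.single (Idx j (\<sigma> r)) n) y"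
        using inv inj by (auto simp: x y lookup_pull lookup_single when_def inv_f_f)
    qed
    then show ?case by (simp add: x single_single_eq_wvar_power map_power)
  next
    case (3 a b)
    then show ?case by (simp only: single_mult_mono map_mult map_key_plus[OF inj_relabel[OF inj(2)]])
  qed
  have single: "psubst (\<lambda>j r. wvar j (\<sigma> r)) (Poly_Mapping.single a c) = Poly_Mapping.single (pull (inv_into UNIV \<sigma>) a) c"
    for a :: "'i idx \<Rightarrow>\<^sub>0 nat" and c :: 'k
  proof -
    have "psubst (\<lambda>j r. wvar j (\<sigma> r)) (Poly_Mapping.single a c) = pconst c * Poly_Mapping.single (pull (inv_into UNIV \<sigma>) a) 1"
      by (subst single_eq_pconst_mult) (simp only: map_mult mono psubst_pconst)
    then show ?thesis by (simp only: single_eq_pconst_mult[symmetric])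
  qed
  have "pull (inv_into UNIV \<sigma>) a = e \<longleftrightarrow> a = pull \<sigma> e" for a
    using pull_pull[OF inj] pull_pull[OF inj(2,1)] cancel pull_id by metis
  then show ?thesis
    by (induction p rule: poly_mapping_induct_single)
       (simp_all add: map_zero map_add lookup_add single lookup_single when_def)
qed

lemma truncate_poly_pconst [simp]: "truncate_poly v' (pconst c) = pconst c"
  by (simp add: truncate_poly_def)

lemma lookup_truncate_poly:
  fixes p :: "('i, 'k::field) wpoly"
  shows "Poly_Mapping.lookup (truncate_poly v' p) e =
    (if \<forall>j r. Idx j r \<in> Poly_Mapping.keys e \<longrightarrow> r \<le> v' j then Poly_Mapping.lookup p e else 0)"
proof -
  interpret ring_map "truncate_poly v' :: ('i, 'k) wpoly \<Rightarrow> _" by (rule ring_map_truncate_poly)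
  have "truncate_poly v' (Poly_Mapping.single a c) =
     (if \<forall>j r. Idx j r \<in> Poly_Mapping.keys a \<longrightarrow> r \<le> v' j then Poly_Mapping.single a c else 0)"
    for a :: "'i idx \<Rightarrow>\<^sub>0 nat" and c :: 'k
  proof (cases "\<forall>j r. Idx j r \<in> Poly_Mapping.keys a \<longrightarrow> r \<le> v' j")
    case True
    have "pvars (Poly_Mapping.single a c) \<subseteq> Poly_Mapping.keys a"
      by (auto simp: pvars_def split: if_splits)
    then have "psubst (\<lambda>i r. if r > v' i then 0 else wvar i r) (Poly_Mapping.single a c) = psubst wvar (Poly_Mapping.single a c)"
      using True by (intro psubst_cong) (auto simp: not_less)
    then show ?thesis using True by (simp add: truncate_poly_def psubst_id)
  next
    case False
    then obtain j r where jr: "Idx j r \<in> Poly_Mapping.keys a" "v' j < r" by auto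
    then have "mono_eval (\<lambda>x. case x of Idx i r \<Rightarrow> if r > v' i then 0 else (wvar i r :: ('i, 'k) wpoly)) a = 0"
      unfolding mono_eval_def by (intro prod_zero bexI[OF _ jr(1)]) (auto simp: in_keys_iff zero_power)
    then have "psubst (\<lambda>i r. if r > v' i then 0 else wvar i r) (Poly_Mapping.single a c) = 0"
      by (simp add: psubst_eq_poly_eval poly_eval_single pconst_def)
    then show ?thesis by (simp add: truncate_poly_def if_not_P[OF False])
  qed
  then show ?thesis
    by (induction p rule: poly_mapping_induct_single)
       (auto simp: map_zero map_add lookup_add lookup_single when_def)
qed

text \<open>
  The Young subgroup \<open>S\<^bsub>k\<^esub> \<times> S\<^bsub>n-k\<^esub>\<close> of the symmetric group.
\<close>

definition young :: "nat \<Rightarrow> nat \<Rightarrow> (nat \<Rightarrow> nat) \<Rightarrow> bool" where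
  "young n k \<sigma> \<longleftrightarrow> \<sigma> permutes {1..n} \<and> \<sigma> ` {1..k} = {1..k}"

lemma young_id: "young n k id"
  by (simp add: young_def permutes_id)

lemma young_comp: "young n k \<sigma> \<Longrightarrow> young n k \<tau> \<Longrightarrow> young n k (\<sigma> \<circ> \<tau>)"
  unfolding young_def by (metis image_comp permutes_compose)

lemma young_inv:
  assumes "young n k \<sigma>"
  shows "young n k (inv_into UNIV \<sigma>)"
proof -
  have "inj \<sigma>" using assms permutes_inj unfolding young_def by blast
  then have "inv_into UNIV \<sigma> ` \<sigma> ` {1..k} = {1..k}" by (simp add: image_inv_f_f)
  then show ?thesis using assms by (simp add: young_def permutes_inv)
qed

lemma young_bij: "young n k \<sigma> \<Longrightarrow> bij \<sigma>"
  unfolding young_def using permutes_bij by blast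

lemma young_inj: "young n k \<sigma> \<Longrightarrow> inj \<sigma>"
  using young_bij bij_is_inj by blast

lemma young_mono:
  assumes "young n' k \<sigma>" "n' \<le> n"
  shows "young n k \<sigma>"
  using assms permutes_subset[of \<sigma> "{1..n'}" "{1..n}"] by (auto simp: young_def)

lemma pvars_subset_iff:
  "pvars p \<subseteq> X \<longleftrightarrow> (\<forall>e. Poly_Mapping.lookup p e \<noteq> 0 \<longrightarrow> Poly_Mapping.keys e \<subseteq> X)"
  unfolding pvars_def UN_subset_iff by (metis in_keys_iff)

lemma partially_symmetric_iff:
  "p \<in> partially_symmetric n k i \<longleftrightarrow>
     (\<forall>e. Poly_Mapping.lookup p e \<noteq> 0 \<longrightarrow> Poly_Mapping.keys e \<subseteq> Idx i ` {1..n}) \<and>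
     (\<forall>\<sigma> e. young n k \<sigma> \<longrightarrow> Poly_Mapping.lookup p (pull \<sigma> e) = Poly_Mapping.lookup p e)"
proof -
  have "psubst (\<lambda>j r. wvar j (\<sigma> r)) p = p \<longleftrightarrow>
      (\<forall>e. Poly_Mapping.lookup p (pull \<sigma> e) = Poly_Mapping.lookup p e)" if "young n k \<sigma>" for \<sigma>
    using lookup_psubst_permute[OF young_bij[OF that], of p]
    by (auto simp: poly_mapping_eq_iff fun_eq_iff)
  then show ?thesis
    unfolding partially_symmetric_def young_def[symmetric] pvars_subset_iff by auto
qed

text \<open>
  Enlarging the symmetric group from \<open>n'\<close> to \<open>n\<close> letters does not identify monomials supported on the
  first \<open>n'\<close> letters which were inequivalent before: a permutation that carries one such monomial to
  another can be changed outside of the support, and outside of the block \<open>{1..k}\<close>, to one that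
  preserves \<open>{1..n'}\<close>.
\<close>

lemma partially_symmetric_orbit:
  fixes g :: "('i, 'k::field) wpoly"
  assumes g: "g \<in> partially_symmetric n' k i" and "k \<le> n'" and \<sigma>: "young n k \<sigma>"
    and e: "Poly_Mapping.keys e \<subseteq> Idx i ` {1..n'}"
    and \<sigma>e: "Poly_Mapping.keys (pull \<sigma> e) \<subseteq> Idx i ` {1..n'}"
  shows "Poly_Mapping.lookup g (pull \<sigma> e) = Poly_Mapping.lookup g e"
proof -
  note inj = young_inj[OF \<sigma>]
  let ?B = "{r. Idx i r \<in> Poly_Mapping.keys (pull \<sigma> e)} \<union> {1..k}"
  have B: "?B \<subseteq> {1..n'}" using \<sigma>e \<open>k \<le> n'\<close> by auto
  have "\<sigma> ` {1..k} \<subseteq> {1..n'}" using \<sigma> \<open>k \<le> n'\<close> by (auto simp: young_def)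
  moreover have "\<sigma> r \<in> {1..n'}" if "Idx i r \<in> Poly_Mapping.keys (pull \<sigma> e)" for r
    using that e by (auto simp: in_keys_pull[OF inj])
  ultimately have "\<sigma> ` ?B \<subseteq> {1..n'}" by blast
  then obtain \<rho> where \<rho>: "\<rho> permutes {1..n'}" and eq: "\<And>r. r \<in> ?B \<Longrightarrow> \<rho> r = \<sigma> r"
    using permutes_extend[OF _ B, of \<sigma>] inj by (metis finite_atLeastAtMost inj_on_subset subset_UNIV)
  have "\<rho> ` {1..k} = \<sigma> ` {1..k}" using eq by (intro image_cong) auto
  then have young: "young n' k \<rho>" using \<rho> \<sigma> by (simp add: young_def)
  note inj' = young_inj[OF young]
  have "pull \<sigma> e = pull \<rho> e"
  proof (rule poly_mapping_eqI)
    fix x :: "'i idx"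
    obtain j r where x: "x = Idx j r" by (cases x)
    show "Poly_Mapping.lookup (pull \<sigma> e) x = Poly_Mapping.lookup (pull \<rho> e) x"
    proof (cases "j = i")
      case False
      then have "Poly_Mapping.lookup e (Idx j s) = 0" for s using e by (auto simp: in_keys_iff)
      then show ?thesis by (simp add: x lookup_pull inj inj')
    next
      case j: True
      show ?thesis
      proof (cases "Idx i r \<in> Poly_Mapping.keys (pull \<sigma> e)")
        case True
        then show ?thesis by (simp add: x j lookup_pull inj inj' eq)
      next
        case False
        have "Idx i (\<rho> r) \<notin> Poly_Mapping.keys e"
        proof
          assume in_e: "Idx i (\<rho> r) \<in> Poly_Mapping.keys e"
          obtain s where s: "\<sigma> s = \<rho> r" using young_bij[OF \<sigma>] by (metis bij_pointE)
          then have "Idx i s \<in> Poly_Mapping.keys (pull \<sigma> e)"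
            using in_e by (simp add: in_keys_pull inj)
          then have "\<rho> s = \<rho> r" using s eq by simp
          then have "s = r" using inj' by (simp add: inj_eq)
          then show False using False \<open>Idx i s \<in> _\<close> by simp
        qed
        then show ?thesis using False by (simp add: x j lookup_pull inj inj' in_keys_iff)
      qed
    qed
  qed
  then show ?thesis using g young by (simp add: partially_symmetric_iff)
qed

lemma truncate_poly_partially_symmetric:
  assumes p: "p \<in> partially_symmetric (v i) k i" and "v' i \<le> v i"
  shows "truncate_poly v' p \<in> partially_symmetric (v' i) k i"
  unfolding partially_symmetric_iff
proof (intro conjI allI impI)
  fix e assume "Poly_Mapping.lookup (truncate_poly v' p) e \<noteq> 0"
  then have "Poly_Mapping.lookup p e \<noteq> 0" "\<forall>j r. Idx j r \<in> Poly_Mapping.keys e \<longrightarrow> r \<le> v' j"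
    by (auto simp: lookup_truncate_poly split: if_splits)
  then show "Poly_Mapping.keys e \<subseteq> Idx i ` {1..v' i}"
    using p unfolding partially_symmetric_iff by fastforce
next
  fix \<sigma> e assume \<sigma>: "young (v' i) k \<sigma>"
  note inj = young_inj[OF \<sigma>]
  have le: "\<sigma> r \<le> v' i \<longleftrightarrow> r \<le> v' i" for r
    using \<sigma> permutes_in_image[of \<sigma> "{1..v' i}" r] permutes_not_in[of \<sigma> "{1..v' i}" r]
    by (cases "r \<in> {1..v' i}") (auto simp: young_def)
  have eq: "Poly_Mapping.lookup p (pull \<sigma> e) = Poly_Mapping.lookup p e"
    using p young_mono[OF \<sigma> assms(2)] by (simp add: partially_symmetric_iff)
  show "Poly_Mapping.lookup (truncate_poly v' p) (pull \<sigma> e) = Poly_Mapping.lookup (truncate_poly v' p) e"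
  proof (cases "Poly_Mapping.lookup p e = 0")
    case True
    then show ?thesis by (simp add: lookup_truncate_poly eq)
  next
    case False
    then have "Poly_Mapping.keys e \<subseteq> Idx i ` {1..v i}" "Poly_Mapping.keys (pull \<sigma> e) \<subseteq> Idx i ` {1..v i}"
      using p eq unfolding partially_symmetric_iff by metis+
    then have i: "j = i" if "Idx j r \<in> Poly_Mapping.keys e \<or> Idx j r \<in> Poly_Mapping.keys (pull \<sigma> e)" for j r
      using that by auto
    have "(\<forall>j r. Idx j r \<in> Poly_Mapping.keys (pull \<sigma> e) \<longrightarrow> r \<le> v' j) \<longleftrightarrow>
        (\<forall>r. Idx i (\<sigma> r) \<in> Poly_Mapping.keys e \<longrightarrow> \<sigma> r \<le> v' i)"
      using i by (metis in_keys_pull[OF inj] le)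
    also have "\<dots> \<longleftrightarrow> (\<forall>j r. Idx j r \<in> Poly_Mapping.keys e \<longrightarrow> r \<le> v' j)"
      using i bij_pointE[OF young_bij[OF \<sigma>]] by metis
    finally show ?thesis by (simp only: lookup_truncate_poly eq)
  qed
qed

text \<open>
  A partially symmetric polynomial is a combination of orbit sums.  Replace each orbit sum by the sum
  over the larger orbit of the same monomial under the larger Young subgroup.  Truncation removes the
  monomials that involve hidden indices, and by \<open>partially_symmetric_orbit\<close> those that remain form the
  original orbit.
\<close>

lemma partially_symmetric_lift:
  fixes g :: "('i, 'k::field) wpoly"
  assumes g: "g \<in> partially_symmetric (v' i) k i" and k: "k \<le> v' i" and le: "v' i \<le> v i"
  shows "\<exists>p\<in>partially_symmetric (v i) k i. truncate_poly v' p = g"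
proof -
  let ?n = "v i" and ?n' = "v' i"
  \<comment> \<open>\<open>a\<close> is a monomial in the orbit of \<open>e\<close> that is supported on the first \<open>v' i\<close> letters.\<close>
  define rep where "rep e a \<longleftrightarrow> Poly_Mapping.keys a \<subseteq> Idx i ` {1..?n'} \<and> (\<exists>\<sigma>. young ?n k \<sigma> \<and> a = pull \<sigma> e)"
    for e a :: "'i idx \<Rightarrow>\<^sub>0 nat"
  define c where "c e = (if \<exists>a. rep e a then Poly_Mapping.lookup g (SOME a. rep e a) else 0)" for e
  have rep: "\<exists>a. rep e a \<and> c e = Poly_Mapping.lookup g a" if "c e \<noteq> 0" for e
    using that by (metis c_def someI_ex)
  have c_eq: "c e = Poly_Mapping.lookup g e" if "Poly_Mapping.keys e \<subseteq> Idx i ` {1..?n'}" for e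
  proof -
    have "rep e e" unfolding rep_def using that young_id pull_id by metis
    then have "rep e (SOME a. rep e a)" "c e = Poly_Mapping.lookup g (SOME a. rep e a)"
      unfolding c_def by (metis someI, auto)
    then show ?thesis
      using partially_symmetric_orbit[OF g k _ that] unfolding rep_def by metis
  qed
  have rep_pull: "rep (pull \<sigma> e) a \<longleftrightarrow> rep e a" if \<sigma>: "young ?n k \<sigma>" for \<sigma> e a
  proof -
    note inj = young_inj[OF \<sigma>] young_inj[OF young_inv[OF \<sigma>]]
    have "\<exists>\<rho>. young ?n k \<rho> \<and> pull \<tau> (pull \<sigma> e) = pull \<rho> e" if "young ?n k \<tau>" for \<tau>
      using that pull_pull[OF inj(1) young_inj[OF that]] young_comp[OF \<sigma> that] by metis
    moreover have "\<exists>\<rho>. young ?n k \<rho> \<and> pull \<tau> e = pull \<rho> (pull \<sigma> e)" if \<tau>: "young ?n k \<tau>" for \<tau>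
    proof -
      let ?\<rho> = "inv_into UNIV \<sigma> \<circ> \<tau>"
      have \<rho>: "young ?n k ?\<rho>" by (intro young_comp young_inv \<sigma> \<tau>)
      have "\<sigma> \<circ> ?\<rho> = \<tau>"
        using young_bij[OF \<sigma>] by (simp add: fun_eq_iff bij_is_surj surj_f_inv_f)
      then show ?thesis using pull_pull[OF inj(1) young_inj[OF \<rho>], of e] \<rho> by metis
    qed
    ultimately show ?thesis unfolding rep_def by metis
  qed
  have c_pull: "c (pull \<sigma> e) = c e" if "young ?n k \<sigma>" for \<sigma> e
  proof -
    have "rep (pull \<sigma> e) = rep e" using rep_pull[OF that] by (simp add: fun_eq_iff)
    then show ?thesis by (simp only: c_def)
  qed
  have support: "Poly_Mapping.keys e \<subseteq> Idx i ` {1..?n}" if nz: "c e \<noteq> 0" for e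
  proof
    fix x assume x: "x \<in> Poly_Mapping.keys e"
    obtain j s where js: "x = Idx j s" by (cases x)
    obtain \<sigma> where \<sigma>: "young ?n k \<sigma>" and sub: "Poly_Mapping.keys (pull \<sigma> e) \<subseteq> Idx i ` {1..?n'}"
      using rep[OF nz] unfolding rep_def by blast
    obtain r where r: "\<sigma> r = s" using young_bij[OF \<sigma>] by (metis bij_pointE)
    have "Idx j r \<in> Poly_Mapping.keys (pull \<sigma> e)"
      using x js r by (simp add: in_keys_pull young_inj[OF \<sigma>])
    then have "j = i" "r \<in> {1..?n}" using sub le by auto
    then have "\<sigma> r \<in> {1..?n}" using \<sigma> permutes_in_image unfolding young_def by metis
    then show "x \<in> Idx i ` {1..?n}" using js r \<open>j = i\<close> by blast
  qed
  have "finite {e. c e \<noteq> 0}"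
  proof (rule finite_subset)
    show "{e. c e \<noteq> 0} \<subseteq> (\<Union>\<sigma>\<in>{\<sigma>. \<sigma> permutes {1..?n}}. pull \<sigma> ` Poly_Mapping.keys g)"
    proof
      fix e assume "e \<in> {e. c e \<noteq> 0}"
      then obtain \<sigma> where \<sigma>: "young ?n k \<sigma>" and nz: "Poly_Mapping.lookup g (pull \<sigma> e) \<noteq> 0"
        using rep[of e] unfolding rep_def by auto
      have "\<sigma> \<circ> inv_into UNIV \<sigma> = id" using young_bij[OF \<sigma>] by (simp add: fun_eq_iff bij_is_surj surj_f_inv_f)
      then have "e = pull (inv_into UNIV \<sigma>) (pull \<sigma> e)"
        using pull_pull[OF young_inj[OF \<sigma>] young_inj[OF young_inv[OF \<sigma>]], of e] pull_id by metis
      moreover have "inv_into UNIV \<sigma> permutes {1..?n}" using young_inv[OF \<sigma>] by (simp add: young_def)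
      ultimately show "e \<in> (\<Union>\<sigma>\<in>{\<sigma>. \<sigma> permutes {1..?n}}. pull \<sigma> ` Poly_Mapping.keys g)"
        using nz by (auto simp: in_keys_iff)
    qed
  qed (simp add: finite_permutations)
  then have lookup: "Poly_Mapping.lookup (Abs_poly_mapping c) = c" by simp
  have "Abs_poly_mapping c \<in> partially_symmetric ?n k i"
    unfolding partially_symmetric_iff lookup using support c_pull by blast
  moreover have "truncate_poly v' (Abs_poly_mapping c) = g"
  proof (rule poly_mapping_eqI)
    fix e
    show "Poly_Mapping.lookup (truncate_poly v' (Abs_poly_mapping c)) e = Poly_Mapping.lookup g e"
    proof (cases "Poly_Mapping.keys e \<subseteq> Idx i ` {1..?n'}")
      case True
      then have "\<forall>j r. Idx j r \<in> Poly_Mapping.keys e \<longrightarrow> r \<le> v' j" by auto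
      then show ?thesis by (simp add: lookup_truncate_poly lookup c_eq[OF True])
    next
      case False
      then have "Poly_Mapping.lookup g e = 0" using g by (auto simp: partially_symmetric_iff)
      moreover have "c e = 0" if le: "\<forall>j r. Idx j r \<in> Poly_Mapping.keys e \<longrightarrow> r \<le> v' j"
      proof (rule ccontr)
        assume "c e \<noteq> 0"
        from support[OF this] have "Poly_Mapping.keys e \<subseteq> Idx i ` {1..?n'}"
          using le by fastforce
        then show False using False by simp
      qed
      ultimately show ?thesis by (simp add: lookup_truncate_poly lookup)
    qed
  qed
  ultimately show ?thesis by blast
qed


section \<open>Symmetric functions on a dimension vector\<close>

lemma Lambda_ring_eqI:
  fixes F G :: "('i, 'k::field) wpoly \<Rightarrow> 'a::comm_ring_1"
  assumes f: "f \<in> Lambda_ring Q v m" and F: "ring_map F" and G: "ring_map G"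
    and "\<And>c. F (pconst c) = G (pconst c)"
    and "\<And>i g. i \<in> verts Q \<Longrightarrow> g \<in> partially_symmetric (v i) (m i) i \<Longrightarrow> F g = G g"
  shows "F f = G f"
proof -
  interpret F: ring_map F by fact
  interpret G: ring_map G by fact
  show ?thesis
    using f assms(4,5) unfolding Lambda_ring_def
    by (auto simp: F.map_sum F.map_mult F.map_prod G.map_sum G.map_mult G.map_prod intro!: sum.cong prod.cong arg_cong2[where f = times])
qed

lemma truncate_poly_Lambda_ring:
  fixes f :: "('i, 'k::field) wpoly"
  assumes "f \<in> Lambda_ring Q v m" "\<And>i. i \<in> verts Q \<Longrightarrow> v' i \<le> v i"
  shows "truncate_poly v' f \<in> Lambda_ring Q v' m"
proof -
  interpret ring_map "truncate_poly v' :: ('i, 'k) wpoly \<Rightarrow> _" by (rule ring_map_truncate_poly)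
  obtain n :: nat and c g where f: "f = (\<Sum>l<n. pconst (c l) * (\<Prod>i\<in>verts Q. g l i))"
    and g: "\<forall>l<n. \<forall>i\<in>verts Q. g l i \<in> partially_symmetric (v i) (m i) i"
    using assms(1) unfolding Lambda_ring_def by blast
  have "truncate_poly v' f = (\<Sum>l<n. pconst (c l) * (\<Prod>i\<in>verts Q. truncate_poly v' (g l i)))"
    unfolding f map_sum map_mult map_prod by simp
  moreover have "truncate_poly v' (g l i) \<in> partially_symmetric (v' i) (m i) i" if "l < n" "i \<in> verts Q" for l i
    by (rule truncate_poly_partially_symmetric[where v = v]) (use that g assms(2) in auto)
  ultimately have "truncate_poly v' f = (\<Sum>l<n. pconst (c l) * (\<Prod>i\<in>verts Q. truncate_poly v' (g l i))) \<and>
      (\<forall>l<n. \<forall>i\<in>verts Q. truncate_poly v' (g l i) \<in> partially_symmetric (v' i) (m i) i)"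
    by blast
  then show ?thesis unfolding Lambda_ring_def by (intro CollectI exI)
qed

lemma Lambda_ring_lift:
  fixes f :: "('i, 'k::field) wpoly"
  assumes f: "f \<in> Lambda_ring Q v' m"
    and le: "\<And>i. i \<in> verts Q \<Longrightarrow> m i \<le> v' i" "\<And>i. i \<in> verts Q \<Longrightarrow> v' i \<le> v i"
  shows "\<exists>p\<in>Lambda_ring Q v m. truncate_poly v' p = f"
proof -
  interpret ring_map "truncate_poly v' :: ('i, 'k) wpoly \<Rightarrow> _" by (rule ring_map_truncate_poly)
  obtain n :: nat and c g where f: "f = (\<Sum>l<n. pconst (c l) * (\<Prod>i\<in>verts Q. g l i))"
    and g: "\<forall>l<n. \<forall>i\<in>verts Q. g l i \<in> partially_symmetric (v' i) (m i) i"
    using f unfolding Lambda_ring_def by blast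
  have "\<forall>l i. \<exists>p. l < n \<and> i \<in> verts Q \<longrightarrow> p \<in> partially_symmetric (v i) (m i) i \<and> truncate_poly v' p = g l i"
    using partially_symmetric_lift[where v = v and v' = v'] le g by metis
  then obtain G where G: "\<And>l i. l < n \<Longrightarrow> i \<in> verts Q \<Longrightarrow> G l i \<in> partially_symmetric (v i) (m i) i"
    and tr: "\<And>l i. l < n \<Longrightarrow> i \<in> verts Q \<Longrightarrow> truncate_poly v' (G l i) = g l i"
    by metis
  let ?p = "\<Sum>l<n. pconst (c l) * (\<Prod>i\<in>verts Q. G l i)"
  have "truncate_poly v' ?p = f"
    unfolding f map_sum map_mult map_prod
    by (intro sum.cong arg_cong2[where f = times] prod.cong) (auto simp: tr)
  moreover have "?p \<in> Lambda_ring Q v m"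
    unfolding Lambda_ring_def using G by blast
  ultimately show ?thesis by blast
qed

text \<open>
  The condition on the permutations among which \<open>restrict_poly\<close> makes its choice.
\<close>

definition selects :: "('i, 'e) pre_digraph \<Rightarrow> ('i \<Rightarrow> nat) \<Rightarrow> ('i \<Rightarrow> nat) \<Rightarrow> ('i \<Rightarrow> nat set) \<Rightarrow>
    ('i \<Rightarrow> nat \<Rightarrow> nat) \<Rightarrow> bool" where
  "selects Q v m \<Gamma> \<sigma> \<longleftrightarrow> (\<forall>i\<in>verts Q. \<sigma> i permutes {1..v i} \<and> \<sigma> i ` {1..m i} = \<Gamma> i)"

lemma selects_exists:
  assumes \<Gamma>: "\<Gamma> \<in> subset_tuples Q v m"
  shows "\<exists>\<sigma>. selects Q v m \<Gamma> \<sigma>"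
proof -
  have "\<exists>\<sigma>. \<sigma> permutes {1..v i} \<and> \<sigma> ` {1..m i} = \<Gamma> i" if "i \<in> verts Q" for i
  proof -
    have \<Gamma>i: "\<Gamma> i \<subseteq> {1..v i}" "card (\<Gamma> i) = m i"
      using \<Gamma> that by (auto simp: subset_tuples_def PiE_iff)
    then have "finite (\<Gamma> i)" by (simp add: finite_subset)
    then obtain f where f: "bij_betw f {1..m i} (\<Gamma> i)"
      using \<Gamma>i(2) finite_same_card_bij[of "{1..m i}" "\<Gamma> i"] by auto
    have "m i \<le> v i" using \<Gamma>i card_mono[of "{1..v i}" "\<Gamma> i"] by simp
    then obtain \<sigma> where "\<sigma> permutes {1..v i}" "\<And>a. a \<in> {1..m i} \<Longrightarrow> \<sigma> a = f a"
      using permutes_extend[of "{1..v i}" "{1..m i}" f] f \<Gamma>i(1) by (auto simp: bij_betw_def)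
    moreover from this(2) have "\<sigma> ` {1..m i} = \<Gamma> i"
      using f by (auto simp: bij_betw_def)
    ultimately show ?thesis by blast
  qed
  then show ?thesis unfolding selects_def by metis
qed

lemma psubst_partially_symmetric:
  fixes p :: "('i, 'k::field) wpoly"
  assumes p: "p \<in> partially_symmetric n k i"
    and "\<sigma> i permutes {1..n}" "\<tau> i permutes {1..n}" "\<sigma> i ` {1..k} = \<tau> i ` {1..k}"
  shows "psubst (\<lambda>j r. wvar j (\<sigma> j r)) p = psubst (\<lambda>j r. wvar j (\<tau> j r)) p"
proof -
  let ?\<rho> = "inv_into UNIV (\<tau> i) \<circ> \<sigma> i"
  have inv: "\<tau> i (?\<rho> r) = \<sigma> i r" for r
    using assms(3) by (simp add: permutes_inverses)
  have "?\<rho> ` {1..k} = inv_into UNIV (\<tau> i) ` \<tau> i ` {1..k}"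
    using assms(4) by (simp only: image_comp[symmetric])
  also have "\<dots> = {1..k}"
    using assms(3) permutes_inj image_inv_f_f by metis
  finally have \<rho>: "?\<rho> permutes {1..n} \<and> ?\<rho> ` {1..k} = {1..k}"
    using assms(2,3) by (simp add: permutes_compose permutes_inv)
  then have inv_p: "psubst (\<lambda>j r. wvar j (?\<rho> r)) p = p"
    using p unfolding partially_symmetric_def by blast
  have vars: "j = i" if "Idx j r \<in> pvars p" for j r
    using p that unfolding partially_symmetric_def by auto
  have "psubst (\<lambda>j r. wvar j (\<tau> j r)) p = psubst (\<lambda>j r. wvar j (\<tau> i r)) p"
    by (rule psubst_cong) (auto dest: vars)
  also have "\<dots> = psubst (\<lambda>j r. wvar j (\<tau> i r)) (psubst (\<lambda>j r. wvar j (?\<rho> r)) p)"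
    by (simp only: inv_p)
  also have "\<dots> = psubst (\<lambda>j r. wvar j (\<sigma> i r)) p"
    unfolding psubst_psubst psubst_wvar inv ..
  also have "\<dots> = psubst (\<lambda>j r. wvar j (\<sigma> j r)) p"
    by (rule psubst_cong) (auto dest: vars)
  finally show ?thesis by simp
qed

lemma restrict_poly_eq:
  assumes f: "f \<in> Lambda_ring Q v m" and \<sigma>: "selects Q v m \<Gamma> \<sigma>"
  shows "restrict_poly Q v m \<Gamma> f = psubst (\<lambda>i r. wvar i (\<sigma> i r)) f"
proof -
  define \<tau> where "\<tau> = (SOME \<sigma>. selects Q v m \<Gamma> \<sigma>)"
  have \<tau>: "selects Q v m \<Gamma> \<tau>" unfolding \<tau>_def by (rule someI[of "selects Q v m \<Gamma>", OF \<sigma>])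
  have "restrict_poly Q v m \<Gamma> f = psubst (\<lambda>i r. wvar i (\<tau> i r)) f"
    by (simp add: restrict_poly_def \<tau>_def selects_def Let_def)
  also have "\<dots> = psubst (\<lambda>i r. wvar i (\<sigma> i r)) f"
  proof (rule Lambda_ring_eqI[OF f ring_map_psubst ring_map_psubst])
    fix i g assume "i \<in> verts Q" "g \<in> partially_symmetric (v i) (m i) i"
    then show "psubst (\<lambda>i r. wvar i (\<tau> i r)) g = psubst (\<lambda>i r. wvar i (\<sigma> i r)) g"
      using \<sigma> \<tau> by (intro psubst_partially_symmetric[of g "v i" "m i" i]) (simp_all only: selects_def)
  qed simp
  finally show ?thesis .
qed

text \<open>
  The permutation that computes the restriction to a visible \<open>\<Gamma>\<close> can be taken to fix all hidden
  indices, and then it commutes with setting the hidden variables to zero.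
\<close>

lemma truncate_restrict_poly:
  fixes f :: "('i, 'k::field) wpoly"
  assumes f: "f \<in> Lambda_ring Q v m" and \<Gamma>: "\<Gamma> \<in> subset_tuples Q v' m"
    and le: "\<And>i. i \<in> verts Q \<Longrightarrow> v' i \<le> v i"
  shows "truncate_poly v' (restrict_poly Q v m \<Gamma> f) = restrict_poly Q v' m \<Gamma> (truncate_poly v' f)"
proof -
  obtain \<sigma> where \<sigma>: "selects Q v' m \<Gamma> \<sigma>" using selects_exists[OF \<Gamma>] by blast
  then have "selects Q v m \<Gamma> \<sigma>"
    using le unfolding selects_def by (meson atLeastatMost_subset_iff order_refl permutes_subset)
  then have "truncate_poly v' (restrict_poly Q v m \<Gamma> f) = truncate_poly v' (psubst (\<lambda>i r. wvar i (\<sigma> i r)) f)"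
    using restrict_poly_eq[OF f] by simp
  also have "\<dots> = psubst (\<lambda>i r. wvar i (\<sigma> i r)) (truncate_poly v' f)"
  proof (rule Lambda_ring_eqI[OF f])
    fix i and g :: "('i, 'k) wpoly" assume i: "i \<in> verts Q" and g: "g \<in> partially_symmetric (v i) (m i) i"
    have vars: "j = i" if "Idx j r \<in> pvars g" for j r
      using g that unfolding partially_symmetric_def by auto
    have perm: "\<sigma> i permutes {1..v' i}" using \<sigma> i by (simp add: selects_def)
    have "\<sigma> i r > v' i \<longleftrightarrow> r > v' i" for r
      using permutes_in_image[OF perm, of r] permutes_not_in[OF perm, of r]
      by (cases "r \<in> {1..v' i}") auto
    then show "truncate_poly v' (psubst (\<lambda>i r. wvar i (\<sigma> i r)) g) = psubst (\<lambda>i r. wvar i (\<sigma> i r)) (truncate_poly v' g)"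
      unfolding truncate_poly_def psubst_psubst
      by (intro psubst_cong) (auto dest!: vars simp: ring_map.map_zero[OF ring_map_psubst])
  qed (simp_all add: ring_map_comp ring_map_psubst ring_map_truncate_poly)
  also have "\<dots> = restrict_poly Q v' m \<Gamma> (truncate_poly v' f)"
    using restrict_poly_eq[OF truncate_poly_Lambda_ring[OF f le] \<sigma>] by simp
  finally show ?thesis .
qed


section \<open>Surjective ring homomorphisms and closed immersions\<close>

lemma topspace_zariski: "topspace (zariski R) = {P. primeideal P R}"
proof -
  have "\<not> carrier R \<subseteq> P" if "primeideal P R" for P
  proof -
    interpret primeideal P R by fact
    show ?thesis using a_subset I_notcarr by blast
  qed
  then have "openin (zariski R) {P. primeideal P R}"
    unfolding openin_zariski by (intro exI[of _ "carrier R"]) blast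
  moreover have "U \<subseteq> {P. primeideal P R}" if "openin (zariski R) U" for U
    using that unfolding openin_zariski by blast
  ultimately show ?thesis
    by (metis openin_subset openin_topspace subset_antisym)
qed

lemma closedin_zariski:
  "closedin (zariski R) C \<longleftrightarrow> (\<exists>E. E \<subseteq> carrier R \<and> C = {P. primeideal P R \<and> E \<subseteq> P})"
proof
  assume "closedin (zariski R) C"
  then obtain E where "E \<subseteq> carrier R" "{P. primeideal P R} - C = {P. primeideal P R \<and> \<not> E \<subseteq> P}"
    and "C \<subseteq> {P. primeideal P R}"
    unfolding closedin_def topspace_zariski openin_zariski by blast
  then show "\<exists>E. E \<subseteq> carrier R \<and> C = {P. primeideal P R \<and> E \<subseteq> P}"
    by (intro exI[of _ E]) blast
next
  assume "\<exists>E. E \<subseteq> carrier R \<and> C = {P. primeideal P R \<and> E \<subseteq> P}"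
  then obtain E where "E \<subseteq> carrier R" "C = {P. primeideal P R \<and> E \<subseteq> P}" by blast
  then show "closedin (zariski R) C"
    unfolding closedin_def topspace_zariski openin_zariski by (intro conjI exI[of _ E]) blast+
qed

context ring_hom_cring
begin

lemma primeideal_spec_map:
  assumes "primeideal q S"
  shows "primeideal (spec_map R h q) R"
proof -
  interpret q: primeideal q S by fact
  show ?thesis
  proof (rule primeidealI)
    show "ideal (spec_map R h q) R"
    proof (rule idealI)
      show "subgroup (spec_map R h q) (add_monoid R)"
        by (rule R.add.subgroupI) (auto simp: spec_map_def)
    qed (auto simp: spec_map_def R.ring_axioms q.I_l_closed q.I_r_closed)
    have "\<one>\<^bsub>S\<^esub> \<notin> q" using q.one_imp_carrier q.I_notcarr by blast
    then have "\<one> \<notin> spec_map R h q" by (simp add: spec_map_def)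
    then show "carrier R \<noteq> spec_map R h q" using R.one_closed by blast
    show "a \<in> spec_map R h q \<or> b \<in> spec_map R h q"
      if "a \<in> carrier R" "b \<in> carrier R" "a \<otimes> b \<in> spec_map R h q" for a b
      using that q.I_prime[of "h a" "h b"] by (auto simp: spec_map_def)
  qed (rule R.is_cring)
qed

lemma mem_image_iff_if_kernel_subset:
  assumes "ideal P R" and ker: "\<And>x. x \<in> carrier R \<Longrightarrow> h x = \<zero>\<^bsub>S\<^esub> \<Longrightarrow> x \<in> P"
    and a: "a \<in> carrier R"
  shows "h a \<in> h ` P \<longleftrightarrow> a \<in> P"
proof
  interpret P: ideal P R by fact
  assume "h a \<in> h ` P"
  then obtain p where p: "p \<in> P" "h a = h p" by blast
  then have "p \<in> carrier R" using P.a_subset by blast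
  have "a \<ominus> p \<in> P"
    by (rule ker) (use a p \<open>p \<in> carrier R\<close> in \<open>auto simp: a_minus_def S.r_neg\<close>)
  then have "(a \<ominus> p) \<oplus> p \<in> P" using p(1) by (rule P.a_closed)
  then show "a \<in> P" using a \<open>p \<in> carrier R\<close> by (simp add: a_minus_def R.add.m_assoc R.l_neg)
qed simp

lemma primeideal_image:
  assumes "primeideal P R" and ker: "\<And>x. x \<in> carrier R \<Longrightarrow> h x = \<zero>\<^bsub>S\<^esub> \<Longrightarrow> x \<in> P"
    and surj: "h ` carrier R = carrier S"
  shows "primeideal (h ` P) S"
proof -
  interpret P: primeideal P R by fact
  note mem = mem_image_iff_if_kernel_subset[OF P.ideal_axioms ker]
  have sub: "p \<in> carrier R" if "p \<in> P" for p using that P.a_subset by blast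
  show ?thesis
  proof (rule primeidealI)
    show "ideal (h ` P) S"
    proof (rule idealI)
      show "subgroup (h ` P) (add_monoid S)"
      proof (rule S.add.subgroupI)
        show "h ` P \<subseteq> carrier S" using sub by auto
        show "h ` P \<noteq> {}" using P.zero_closed by blast
      next
        fix x assume "x \<in> h ` P"
        then obtain p where "p \<in> P" "x = h p" by blast
        then have "\<ominus>\<^bsub>S\<^esub> x = h (\<ominus> p)" "\<ominus> p \<in> P" using sub by auto
        then show "\<ominus>\<^bsub>S\<^esub> x \<in> h ` P" by blast
      next
        fix x y assume "x \<in> h ` P" "y \<in> h ` P"
        then obtain p r where "p \<in> P" "x = h p" "r \<in> P" "y = h r" by blast
        then have "x \<oplus>\<^bsub>S\<^esub> y = h (p \<oplus> r)" "p \<oplus> r \<in> P" using sub by auto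
        then show "x \<oplus>\<^bsub>S\<^esub> y \<in> h ` P" by blast
      qed
    next
      fix a x assume "a \<in> h ` P" "x \<in> carrier S"
      then obtain p r where "p \<in> P" "a = h p" "r \<in> carrier R" "x = h r"
        using surj by blast
      then have "x \<otimes>\<^bsub>S\<^esub> a = h (r \<otimes> p)" "r \<otimes> p \<in> P" using sub P.I_l_closed by auto
      then show "x \<otimes>\<^bsub>S\<^esub> a \<in> h ` P" by blast
      then show "a \<otimes>\<^bsub>S\<^esub> x \<in> h ` P"
        using \<open>x \<in> carrier S\<close> \<open>a = h p\<close> \<open>p \<in> P\<close> sub S.m_comm by force
    qed (rule S.ring_axioms)
    show "carrier S \<noteq> h ` P"
    proof
      assume "carrier S = h ` P"
      then have "h \<one> \<in> h ` P" using S.one_closed hom_one by metis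
      then have "\<one> \<in> P" using mem R.one_closed by blast
      then show False using P.one_imp_carrier P.I_notcarr by blast
    qed
    show "a \<in> h ` P \<or> b \<in> h ` P"
      if ab: "a \<in> carrier S" "b \<in> carrier S" "a \<otimes>\<^bsub>S\<^esub> b \<in> h ` P" for a b
    proof -
      obtain x y where xy: "x \<in> carrier R" "a = h x" "y \<in> carrier R" "b = h y"
        using ab(1,2) surj by blast
      then have "x \<otimes> y \<in> P" using ab(3) mem[of "x \<otimes> y"] by simp
      then show ?thesis using P.I_prime[of x y] xy by auto
    qed
  qed (rule S.is_cring)
qed

text \<open>
  For a surjective \<open>h\<close> the primes of \<open>S\<close> correspond, by preimage and image, to the primes of \<open>R\<close> that
  contain the kernel, and these form a closed set.  Fractions over \<open>S\<close> lift numerator and denominator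
  separately.
\<close>

lemma closed_immersion_if_surjective:
  assumes surj: "h ` carrier R = carrier S"
  shows "closed_immersion R S h"
proof -
  have image: "h ` spec_map R h q = q" if "primeideal q S" for q
  proof -
    interpret q: primeideal q S by fact
    show ?thesis using surj q.a_subset by (auto simp: spec_map_def)
  qed
  have cont: "continuous_map (zariski S) (zariski R) (spec_map R h)"
    unfolding continuous_map topspace_zariski
  proof (intro conjI allI impI)
    show "spec_map R h ` {P. primeideal P S} \<subseteq> {P. primeideal P R}"
      using primeideal_spec_map by blast
    fix U assume "openin (zariski R) U"
    then obtain E where E: "E \<subseteq> carrier R" "U = {P. primeideal P R \<and> \<not> E \<subseteq> P}"
      unfolding openin_zariski by blast
    have "{q \<in> {P. primeideal P S}. spec_map R h q \<in> U} = {q. primeideal q S \<and> \<not> h ` E \<subseteq> q}"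
      using E primeideal_spec_map by (auto simp: spec_map_def)
    then show "openin (zariski S) {q \<in> {P. primeideal P S}. spec_map R h q \<in> U}"
      unfolding openin_zariski using E(1) by (intro exI[of _ "h ` E"]) auto
  qed
  have closed: "closed_map (zariski S) (zariski R) (spec_map R h)"
    unfolding closed_map_def
  proof (intro allI impI)
    fix C assume "closedin (zariski S) C"
    then obtain F where F: "F \<subseteq> carrier S" "C = {q. primeideal q S \<and> F \<subseteq> q}"
      unfolding closedin_zariski by blast
    \<comment> \<open>The zero is added to \<open>F\<close> so that its preimage contains the kernel.\<close>
    let ?E = "{x \<in> carrier R. h x \<in> insert \<zero>\<^bsub>S\<^esub> F}"
    have "spec_map R h ` C = {P. primeideal P R \<and> ?E \<subseteq> P}"
    proof (intro subset_antisym subsetI)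
      fix P assume "P \<in> spec_map R h ` C"
      then obtain q where q: "primeideal q S" "F \<subseteq> q" "P = spec_map R h q"
        using F(2) by blast
      interpret q: primeideal q S by fact
      show "P \<in> {P. primeideal P R \<and> ?E \<subseteq> P}"
        using q primeideal_spec_map[OF q(1)] q.zero_closed by (auto simp: spec_map_def)
    next
      fix P assume "P \<in> {P. primeideal P R \<and> ?E \<subseteq> P}"
      then have P: "primeideal P R" and E: "?E \<subseteq> P" by blast+
      interpret P: primeideal P R by fact
      have ker: "x \<in> P" if "x \<in> carrier R" "h x = \<zero>\<^bsub>S\<^esub>" for x
        using that E by blast
      have "F \<subseteq> h ` P"
      proof
        fix y assume "y \<in> F"
        then obtain x where x: "x \<in> carrier R" "y = h x" using F(1) surj by blast
        then have "x \<in> P" using E \<open>y \<in> F\<close> by blast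
        then show "y \<in> h ` P" using x(2) by blast
      qed
      then have "h ` P \<in> C" using primeideal_image[OF P ker surj] F(2) by blast
      moreover have "spec_map R h (h ` P) = P"
        using mem_image_iff_if_kernel_subset[OF P.ideal_axioms ker] P.a_subset
        by (auto simp: spec_map_def)
      ultimately show "P \<in> spec_map R h ` C" by blast
    qed
    then show "closedin (zariski R) (spec_map R h ` C)"
      unfolding closedin_zariski by (intro exI[of _ ?E]) blast
  qed
  have "inj_on (spec_map R h) (topspace (zariski S))"
    by (rule inj_on_inverseI[of _ "image h"]) (simp add: topspace_zariski image)
  then have "embedding_map (zariski S) (zariski R) (spec_map R h)"
    using cont closed by (intro injective_closed_imp_embedding_map)
  moreover have "closedin (zariski R) (spec_map R h ` topspace (zariski S))"
    using closed unfolding closed_map_def by blast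
  moreover have "stalk_surjective R S h q" if "primeideal q S" for q
  proof -
    interpret q: primeideal q S by fact
    have "\<one>\<^bsub>S\<^esub> \<notin> q" using q.one_imp_carrier q.I_notcarr by blast
    show ?thesis
      unfolding stalk_surjective_def
    proof (intro ballI)
      fix b s assume b: "b \<in> carrier S" and s: "s \<in> carrier S - q"
      obtain a t where at: "a \<in> carrier R" "b = h a" "t \<in> carrier R" "s = h t"
        using b s surj by blast
      have "t \<in> carrier R - spec_map R h q" using at s by (simp add: spec_map_def)
      moreover have "\<one>\<^bsub>S\<^esub> \<otimes>\<^bsub>S\<^esub> (h a \<otimes>\<^bsub>S\<^esub> s) = \<one>\<^bsub>S\<^esub> \<otimes>\<^bsub>S\<^esub> (h t \<otimes>\<^bsub>S\<^esub> b)"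
        using at by (simp add: S.m_comm)
      ultimately show "\<exists>a\<in>carrier R. \<exists>t\<in>carrier R - spec_map R h q. \<exists>x\<in>carrier S - q.
          x \<otimes>\<^bsub>S\<^esub> (h a \<otimes>\<^bsub>S\<^esub> s) = x \<otimes>\<^bsub>S\<^esub> (h t \<otimes>\<^bsub>S\<^esub> b)"
        using at \<open>\<one>\<^bsub>S\<^esub> \<notin> q\<close> by (intro bexI[of _ a] bexI[of _ t] bexI[of _ "\<one>\<^bsub>S\<^esub>"]) auto
    qed
  qed
  ultimately show ?thesis
    unfolding closed_immersion_def using homh by blast
qed

end


section \<open>Generated subalgebras\<close>

lemma scalar_one: "scalar 1 = 1"
  by (simp add: scalar_def pconst_def flip: One_fract_def)

lemma scalar_zero: "scalar 0 = 0"
  by (simp add: scalar_def pconst_def flip: Zero_fract_def)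

lemma scalar_uminus: "scalar (- c) = - scalar c"
  by (simp add: scalar_def pconst_def single_uminus[symmetric])

lemma subalgebra_gen_uminus:
  assumes "x \<in> subalgebra_gen S"
  shows "- x \<in> subalgebra_gen S"
proof -
  have "scalar (- 1) * x \<in> subalgebra_gen S"
    by (intro subalgebra_gen.intros assms)
  then show ?thesis by (simp add: scalar_uminus scalar_one)
qed

lemma cring_subalgebra_gen:
  fixes S :: "('i, 'k::field) loc set"
  shows "cring \<lparr>carrier = subalgebra_gen S, mult = (*), one = 1, zero = 0, add = (+)\<rparr>"
    (is "cring ?R")
proof (rule cringI)
  show "abelian_group ?R"
  proof (rule abelian_groupI)
    fix x assume "x \<in> carrier ?R"
    then show "\<exists>y\<in>carrier ?R. y \<oplus>\<^bsub>?R\<^esub> x = \<zero>\<^bsub>?R\<^esub>"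
      by (intro bexI[of _ "- x"]) (simp_all add: subalgebra_gen_uminus)
  qed (use subalgebra_gen.intros(1)[of 0 S] in
    \<open>simp_all add: subalgebra_gen.intros scalar_zero add_ac\<close>)
  show "comm_monoid ?R"
    by (rule comm_monoidI)
       (use subalgebra_gen.intros(1)[of 1 S] in
         \<open>simp_all add: subalgebra_gen.intros scalar_one mult_ac\<close>)
qed (simp add: distrib_right)

lemma cring_slice_ring: "cring (slice_ring Q v w)"
  unfolding slice_ring_def by (rule cring_subalgebra_gen)

lemma image_subalgebra_gen:
  assumes scalar: "\<And>c. \<phi> (scalar c) = scalar c"
    and add: "\<And>x y. x \<in> subalgebra_gen S \<Longrightarrow> y \<in> subalgebra_gen S \<Longrightarrow> \<phi> (x + y) = \<phi> x + \<phi> y"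
    and mult: "\<And>x y. x \<in> subalgebra_gen S \<Longrightarrow> y \<in> subalgebra_gen S \<Longrightarrow> \<phi> (x * y) = \<phi> x * \<phi> y"
    and into: "\<And>x. x \<in> S \<Longrightarrow> \<phi> x \<in> subalgebra_gen T"
    and onto: "T \<subseteq> \<phi> ` S"
  shows "\<phi> ` subalgebra_gen S = subalgebra_gen T"
proof (intro subset_antisym subsetI)
  fix y assume "y \<in> \<phi> ` subalgebra_gen S"
  then obtain x where "x \<in> subalgebra_gen S" "y = \<phi> x" by blast
  then show "y \<in> subalgebra_gen T"
    by (induction x arbitrary: y rule: subalgebra_gen.induct)
       (auto simp: scalar add mult into intro: subalgebra_gen.intros)
next
  fix y assume "y \<in> subalgebra_gen T"
  then show "y \<in> \<phi> ` subalgebra_gen S"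
  proof (induction y rule: subalgebra_gen.induct)
    case (1 c)
    have "scalar c \<in> subalgebra_gen S" by (rule subalgebra_gen.intros)
    then show ?case using scalar by (metis image_eqI)
  next
    case (2 y)
    then show ?case using onto subalgebra_gen.intros(2) by blast
  next
    case (3 x y)
    then obtain a b where "a \<in> subalgebra_gen S" "b \<in> subalgebra_gen S" "x = \<phi> a" "y = \<phi> b" by blast
    then show ?case by (intro image_eqI[of _ \<phi> "a + b"]) (simp_all add: add subalgebra_gen.intros)
  next
    case (4 x y)
    then obtain a b where "a \<in> subalgebra_gen S" "b \<in> subalgebra_gen S" "x = \<phi> a" "y = \<phi> b" by blast
    then show ?case by (intro image_eqI[of _ \<phi> "a * b"]) (simp_all add: mult subalgebra_gen.intros)
  qed
qed


section \<open>Dimension vectors\<close>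

lemma (in fin_digraph) sum_arcs_group:
  fixes g :: "'b \<Rightarrow> int"
  shows "(\<Sum>a\<in>arcs G. f (tail G a) * g a) =
    (\<Sum>i\<in>verts G. f i * (\<Sum>a\<in>{a \<in> arcs G. tail G a = i}. g a))"
    and "(\<Sum>a\<in>arcs G. f (head G a) * g a) =
    (\<Sum>i\<in>verts G. f i * (\<Sum>a\<in>{a \<in> arcs G. head G a = i}. g a))"
proof -
  have "(\<Sum>a\<in>arcs G. f (p a) * g a) = (\<Sum>i\<in>verts G. f i * (\<Sum>a\<in>{a \<in> arcs G. p a = i}. g a))"
    if "\<And>a. a \<in> arcs G \<Longrightarrow> p a \<in> verts G" for p
  proof -
    have "(\<Sum>a\<in>arcs G. f (p a) * g a) = (\<Sum>i\<in>verts G. \<Sum>a\<in>{a \<in> arcs G. p a = i}. f (p a) * g a)"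
      using that by (intro sum.group[symmetric]) auto
    then show ?thesis by (simp add: sum_distrib_left)
  qed
  then show "(\<Sum>a\<in>arcs G. f (tail G a) * g a) =
    (\<Sum>i\<in>verts G. f i * (\<Sum>a\<in>{a \<in> arcs G. tail G a = i}. g a))"
    and "(\<Sum>a\<in>arcs G. f (head G a) * g a) =
    (\<Sum>i\<in>verts G. f i * (\<Sum>a\<in>{a \<in> arcs G. head G a = i}. g a))"
    by auto
qed

text \<open>
  The arrows between \<open>i\<close> and \<open>j\<close> are those from \<open>i\<close> to \<open>j\<close> and those from \<open>j\<close> to \<open>i\<close>; the absence of loops
  makes the two kinds disjoint.
\<close>

lemma cartan_sum:
  fixes Q :: "('i, 'e) pre_digraph"
  assumes "fin_digraph Q" "loopfree_digraph Q" and i: "i \<in> verts Q"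
  shows "(\<Sum>j\<in>verts Q. cartan Q i j * x j) = 2 * x i
    - (\<Sum>a\<in>{a \<in> arcs Q. tail Q a = i}. x (head Q a))
    - (\<Sum>a\<in>{a \<in> arcs Q. head Q a = i}. x (tail Q a))"
proof -
  interpret fin_digraph Q by fact
  interpret loopfree_digraph Q by fact
  have count: "int (card {a \<in> arcs Q. {tail Q a, head Q a} = {i, j}}) =
      (\<Sum>a\<in>{a \<in> arcs Q. tail Q a = i}. if head Q a = j then 1 else 0)
      + (\<Sum>a\<in>{a \<in> arcs Q. head Q a = i}. if tail Q a = j then 1 else 0)" if "j \<noteq> i" for j
  proof -
    have "{a \<in> arcs Q. {tail Q a, head Q a} = {i, j}} =
       {a \<in> arcs Q. tail Q a = i \<and> head Q a = j} \<union> {a \<in> arcs Q. head Q a = i \<and> tail Q a = j}"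
      by (auto simp: doubleton_eq_iff)
    moreover have "{a \<in> arcs Q. tail Q a = i \<and> head Q a = j} \<inter> {a \<in> arcs Q. head Q a = i \<and> tail Q a = j} = {}"
      using that by auto
    ultimately have "card {a \<in> arcs Q. {tail Q a, head Q a} = {i, j}} =
      card {a \<in> arcs Q. tail Q a = i \<and> head Q a = j} + card {a \<in> arcs Q. head Q a = i \<and> tail Q a = j}"
      by (simp add: card_Un_disjoint)
    then show ?thesis
      by (simp add: sum.If_cases Int_def)
  qed
  have count': "(\<Sum>j\<in>verts Q. (\<Sum>a\<in>{a \<in> arcs Q. p a = i}. if r a = j then 1 else 0) * x j)
      = (\<Sum>a\<in>{a \<in> arcs Q. p a = i}. x (r a))" if "\<And>a. a \<in> arcs Q \<Longrightarrow> r a \<in> verts Q" for p r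
  proof -
    have "(\<Sum>j\<in>verts Q. (\<Sum>a\<in>{a \<in> arcs Q. p a = i}. if r a = j then 1 else 0) * x j)
      = (\<Sum>a\<in>{a \<in> arcs Q. p a = i}. \<Sum>j\<in>verts Q. if r a = j then x j else 0)"
      unfolding sum_distrib_right by (subst sum.swap) (intro sum.cong; simp)
    then show ?thesis using that by simp
  qed
  let ?T = "\<lambda>j. \<Sum>a\<in>{a \<in> arcs Q. tail Q a = i}. if head Q a = j then 1 else 0 :: int"
  let ?H = "\<lambda>j. \<Sum>a\<in>{a \<in> arcs Q. head Q a = i}. if tail Q a = j then 1 else 0 :: int"
  have "?T i = 0" "?H i = 0"
    using no_loops by (force intro!: sum.neutral)+
  then have "cartan Q i j = (if i = j then 2 else 0) - ?T j - ?H j" for j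
    using count[of j] by (auto simp: cartan_def)
  then have "(\<Sum>j\<in>verts Q. cartan Q i j * x j) =
     (\<Sum>j\<in>verts Q. (if i = j then 2 * x i else 0) - ?T j * x j - ?H j * x j)"
    by (intro sum.cong) (auto simp: left_diff_distrib)
  also have "\<dots> = 2 * x i - (\<Sum>j\<in>verts Q. ?T j * x j) - (\<Sum>j\<in>verts Q. ?H j * x j)"
    using i by (simp add: sum_subtractf)
  finally show ?thesis by (simp add: count')
qed

lemma cartan_form:
  fixes Q :: "('i, 'e) pre_digraph" and u x :: "'i \<Rightarrow> int"
  assumes "fin_digraph Q" "loopfree_digraph Q"
  shows "(\<Sum>i\<in>verts Q. u i * (\<Sum>j\<in>verts Q. cartan Q i j * x j)) =
    2 * (\<Sum>i\<in>verts Q. u i * x i)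
    - (\<Sum>a\<in>arcs Q. u (tail Q a) * x (head Q a)) - (\<Sum>a\<in>arcs Q. u (head Q a) * x (tail Q a))"
proof -
  interpret fin_digraph Q by fact
  have "(\<Sum>i\<in>verts Q. u i * (\<Sum>j\<in>verts Q. cartan Q i j * x j)) =
    (\<Sum>i\<in>verts Q. 2 * (u i * x i) - u i * (\<Sum>a\<in>{a \<in> arcs Q. tail Q a = i}. x (head Q a))
      - u i * (\<Sum>a\<in>{a \<in> arcs Q. head Q a = i}. x (tail Q a)))"
    by (intro sum.cong refl) (simp add: cartan_sum[OF assms] right_diff_distrib mult.left_commute)
  then show ?thesis
    using sum_arcs_group(1)[of u "\<lambda>a. x (head Q a)"] sum_arcs_group(2)[of u "\<lambda>a. x (tail Q a)"]
    by (simp only: sum_subtractf sum_distrib_left[symmetric])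
qed

text \<open>
  The multiplicities of the simple coroots in a difference of coweights are its pairings with the
  fundamental weights, and they determine its pairings with the simple roots through the Cartan matrix.
\<close>

lemma dominance_le_fund_weight:
  assumes "root_datum Q scale coroot \<alpha> \<Lambda>" "dominance_le Q scale coroot mu lam"
  shows "\<exists>n. (\<forall>i\<in>verts Q. \<Lambda> i (lam - mu) = int (n i)) \<and>
    (\<forall>i\<in>verts Q. \<alpha> i (lam - mu) = (\<Sum>j\<in>verts Q. cartan Q i j * int (n j)))"
proof -
  interpret root_datum Q scale coroot \<alpha> \<Lambda> by fact
  obtain n :: "'a \<Rightarrow> nat" where n: "lam - mu = (\<Sum>i\<in>verts Q. scale (int (n i)) (coroot i))"
    using assms(2) unfolding dominance_le_def by blast
  have "\<Lambda> i (lam - mu) = int (n i)" if "i \<in> verts Q" for i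
  proof -
    interpret l: module_hom scale "(*)" "\<Lambda> i" by (rule fund_weight_linear) fact
    have "\<Lambda> i (lam - mu) = (\<Sum>j\<in>verts Q. if i = j then int (n j) else 0)"
      unfolding n l.sum by (intro sum.cong) (auto simp: l.scale fund_weight_coroot that)
    then show ?thesis using that by simp
  qed
  moreover have "\<alpha> i (lam - mu) = (\<Sum>j\<in>verts Q. cartan Q i j * int (n j))" if "i \<in> verts Q" for i
  proof -
    interpret l: module_hom scale "(*)" "\<alpha> i" by (rule simple_root_linear) fact
    show ?thesis
      unfolding n l.sum by (intro sum.cong) (auto simp: l.scale simple_root_coroot that)
  qed
  ultimately show ?thesis by blast
qed


section \<open>Characters of the exponent lattice\<close>

definition exponent_sum :: "('x \<Rightarrow> int) \<Rightarrow> ('x \<Rightarrow>\<^sub>0 int) \<Rightarrow> int" where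
  "exponent_sum c e = (\<Sum>x\<in>Poly_Mapping.keys e. c x * Poly_Mapping.lookup e x)"

definition exponent_prod :: "('x \<Rightarrow> 'a::field) \<Rightarrow> ('x \<Rightarrow>\<^sub>0 int) \<Rightarrow> 'a" where
  "exponent_prod g e = (\<Prod>x\<in>Poly_Mapping.keys e. g x powi Poly_Mapping.lookup e x)"

lemma exponent_sum_zero [simp]: "exponent_sum c 0 = 0"
  by (simp add: exponent_sum_def)

lemma exponent_prod_zero [simp]: "exponent_prod g 0 = 1"
  by (simp add: exponent_prod_def)

lemma exponent_sum_single [simp]: "exponent_sum c (Poly_Mapping.single x k) = c x * k"
  by (simp add: exponent_sum_def)

lemma exponent_prod_single [simp]: "exponent_prod g (Poly_Mapping.single x k) = g x powi k"
  by (simp add: exponent_prod_def)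

lemma exponent_sum_add: "exponent_sum c (a + b) = exponent_sum c a + exponent_sum c b"
proof -
  let ?A = "Poly_Mapping.keys a \<union> Poly_Mapping.keys b"
  have "exponent_sum c e = (\<Sum>x\<in>?A. c x * Poly_Mapping.lookup e x)" if "e \<in> {a, b, a + b}" for e
    unfolding exponent_sum_def
    by (rule sum.mono_neutral_left) (use that keys_add[of a b] in \<open>auto simp: in_keys_iff\<close>)
  then show ?thesis
    by (simp add: lookup_add distrib_left sum.distrib)
qed

lemma exponent_prod_add:
  assumes "\<And>x. g x \<noteq> 0"
  shows "exponent_prod g (a + b) = exponent_prod g a * exponent_prod g b"
proof -
  let ?A = "Poly_Mapping.keys a \<union> Poly_Mapping.keys b"
  have "exponent_prod g e = (\<Prod>x\<in>?A. g x powi Poly_Mapping.lookup e x)" if "e \<in> {a, b, a + b}" for e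
    unfolding exponent_prod_def
    by (rule prod.mono_neutral_left) (use that keys_add[of a b] in \<open>auto simp: in_keys_iff\<close>)
  then show ?thesis
    by (simp add: lookup_add power_int_add assms prod.distrib)
qed

lemma exponent_sum_uminus: "exponent_sum c (- e) = - exponent_sum c e"
  using exponent_sum_add[of c e "- e"] by simp

lemma exponent_prod_uminus:
  assumes "\<And>x. g x \<noteq> 0"
  shows "exponent_prod g (- e) = inverse (exponent_prod g e)"
  using exponent_prod_add[of g e "- e"] assms by (simp add: inverse_unique)

lemma exponent_sum_uexp:
  fixes Q :: "('i, 'e) pre_digraph"
  shows "exponent_sum c (uexp Q \<Gamma>) = (\<Sum>i\<in>verts Q. \<Sum>r\<in>\<Gamma> i. c (Idx i r))"
proof -
  have sum: "exponent_sum c (\<Sum>i\<in>A. F i) = (\<Sum>i\<in>A. exponent_sum c (F i))" for A :: "'i set" and F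
    by (induction A rule: infinite_finite_induct) (simp_all add: exponent_sum_add)
  have sum': "exponent_sum c (\<Sum>i\<in>A. F i) = (\<Sum>i\<in>A. exponent_sum c (F i))" for A :: "nat set" and F
    by (induction A rule: infinite_finite_induct) (simp_all add: exponent_sum_add)
  show ?thesis unfolding uexp_def sum sum' by simp
qed

lemma exponent_prod_uexp:
  fixes Q :: "('i, 'e) pre_digraph"
  assumes "\<And>x. g x \<noteq> 0"
  shows "exponent_prod g (uexp Q \<Gamma>) = (\<Prod>i\<in>verts Q. \<Prod>r\<in>\<Gamma> i. g (Idx i r))"
proof -
  have sum: "exponent_prod g (\<Sum>i\<in>A. F i) = (\<Prod>i\<in>A. exponent_prod g (F i))" for A :: "'i set" and F
    by (induction A rule: infinite_finite_induct) (simp_all add: exponent_prod_add assms)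
  have sum': "exponent_prod g (\<Sum>i\<in>A. F i) = (\<Prod>i\<in>A. exponent_prod g (F i))" for A :: "nat set" and F
    by (induction A rule: infinite_finite_induct) (simp_all add: exponent_prod_add assms)
  show ?thesis unfolding uexp_def sum sum' by simp
qed


section \<open>The limit of a monopole operator\<close>

lemma truncate_poly_wvar: "truncate_poly v' (wvar i r) = (if r > v' i then 0 else wvar i r)"
  by (simp add: truncate_poly_def)

lemma subset_tuplesD:
  assumes "\<Gamma> \<in> subset_tuples Q v m" "i \<in> verts Q"
  shows "\<Gamma> i \<subseteq> {1..v i}" "card (\<Gamma> i) = m i" "finite (\<Gamma> i)"
proof -
  show "\<Gamma> i \<subseteq> {1..v i}" "card (\<Gamma> i) = m i"
    using assms by (auto simp: subset_tuples_def PiE_iff)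
  then show "finite (\<Gamma> i)" by (simp add: finite_subset)
qed

lemma finite_subset_tuples: "finite (verts Q) \<Longrightarrow> finite (subset_tuples Q v m)"
  unfolding subset_tuples_def by (intro finite_PiE) auto

lemma subset_tuples_restrict:
  "subset_tuples Q v' m \<subseteq> subset_tuples Q v m" if "\<And>i. i \<in> verts Q \<Longrightarrow> v' i \<le> v i"
  using that unfolding subset_tuples_def by (intro PiE_mono) fastforce

lemma subset_tuples_empty:
  assumes "i \<in> verts Q" "v i < m i"
  shows "subset_tuples Q v m = {}"
proof -
  have False if "\<Gamma> \<in> subset_tuples Q v m" for \<Gamma>
    using subset_tuplesD[OF that assms(1)] card_mono[of "{1..v i}" "\<Gamma> i"] assms(2) by simp
  then show ?thesis by blast
qed

text \<open>
  Counts the factors that are hidden in both indices; each of them has order \<open>2\<close>.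
\<close>

lemma sum_if_rectangle:
  assumes "finite A" "finite B"
  shows "(\<Sum>r\<in>A. \<Sum>s\<in>B. if P r \<and> R s then 2 else 0 :: int) =
    2 * (int (card {r \<in> A. P r}) * int (card {s \<in> B. R s}))"
proof -
  have "(\<Sum>r\<in>A. \<Sum>s\<in>B. if P r \<and> R s then 2 else 0 :: int) =
    (\<Sum>r\<in>A. if P r then 2 * int (card {s \<in> B. R s}) else 0)"
  proof (rule sum.cong)
    fix r
    show "(\<Sum>s\<in>B. if P r \<and> R s then 2 else 0 :: int) = (if P r then 2 * int (card {s \<in> B. R s}) else 0)"
      using assms(2) by (cases "P r") (simp_all add: sum.If_cases Int_def conj_commute)
  qed simp
  then show ?thesis
    using assms(1) by (simp add: sum.If_cases Int_def conj_commute)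
qed

text \<open>
  Those consequences of the hypotheses on coweights that enter the computation with dimension
  vectors, where \<open>v - v'\<close> is the dimension vector of \<open>\<lambda> - \<lambda>'\<close>.
\<close>

locale nested_slices =
  fixes Q :: "('i, 'e) pre_digraph" and v v' w w' :: "'i \<Rightarrow> nat"
  assumes fin: "fin_digraph Q" and loopfree: "loopfree_digraph Q"
    and le: "i \<in> verts Q \<Longrightarrow> v' i \<le> v i"
    and w': "i \<in> verts Q \<Longrightarrow>
      int (w' i) = int (w i) - (\<Sum>j\<in>verts Q. cartan Q i j * int (v j - v' j))"
    and conic: "(\<forall>i\<in>verts Q. 0 \<le> u i \<and> u i \<le> int (v i - v' i)) \<Longrightarrow> (\<exists>i\<in>verts Q. u i \<noteq> 0) \<Longrightarrow>
      (\<Sum>i\<in>verts Q. u i * (int (w i) - (\<Sum>j\<in>verts Q. cartan Q i j * int (v j - v' j))))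
        + (\<Sum>i\<in>verts Q. u i * (\<Sum>j\<in>verts Q. cartan Q i j * u j)) \<ge> 1"
begin

sublocale fin_digraph Q by (rule fin)

definition codim :: "'i \<Rightarrow> nat" where
  "codim i = v i - v' i"

definition codim_out :: "'i \<Rightarrow> nat" where
  "codim_out i = (\<Sum>a\<in>{a \<in> arcs Q. tail Q a = i}. codim (head Q a))"

definition codim_in :: "'i \<Rightarrow> nat" where
  "codim_in i = (\<Sum>a\<in>{a \<in> arcs Q. head Q a = i}. codim (tail Q a))"

text \<open>
  The exponent \<open>c\<^bsub>i\<^esub>\<close> of the parameter by which a hidden \<open>u\<^bsub>i,r\<^esub>\<close> is multiplied.  The order of a
  coefficient of \<open>M\<^sup>-\<close> exceeds that of the coefficient of \<open>M\<^sup>+\<close> for the same \<open>\<Gamma>\<close> by a linear form in the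
  numbers of hidden elements, and \<open>c\<^bsub>i\<^esub>\<close> is half of its coefficient at \<open>i\<close>.
\<close>

definition charge :: "'i idx \<Rightarrow> int" where
  "charge x = (case x of Idx i r \<Rightarrow>
     if r > v' i then int (w i) + int (codim_in i) - int (codim_out i) else 0)"

text \<open>
  The inverse of the factor which \<open>u\<^bsub>i,r\<^esub>\<close> acquires in the limit of \<open>M\<^sup>+\<close>: the differences of \<open>w\<^bsub>i,r\<^esub>\<close> with
  hidden variables tend to \<open>w\<^bsub>i,r\<^esub>\<close> in the denominator and to \<open>- w\<^bsub>i,r\<^esub>\<close> for the arrows leaving \<open>i\<close>.
\<close>

definition rescaling :: "'i idx \<Rightarrow> ('i, 'k::field) wpoly fract" where
  "rescaling x = (case x of Idx i r \<Rightarrow> to_fract (wvar i r ^ codim i) / to_fract ((- wvar i r) ^ codim_out i))"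

definition hidden_count :: "('i \<Rightarrow> nat set) \<Rightarrow> 'i \<Rightarrow> nat" where
  "hidden_count \<Gamma> i = card {r \<in> \<Gamma> i. r > v' i}"

definition conicity_form :: "('i \<Rightarrow> int) \<Rightarrow> int" where
  "conicity_form u = (\<Sum>i\<in>verts Q. u i * (int (w i) - (\<Sum>j\<in>verts Q. cartan Q i j * int (codim j))))
        + (\<Sum>i\<in>verts Q. u i * (\<Sum>j\<in>verts Q. cartan Q i j * u j))"

abbreviation slice_limit :: "(('i idx \<Rightarrow>\<^sub>0 int) \<Rightarrow>\<^sub>0 ('i, 'k::field) wpoly fract) \<Rightarrow> ('i, 'k) loc" where
  "slice_limit \<equiv> degeneration.limit (contract v') (exponent_sum charge) (exponent_prod rescaling)"

abbreviation has_slice_limit :: "('i, 'k::field) loc \<Rightarrow> bool" where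
  "has_slice_limit \<equiv> degeneration.regular (contract v') (exponent_sum charge)"

lemma rescaling_nonzero: "rescaling x \<noteq> 0"
  by (cases x) (simp add: rescaling_def Zero_fract_def eq_fract)

lemma degeneration_contract:
  "degeneration (contract v' :: ('i, 'k::field) wpoly fract \<Rightarrow> _) (exponent_sum charge) (exponent_prod rescaling)"
  by (intro degeneration.intro ring_map_contract degeneration_axioms.intro
      exponent_sum_add exponent_prod_zero exponent_prod_add rescaling_nonzero)

lemma int_w': "i \<in> verts Q \<Longrightarrow> w i + codim_out i + codim_in i = w' i + 2 * codim i"
proof -
  assume i: "i \<in> verts Q"
  have "int (w' i) = int (w i) - (2 * int (codim i) - int (codim_out i) - int (codim_in i))"
    using w'[OF i] cartan_sum[OF fin loopfree i, of "\<lambda>j. int (codim j)"]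
    by (simp add: codim_def codim_out_def codim_in_def)
  then show ?thesis by linarith
qed

lemma sum_charge:
  "(\<Sum>i\<in>verts Q. u i * (int (w i) + int (codim_in i) - int (codim_out i))) =
     (\<Sum>i\<in>verts Q. u i * int (w i)) + (\<Sum>a\<in>arcs Q. u (head Q a) * int (codim (tail Q a)))
       - (\<Sum>a\<in>arcs Q. u (tail Q a) * int (codim (head Q a)))"
  unfolding sum_arcs_group(1)[of u "\<lambda>a. int (codim (head Q a))"] sum_arcs_group(2)[of u "\<lambda>a. int (codim (tail Q a))"]
  by (simp add: codim_in_def codim_out_def distrib_left right_diff_distrib sum.distrib sum_subtractf)

text \<open>
  The form of the conicity condition, sorted by framing, vertices and arrows as in the orders of the
  monopole operators.
\<close>

lemma conicity_form_eq:
  "conicity_form u = (\<Sum>i\<in>verts Q. u i * int (w i)) - 2 * (\<Sum>i\<in>verts Q. u i * (int (codim i) - u i))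
     + (\<Sum>a\<in>arcs Q. u (tail Q a) * (int (codim (head Q a)) - u (head Q a)))
     + (\<Sum>a\<in>arcs Q. u (head Q a) * (int (codim (tail Q a)) - u (tail Q a)))"
  unfolding conicity_form_def right_diff_distrib sum_subtractf cartan_form[OF fin loopfree]
  by (simp add: mult.commute)

text \<open>
  A difference of two variables has order \<open>2\<close> if both are hidden; otherwise it survives truncation and
  has order \<open>0\<close>.
\<close>

lemma leading_difference:
  assumes "Idx i r \<noteq> Idx j s"
  shows "\<exists>c::('i, 'k::field) wpoly fract. c \<noteq> 0 \<and>
    leading (if r > v' i \<and> s > v' j then 2 else 0) (contract_poly v' (wvar i r - wvar j s)) c"
proof (cases "r > v' i \<and> s > v' j")
  case True
  have "to_fract (wvar i r - wvar j s :: ('i, 'k) wpoly) \<noteq> 0"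
    using assms by (simp add: wvar_eq_iff)
  moreover have "leading (if r > v' i \<and> s > v' j then 2 else 0) (contract_poly v' (wvar i r - wvar j s))
      (to_fract (wvar i r - wvar j s :: ('i, 'k) wpoly))"
    unfolding if_P[OF True] using True by (intro leading_contract_diff) auto
  ultimately show ?thesis by blast
next
  case False
  have "truncate_poly v' (wvar i r - wvar j s :: ('i, 'k) wpoly) \<noteq> 0"
    unfolding ring_map.map_diff[OF ring_map_truncate_poly] truncate_poly_wvar
    using False assms by (auto simp: wvar_eq_iff)
  then show ?thesis
    unfolding if_not_P[OF False] using leading_contract_poly by (metis to_fract_eq_0_iff)
qed

lemma card_hidden_complement:
  assumes "\<Gamma> \<in> subset_tuples Q v m" "i \<in> verts Q"
  shows "int (card {s \<in> {1..v i} - \<Gamma> i. s > v' i}) = int (codim i) - int (hidden_count \<Gamma> i)"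
    and "hidden_count \<Gamma> i \<le> codim i"
proof -
  have sub: "{r \<in> \<Gamma> i. r > v' i} \<subseteq> {v' i<..v i}" using subset_tuplesD(1)[OF assms] by auto
  have "{s \<in> {1..v i} - \<Gamma> i. s > v' i} = {v' i<..v i} - {r \<in> \<Gamma> i. r > v' i}" by auto
  moreover have "finite {r \<in> \<Gamma> i. r > v' i}" using subset_tuplesD(3)[OF assms] by simp
  moreover have "card {r \<in> \<Gamma> i. r > v' i} \<le> card {v' i<..v i}" using sub by (intro card_mono) auto
  ultimately show "int (card {s \<in> {1..v i} - \<Gamma> i. s > v' i}) = int (codim i) - int (hidden_count \<Gamma> i)"
    and "hidden_count \<Gamma> i \<le> codim i"
    using sub by (simp_all add: card_Diff_subset hidden_count_def codim_def of_nat_diff)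
qed

lemma exponent_sum_charge:
  assumes "\<Gamma> \<in> subset_tuples Q v m"
  shows "exponent_sum charge (uexp Q \<Gamma>) =
    (\<Sum>i\<in>verts Q. int (hidden_count \<Gamma> i) * (int (w i) + int (codim_in i) - int (codim_out i)))"
  unfolding exponent_sum_uexp
proof (intro sum.cong refl)
  fix i assume "i \<in> verts Q"
  then have "finite (\<Gamma> i)" by (rule subset_tuplesD(3)[OF assms])
  then show "(\<Sum>r\<in>\<Gamma> i. charge (Idx i r)) = int (hidden_count \<Gamma> i) * (int (w i) + int (codim_in i) - int (codim_out i))"
    by (simp add: charge_def hidden_count_def sum.If_cases Int_def)
qed

text \<open>
  These products occur as numerators and as denominators; for the latter it matters that the leading
  coefficient does not vanish.
\<close>

lemma leading_differences:
  assumes \<Gamma>: "\<Gamma> \<in> subset_tuples Q v m" and ij: "i \<in> verts Q" "j \<in> verts Q"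
  shows "\<exists>c::('i, 'k::field) wpoly fract. c \<noteq> 0 \<and>
    leading (2 * (int (hidden_count \<Gamma> i) * (int (codim j) - int (hidden_count \<Gamma> j))))
      (contract_poly v' (\<Prod>r\<in>\<Gamma> i. \<Prod>s\<in>{1..v j} - \<Gamma> j. wvar i r - wvar j s)) c"
    and "\<exists>c::('i, 'k::field) wpoly fract. c \<noteq> 0 \<and>
    leading (2 * (int (hidden_count \<Gamma> i) * (int (codim j) - int (hidden_count \<Gamma> j))))
      (contract_poly v' (\<Prod>r\<in>\<Gamma> i. \<Prod>s\<in>{1..v j} - \<Gamma> j. wvar j s - wvar i r)) c"
proof -
  interpret ring_map "contract_poly v' :: ('i, 'k) wpoly \<Rightarrow> _" by (rule ring_map_contract_poly)
  let ?S = "{1..v j} - \<Gamma> j"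
  let ?n = "\<lambda>r s. if r > v' i \<and> s > v' j then 2 else 0 :: int"
  have fin: "finite (\<Gamma> i)" "finite ?S" using subset_tuplesD(3)[OF \<Gamma> ij(1)] by auto
  have ne: "Idx i r \<noteq> Idx j s" if "r \<in> \<Gamma> i" "s \<in> ?S" for r s
    using that by auto
  have "\<forall>r s. \<exists>c::('i, 'k) wpoly fract. r \<in> \<Gamma> i \<and> s \<in> ?S \<longrightarrow>
      c \<noteq> 0 \<and> leading (?n r s) (contract_poly v' (wvar i r - wvar j s)) c"
    using leading_difference[OF ne] by blast
  then obtain c :: "nat \<Rightarrow> nat \<Rightarrow> ('i, 'k) wpoly fract"
    where c: "\<And>r s. r \<in> \<Gamma> i \<Longrightarrow> s \<in> ?S \<Longrightarrow> c r s \<noteq> 0"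
      "\<And>r s. r \<in> \<Gamma> i \<Longrightarrow> s \<in> ?S \<Longrightarrow> leading (?n r s) (contract_poly v' (wvar i r - wvar j s)) (c r s)"
    by metis
  have order: "(\<Sum>r\<in>\<Gamma> i. \<Sum>s\<in>?S. ?n r s) = 2 * (int (hidden_count \<Gamma> i) * (int (codim j) - int (hidden_count \<Gamma> j)))"
    unfolding sum_if_rectangle[OF fin, of "\<lambda>r. r > v' i" "\<lambda>s. s > v' j"]
      card_hidden_complement(1)[OF \<Gamma> ij(2)] hidden_count_def[of \<Gamma> i] ..
  have "leading (\<Sum>r\<in>\<Gamma> i. \<Sum>s\<in>?S. ?n r s) (\<Prod>r\<in>\<Gamma> i. \<Prod>s\<in>?S. contract_poly v' (wvar i r - wvar j s))
      (\<Prod>r\<in>\<Gamma> i. \<Prod>s\<in>?S. c r s)"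
    by (intro leading_prod c(2))
  moreover have "(\<Prod>r\<in>\<Gamma> i. \<Prod>s\<in>?S. c r s) \<noteq> 0" using c(1) fin by simp
  ultimately show "\<exists>c::('i, 'k) wpoly fract. c \<noteq> 0 \<and>
    leading (2 * (int (hidden_count \<Gamma> i) * (int (codim j) - int (hidden_count \<Gamma> j))))
      (contract_poly v' (\<Prod>r\<in>\<Gamma> i. \<Prod>s\<in>{1..v j} - \<Gamma> j. wvar i r - wvar j s)) c"
    unfolding map_prod order by blast
  have minus: "leading (?n r s) (contract_poly v' (wvar j s - wvar i r)) (- c r s)" if "r \<in> \<Gamma> i" "s \<in> ?S" for r s
    using leading_uminus[OF c(2)[OF that]] by (simp add: map_diff)
  have "leading (\<Sum>r\<in>\<Gamma> i. \<Sum>s\<in>?S. ?n r s) (\<Prod>r\<in>\<Gamma> i. \<Prod>s\<in>?S. contract_poly v' (wvar j s - wvar i r))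
      (\<Prod>r\<in>\<Gamma> i. \<Prod>s\<in>?S. - c r s)"
    by (intro leading_prod minus)
  moreover have "(\<Prod>r\<in>\<Gamma> i. \<Prod>s\<in>?S. - c r s) \<noteq> 0" using c(1) fin by simp
  ultimately show "\<exists>c::('i, 'k) wpoly fract. c \<noteq> 0 \<and>
    leading (2 * (int (hidden_count \<Gamma> i) * (int (codim j) - int (hidden_count \<Gamma> j))))
      (contract_poly v' (\<Prod>r\<in>\<Gamma> i. \<Prod>s\<in>{1..v j} - \<Gamma> j. wvar j s - wvar i r)) c"
    unfolding map_prod order by blast
qed

lemma leading_contract_prod:
  assumes "\<And>a. a \<in> A \<Longrightarrow> \<exists>c. c \<noteq> 0 \<and> leading (n a) (contract_poly v' (p a)) c" "finite A"
  shows "\<exists>c. c \<noteq> 0 \<and> leading (\<Sum>a\<in>A. n a) (contract_poly v' (\<Prod>a\<in>A. p a)) c"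
proof -
  obtain c where "\<And>a. a \<in> A \<Longrightarrow> c a \<noteq> 0 \<and> leading (n a) (contract_poly v' (p a)) (c a)"
    using assms(1) by metis
  then have "leading (\<Sum>a\<in>A. n a) (contract_poly v' (\<Prod>a\<in>A. p a)) (\<Prod>a\<in>A. c a)"
    and "(\<Prod>a\<in>A. c a) \<noteq> 0"
    using leading_prod[of A n "\<lambda>a. contract_poly v' (p a)" c] assms(2)
    by (simp_all add: ring_map.map_prod[OF ring_map_contract_poly])
  then show ?thesis by blast
qed

definition plus_arrows :: "('i \<Rightarrow> nat) \<Rightarrow> ('i \<Rightarrow> nat set) \<Rightarrow> ('i, 'k::field) wpoly" where
  "plus_arrows x \<Gamma> = (\<Prod>a\<in>arcs Q. \<Prod>r\<in>\<Gamma> (tail Q a). \<Prod>s\<in>{1..x (head Q a)} - \<Gamma> (head Q a).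
     wvar (head Q a) s - wvar (tail Q a) r)"

definition minus_arrows :: "('i \<Rightarrow> nat) \<Rightarrow> ('i \<Rightarrow> nat set) \<Rightarrow> ('i, 'k::field) wpoly" where
  "minus_arrows x \<Gamma> = (\<Prod>a\<in>arcs Q. \<Prod>r\<in>\<Gamma> (head Q a). \<Prod>s\<in>{1..x (tail Q a)} - \<Gamma> (tail Q a).
     wvar (head Q a) r - wvar (tail Q a) s)"

definition plus_den :: "('i \<Rightarrow> nat) \<Rightarrow> ('i \<Rightarrow> nat set) \<Rightarrow> ('i, 'k::field) wpoly" where
  "plus_den x \<Gamma> = (\<Prod>i\<in>verts Q. \<Prod>r\<in>\<Gamma> i. \<Prod>s\<in>{1..x i} - \<Gamma> i. wvar i r - wvar i s)"

definition minus_den :: "('i \<Rightarrow> nat) \<Rightarrow> ('i \<Rightarrow> nat set) \<Rightarrow> ('i, 'k::field) wpoly" where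
  "minus_den x \<Gamma> = (\<Prod>i\<in>verts Q. \<Prod>r\<in>\<Gamma> i. \<Prod>s\<in>{1..x i} - \<Gamma> i. wvar i s - wvar i r)"

definition framing :: "('i \<Rightarrow> nat) \<Rightarrow> ('i \<Rightarrow> nat set) \<Rightarrow> ('i, 'k::field) wpoly" where
  "framing y \<Gamma> = (\<Prod>j\<in>verts Q. \<Prod>t\<in>\<Gamma> j. wvar j t ^ y j)"

text \<open>
  The value of the conicity form on the numbers of hidden elements, a lower bound for the order in \<open>t\<close>
  of the summands of \<open>\<Gamma>\<close> in both kinds of monopole operators.
\<close>

definition excess :: "('i \<Rightarrow> nat set) \<Rightarrow> int" where
  "excess \<Gamma> = conicity_form (\<lambda>i. int (hidden_count \<Gamma> i))"

lemma den_order: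
  assumes \<Gamma>: "\<Gamma> \<in> subset_tuples Q v m"
  shows "\<exists>c::('i, 'k::field) wpoly fract. c \<noteq> 0 \<and>
      leading (\<Sum>i\<in>verts Q. 2 * (int (hidden_count \<Gamma> i) * (int (codim i) - int (hidden_count \<Gamma> i))))
        (contract_poly v' (plus_den v \<Gamma>)) c"
    and "\<exists>c::('i, 'k::field) wpoly fract. c \<noteq> 0 \<and>
      leading (\<Sum>i\<in>verts Q. 2 * (int (hidden_count \<Gamma> i) * (int (codim i) - int (hidden_count \<Gamma> i))))
        (contract_poly v' (minus_den v \<Gamma>)) c"
  unfolding plus_den_def minus_den_def
  by (intro leading_contract_prod leading_differences[OF \<Gamma>]; simp)+

lemma arrows_order:
  assumes \<Gamma>: "\<Gamma> \<in> subset_tuples Q v m"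
  shows "\<exists>c::('i, 'k::field) wpoly fract. c \<noteq> 0 \<and>
      leading (\<Sum>a\<in>arcs Q. 2 * (int (hidden_count \<Gamma> (tail Q a)) * (int (codim (head Q a)) - int (hidden_count \<Gamma> (head Q a)))))
        (contract_poly v' (plus_arrows v \<Gamma>)) c"
    and "\<exists>c::('i, 'k::field) wpoly fract. c \<noteq> 0 \<and>
      leading (\<Sum>a\<in>arcs Q. 2 * (int (hidden_count \<Gamma> (head Q a)) * (int (codim (tail Q a)) - int (hidden_count \<Gamma> (tail Q a)))))
        (contract_poly v' (minus_arrows v \<Gamma>)) c"
  unfolding plus_arrows_def minus_arrows_def
  by (intro leading_contract_prod leading_differences[OF \<Gamma>]; simp)+

lemma framing_order:
  assumes \<Gamma>: "\<Gamma> \<in> subset_tuples Q v m"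
  shows "\<exists>c::('i, 'k::field) wpoly fract. c \<noteq> 0 \<and>
      leading (\<Sum>i\<in>verts Q. 2 * (int (hidden_count \<Gamma> i) * int (w i))) (contract_poly v' (framing w \<Gamma>)) c"
proof -
  interpret ring_map "contract_poly v' :: ('i, 'k) wpoly \<Rightarrow> _" by (rule ring_map_contract_poly)
  have wvar: "leading (if r > v' i then 2 else 0) (contract_poly v' (wvar i r :: ('i, 'k) wpoly)) (to_fract (wvar i r))" for i r
    by (cases "r > v' i") (simp_all add: leading_contract_wvar)
  have power: "leading (int (w i) * (if r > v' i then 2 else 0)) (contract_poly v' ((wvar i r :: ('i, 'k) wpoly) ^ w i))
      (to_fract (wvar i r) ^ w i)" for i r
    unfolding map_power by (rule leading_power) (rule wvar)
  have "(\<Sum>r\<in>\<Gamma> i. int (w i) * (if r > v' i then 2 else 0)) = 2 * (int (hidden_count \<Gamma> i) * int (w i))" if "i \<in> verts Q" for i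
    using subset_tuplesD(3)[OF \<Gamma> that] by (simp add: hidden_count_def sum.If_cases Int_def flip: sum_distrib_left)
  then have order: "(\<Sum>i\<in>verts Q. 2 * (int (hidden_count \<Gamma> i) * int (w i))) =
      (\<Sum>i\<in>verts Q. \<Sum>r\<in>\<Gamma> i. int (w i) * (if r > v' i then 2 else 0))"
    by simp
  show ?thesis
    unfolding framing_def order
  proof (rule leading_contract_prod)
    fix i assume "i \<in> verts Q"
    then have "finite (\<Gamma> i)" by (rule subset_tuplesD(3)[OF \<Gamma>])
    then show "\<exists>c::('i, 'k) wpoly fract. c \<noteq> 0 \<and> leading (\<Sum>r\<in>\<Gamma> i. int (w i) * (if r > v' i then 2 else 0))
        (contract_poly v' (\<Prod>t\<in>\<Gamma> i. wvar i t ^ w i)) c"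
    proof (rule leading_contract_prod[rotated])
      fix r
      have "to_fract (wvar i r :: ('i, 'k) wpoly) ^ w i \<noteq> 0" by simp
      then show "\<exists>c::('i, 'k) wpoly fract. c \<noteq> 0 \<and> leading (int (w i) * (if r > v' i then 2 else 0))
          (contract_poly v' (wvar i r ^ w i)) c"
        using power by blast
    qed
  qed simp
qed

text \<open>
  The remaining part of \<open>excess \<Gamma>\<close> is the charge of the monomial \<open>u\<^bsub>\<Gamma>\<^esub>\<close> by which the coefficient is
  multiplied.
\<close>

lemma plus_order:
  fixes p :: "('i, 'k::field) wpoly"
  assumes \<Gamma>: "\<Gamma> \<in> subset_tuples Q v m"
  shows "\<exists>c. leading (excess \<Gamma> - exponent_sum charge (uexp Q \<Gamma>))
    (contract v' (Fraction_Field.Fract (p * plus_arrows v \<Gamma>) (plus_den v \<Gamma>))) c"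
proof -
  interpret ring_map "contract_poly v' :: ('i, 'k) wpoly \<Rightarrow> _" by (rule ring_map_contract_poly)
  obtain c where c: "c \<noteq> 0" "leading (\<Sum>i\<in>verts Q. 2 * (int (hidden_count \<Gamma> i) * (int (codim i) - int (hidden_count \<Gamma> i))))
        (contract_poly v' (plus_den v \<Gamma> :: ('i, 'k) wpoly)) c"
    using den_order(1)[OF \<Gamma>] by blast
  obtain d where d: "leading (\<Sum>a\<in>arcs Q. 2 * (int (hidden_count \<Gamma> (tail Q a)) * (int (codim (head Q a)) - int (hidden_count \<Gamma> (head Q a)))))
        (contract_poly v' (plus_arrows v \<Gamma> :: ('i, 'k) wpoly)) d"
    using arrows_order(1)[OF \<Gamma>] by blast
  have order: "0 + (\<Sum>a\<in>arcs Q. 2 * (int (hidden_count \<Gamma> (tail Q a)) * (int (codim (head Q a)) - int (hidden_count \<Gamma> (head Q a)))))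
      - (\<Sum>i\<in>verts Q. 2 * (int (hidden_count \<Gamma> i) * (int (codim i) - int (hidden_count \<Gamma> i))))
     = excess \<Gamma> - exponent_sum charge (uexp Q \<Gamma>)"
    unfolding excess_def conicity_form_eq exponent_sum_charge[OF \<Gamma>] sum_charge
    by (simp add: sum_distrib_left[symmetric] right_diff_distrib sum_subtractf mult.commute)
  show ?thesis
    using leading_divide[OF leading_mult[OF leading_contract_poly[of v' p] d] c(2,1)]
    unfolding order contract_Fract map_mult by blast
qed

lemma minus_order:
  fixes p :: "('i, 'k::field) wpoly"
  assumes \<Gamma>: "\<Gamma> \<in> subset_tuples Q v m"
  shows "\<exists>c. leading (excess \<Gamma> + exponent_sum charge (uexp Q \<Gamma>))
    (contract v' (Fraction_Field.Fract (p * framing w \<Gamma> * minus_arrows v \<Gamma>) (minus_den v \<Gamma>))) c"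
proof -
  interpret ring_map "contract_poly v' :: ('i, 'k) wpoly \<Rightarrow> _" by (rule ring_map_contract_poly)
  obtain c where c: "c \<noteq> 0" "leading (\<Sum>i\<in>verts Q. 2 * (int (hidden_count \<Gamma> i) * (int (codim i) - int (hidden_count \<Gamma> i))))
        (contract_poly v' (minus_den v \<Gamma> :: ('i, 'k) wpoly)) c"
    using den_order(2)[OF \<Gamma>] by blast
  obtain d where d: "leading (\<Sum>a\<in>arcs Q. 2 * (int (hidden_count \<Gamma> (head Q a)) * (int (codim (tail Q a)) - int (hidden_count \<Gamma> (tail Q a)))))
        (contract_poly v' (minus_arrows v \<Gamma> :: ('i, 'k) wpoly)) d"
    using arrows_order(2)[OF \<Gamma>] by blast
  obtain b where b: "leading (\<Sum>i\<in>verts Q. 2 * (int (hidden_count \<Gamma> i) * int (w i))) (contract_poly v' (framing w \<Gamma> :: ('i, 'k) wpoly)) b"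
    using framing_order[OF \<Gamma>] by blast
  have order: "0 + (\<Sum>i\<in>verts Q. 2 * (int (hidden_count \<Gamma> i) * int (w i)))
      + (\<Sum>a\<in>arcs Q. 2 * (int (hidden_count \<Gamma> (head Q a)) * (int (codim (tail Q a)) - int (hidden_count \<Gamma> (tail Q a)))))
      - (\<Sum>i\<in>verts Q. 2 * (int (hidden_count \<Gamma> i) * (int (codim i) - int (hidden_count \<Gamma> i))))
     = excess \<Gamma> + exponent_sum charge (uexp Q \<Gamma>)"
    unfolding excess_def conicity_form_eq exponent_sum_charge[OF \<Gamma>] sum_charge
    by (simp add: sum_distrib_left[symmetric] right_diff_distrib sum_subtractf mult.commute)
  show ?thesis
    using leading_divide[OF leading_mult[OF leading_mult[OF leading_contract_poly[of v' p] b] d] c(2,1)]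
    unfolding order contract_Fract map_mult by blast
qed

lemma excess_visible:
  assumes "\<Gamma> \<in> subset_tuples Q v' m"
  shows "excess \<Gamma> = 0" "exponent_sum charge (uexp Q \<Gamma>) = 0"
proof -
  have "{r \<in> \<Gamma> i. r > v' i} = {}" if "i \<in> verts Q" for i
    using subset_tuplesD(1)[OF assms that] by auto
  then have "hidden_count \<Gamma> i = 0" if "i \<in> verts Q" for i
    using that by (simp only: hidden_count_def card.empty)
  moreover have "\<Gamma> \<in> subset_tuples Q v m" using assms subset_tuples_restrict le by blast
  ultimately show "excess \<Gamma> = 0" "exponent_sum charge (uexp Q \<Gamma>) = 0"
    by (simp_all add: excess_def conicity_form_def exponent_sum_charge)
qed

lemma excess_hidden:
  assumes \<Gamma>: "\<Gamma> \<in> subset_tuples Q v m" and "\<Gamma> \<notin> subset_tuples Q v' m"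
  shows "excess \<Gamma> \<ge> 1"
proof -
  have "\<exists>i\<in>verts Q. hidden_count \<Gamma> i \<noteq> 0"
  proof (rule ccontr)
    assume "\<not> (\<exists>i\<in>verts Q. hidden_count \<Gamma> i \<noteq> 0)"
    then have none: "\<forall>i\<in>verts Q. hidden_count \<Gamma> i = 0" by blast
    have "\<Gamma> i \<subseteq> {1..v' i}" if i: "i \<in> verts Q" for i
    proof -
      have "{r \<in> \<Gamma> i. r > v' i} = {}"
        using bspec[OF none i] subset_tuplesD(3)[OF \<Gamma> i]
        unfolding hidden_count_def by (subst (asm) card_0_eq) auto
      then show ?thesis using subset_tuplesD(1)[OF \<Gamma> i] by force
    qed
    then have "\<Gamma> \<in> subset_tuples Q v' m"
      using \<Gamma> unfolding subset_tuples_def PiE_iff by simp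
    then show False using assms(2) by blast
  qed
  then show ?thesis
    unfolding excess_def conicity_form_def codim_def
    using card_hidden_complement(2)[OF \<Gamma>] by (intro conic) (auto simp: codim_def)
qed

lemma excess_nonneg: "\<Gamma> \<in> subset_tuples Q v m \<Longrightarrow> excess \<Gamma> \<ge> 0"
  using excess_visible(1) excess_hidden by (metis order_refl order_trans zero_le_one)

lemma leading_le:
  assumes "leading n x c" "m \<le> n"
  shows "\<exists>d. leading m x d"
  using assms leading_weaken by (metis order_le_less)

section \<open>Truncating the surviving summands\<close>

text \<open>
  Every hidden \<open>s\<close> contributes to the truncation a factor \<open>w\<^bsub>i,r\<^esub>\<close>, respectively \<open>- w\<^bsub>i,r\<^esub>\<close>, and there are
  \<open>codim j\<close> of them.
\<close>

lemma truncate_differences: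
  assumes \<Gamma>: "\<Gamma> \<in> subset_tuples Q v' m" and ij: "i \<in> verts Q" "j \<in> verts Q"
  shows "truncate_poly v' (\<Prod>r\<in>\<Gamma> i. \<Prod>s\<in>{1..v j} - \<Gamma> j. wvar i r - wvar j s) =
      (\<Prod>r\<in>\<Gamma> i. \<Prod>s\<in>{1..v' j} - \<Gamma> j. wvar i r - wvar j s) * (\<Prod>r\<in>\<Gamma> i. (wvar i r :: ('i, 'k::field) wpoly) ^ codim j)"
    and "truncate_poly v' (\<Prod>r\<in>\<Gamma> i. \<Prod>s\<in>{1..v j} - \<Gamma> j. wvar j s - wvar i r) =
      (\<Prod>r\<in>\<Gamma> i. \<Prod>s\<in>{1..v' j} - \<Gamma> j. wvar j s - wvar i r) * (\<Prod>r\<in>\<Gamma> i. (- wvar i r :: ('i, 'k::field) wpoly) ^ codim j)"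
proof -
  interpret ring_map "truncate_poly v' :: ('i, 'k) wpoly \<Rightarrow> _" by (rule ring_map_truncate_poly)
  let ?t = "\<lambda>j s. truncate_poly v' (wvar j s) :: ('i, 'k) wpoly"
  have split: "{1..v j} - \<Gamma> j = ({1..v' j} - \<Gamma> j) \<union> {v' j<..v j}"
    using subset_tuplesD(1)[OF \<Gamma> ij(2)] le[OF ij(2)] by auto
  have disjoint: "({1..v' j} - \<Gamma> j) \<inter> {v' j<..v j} = {}" by auto
  have prod_split: "(\<Prod>s\<in>{1..v j} - \<Gamma> j. F s) = (\<Prod>s\<in>{1..v' j} - \<Gamma> j. F s) * (\<Prod>s\<in>{v' j<..v j}. F s)"
    for F :: "nat \<Rightarrow> ('i, 'k) wpoly"
    unfolding split by (rule prod.union_disjoint) (use disjoint in auto)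
  have visible: "?t i r = wvar i r" if "r \<in> \<Gamma> i" for r
    using subset_tuplesD(1)[OF \<Gamma> ij(1)] that by (auto simp: truncate_poly_wvar)
  have "(\<Prod>s\<in>{1..v j} - \<Gamma> j. ?t i r - ?t j s) =
      (\<Prod>s\<in>{1..v' j} - \<Gamma> j. wvar i r - wvar j s) * wvar i r ^ codim j" if "r \<in> \<Gamma> i" for r
    unfolding prod_split visible[OF that] by (simp add: truncate_poly_wvar codim_def)
  then show "truncate_poly v' (\<Prod>r\<in>\<Gamma> i. \<Prod>s\<in>{1..v j} - \<Gamma> j. wvar i r - wvar j s) =
      (\<Prod>r\<in>\<Gamma> i. \<Prod>s\<in>{1..v' j} - \<Gamma> j. wvar i r - wvar j s) * (\<Prod>r\<in>\<Gamma> i. (wvar i r :: ('i, 'k) wpoly) ^ codim j)"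
    unfolding map_prod map_diff prod.distrib[symmetric] by (intro prod.cong) simp_all
  have "(\<Prod>s\<in>{1..v j} - \<Gamma> j. ?t j s - ?t i r) =
      (\<Prod>s\<in>{1..v' j} - \<Gamma> j. wvar j s - wvar i r) * (- wvar i r) ^ codim j" if "r \<in> \<Gamma> i" for r
    unfolding prod_split visible[OF that] by (simp add: truncate_poly_wvar codim_def)
  then show "truncate_poly v' (\<Prod>r\<in>\<Gamma> i. \<Prod>s\<in>{1..v j} - \<Gamma> j. wvar j s - wvar i r) =
      (\<Prod>r\<in>\<Gamma> i. \<Prod>s\<in>{1..v' j} - \<Gamma> j. wvar j s - wvar i r) * (\<Prod>r\<in>\<Gamma> i. (- wvar i r :: ('i, 'k) wpoly) ^ codim j)"
    unfolding map_prod map_diff prod.distrib[symmetric] by (intro prod.cong) simp_all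
qed

lemma prod_arcs_group:
  fixes F :: "'i \<Rightarrow> nat \<Rightarrow> 'a::comm_ring_1"
  shows "(\<Prod>a\<in>arcs Q. \<Prod>r\<in>\<Gamma> (tail Q a). F (tail Q a) r ^ codim (head Q a)) =
      (\<Prod>i\<in>verts Q. \<Prod>r\<in>\<Gamma> i. F i r ^ codim_out i)"
    and "(\<Prod>a\<in>arcs Q. \<Prod>r\<in>\<Gamma> (head Q a). F (head Q a) r ^ codim (tail Q a)) =
      (\<Prod>i\<in>verts Q. \<Prod>r\<in>\<Gamma> i. F i r ^ codim_in i)"
proof -
  have group: "(\<Prod>a\<in>arcs Q. \<Prod>r\<in>\<Gamma> (p a). F (p a) r ^ n a) =
      (\<Prod>i\<in>verts Q. \<Prod>r\<in>\<Gamma> i. F i r ^ (\<Sum>a\<in>{a \<in> arcs Q. p a = i}. n a))"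
    if p: "\<And>a. a \<in> arcs Q \<Longrightarrow> p a \<in> verts Q" for p n
  proof -
    have "(\<Prod>a\<in>arcs Q. \<Prod>r\<in>\<Gamma> (p a). F (p a) r ^ n a) =
      (\<Prod>i\<in>verts Q. \<Prod>a\<in>{a \<in> arcs Q. p a = i}. \<Prod>r\<in>\<Gamma> (p a). F (p a) r ^ n a)"
      using p by (intro prod.group[symmetric]) auto
    also have "\<dots> = (\<Prod>i\<in>verts Q. \<Prod>a\<in>{a \<in> arcs Q. p a = i}. \<Prod>r\<in>\<Gamma> i. F i r ^ n a)"
      by (intro prod.cong) auto
    also have "\<dots> = (\<Prod>i\<in>verts Q. \<Prod>r\<in>\<Gamma> i. F i r ^ (\<Sum>a\<in>{a \<in> arcs Q. p a = i}. n a))"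
      unfolding power_sum by (intro prod.cong refl prod.swap)
    finally show ?thesis .
  qed
  show "(\<Prod>a\<in>arcs Q. \<Prod>r\<in>\<Gamma> (tail Q a). F (tail Q a) r ^ codim (head Q a)) =
      (\<Prod>i\<in>verts Q. \<Prod>r\<in>\<Gamma> i. F i r ^ codim_out i)"
    unfolding codim_out_def by (rule group) simp
  show "(\<Prod>a\<in>arcs Q. \<Prod>r\<in>\<Gamma> (head Q a). F (head Q a) r ^ codim (tail Q a)) =
      (\<Prod>i\<in>verts Q. \<Prod>r\<in>\<Gamma> i. F i r ^ codim_in i)"
    unfolding codim_in_def by (rule group) simp
qed

definition var_prod :: "('i \<Rightarrow> nat) \<Rightarrow> ('i \<Rightarrow> nat set) \<Rightarrow> ('i, 'k::field) wpoly" where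
  "var_prod k \<Gamma> = (\<Prod>i\<in>verts Q. \<Prod>r\<in>\<Gamma> i. wvar i r ^ k i)"

definition neg_var_prod :: "('i \<Rightarrow> nat) \<Rightarrow> ('i \<Rightarrow> nat set) \<Rightarrow> ('i, 'k::field) wpoly" where
  "neg_var_prod k \<Gamma> = (\<Prod>i\<in>verts Q. \<Prod>r\<in>\<Gamma> i. (- wvar i r) ^ k i)"

lemma truncate_prod_distrib:
  assumes "\<And>a. a \<in> A \<Longrightarrow> truncate_poly v' (p a) = q a * r a"
  shows "truncate_poly v' (\<Prod>a\<in>A. p a) = (\<Prod>a\<in>A. q a) * (\<Prod>a\<in>A. r a)"
  using assms by (simp add: ring_map.map_prod[OF ring_map_truncate_poly] prod.distrib)

lemma truncate_arrows_den:
  assumes \<Gamma>: "\<Gamma> \<in> subset_tuples Q v' m"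
  shows "truncate_poly v' (plus_arrows v \<Gamma> :: ('i, 'k::field) wpoly) = plus_arrows v' \<Gamma> * neg_var_prod codim_out \<Gamma>"
    and "truncate_poly v' (minus_arrows v \<Gamma> :: ('i, 'k::field) wpoly) = minus_arrows v' \<Gamma> * var_prod codim_in \<Gamma>"
    and "truncate_poly v' (plus_den v \<Gamma> :: ('i, 'k::field) wpoly) = plus_den v' \<Gamma> * var_prod codim \<Gamma>"
    and "truncate_poly v' (minus_den v \<Gamma> :: ('i, 'k::field) wpoly) = minus_den v' \<Gamma> * neg_var_prod codim \<Gamma>"
    and "truncate_poly v' (framing w \<Gamma> :: ('i, 'k::field) wpoly) = framing w \<Gamma>"
proof -
  interpret ring_map "truncate_poly v' :: ('i, 'k) wpoly \<Rightarrow> _" by (rule ring_map_truncate_poly)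
  note differences = truncate_differences[OF \<Gamma>]
  show "truncate_poly v' (plus_arrows v \<Gamma> :: ('i, 'k::field) wpoly) = plus_arrows v' \<Gamma> * neg_var_prod codim_out \<Gamma>"
    unfolding plus_arrows_def neg_var_prod_def
      prod_arcs_group(1)[of "\<lambda>i r. - wvar i r :: ('i, 'k) wpoly", symmetric]
    by (rule truncate_prod_distrib, rule differences(2)) simp_all
  show "truncate_poly v' (minus_arrows v \<Gamma> :: ('i, 'k::field) wpoly) = minus_arrows v' \<Gamma> * var_prod codim_in \<Gamma>"
    unfolding minus_arrows_def var_prod_def
      prod_arcs_group(2)[of "\<lambda>i r. wvar i r :: ('i, 'k) wpoly", symmetric]
    by (rule truncate_prod_distrib, rule differences(1)) simp_all
  show "truncate_poly v' (plus_den v \<Gamma> :: ('i, 'k::field) wpoly) = plus_den v' \<Gamma> * var_prod codim \<Gamma>"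
    unfolding plus_den_def var_prod_def
    by (rule truncate_prod_distrib, rule differences(1)) simp_all
  show "truncate_poly v' (minus_den v \<Gamma> :: ('i, 'k::field) wpoly) = minus_den v' \<Gamma> * neg_var_prod codim \<Gamma>"
    unfolding minus_den_def neg_var_prod_def
    by (rule truncate_prod_distrib, rule differences(2)) simp_all
  have "truncate_poly v' (wvar j t) = (wvar j t :: ('i, 'k) wpoly)" if "j \<in> verts Q" "t \<in> \<Gamma> j" for j t
    using subset_tuplesD(1)[OF \<Gamma> that(1)] that(2) by (auto simp: truncate_poly_wvar)
  then show "truncate_poly v' (framing w \<Gamma> :: ('i, 'k::field) wpoly) = framing w \<Gamma>"
    unfolding framing_def map_prod map_power by (intro prod.cong refl) simp
qed

lemma nonzero_products:
  assumes \<Gamma>: "\<Gamma> \<in> subset_tuples Q x m"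
  shows "plus_den x \<Gamma> \<noteq> (0 :: ('i, 'k::field) wpoly)" "minus_den x \<Gamma> \<noteq> (0 :: ('i, 'k) wpoly)"
    "var_prod k \<Gamma> \<noteq> (0 :: ('i, 'k) wpoly)" "neg_var_prod k \<Gamma> \<noteq> (0 :: ('i, 'k) wpoly)"
  using subset_tuplesD(3)[OF \<Gamma>]
  by (auto simp: plus_den_def minus_den_def var_prod_def neg_var_prod_def wvar_eq_iff)

lemma exponent_prod_rescaling:
  "exponent_prod rescaling (uexp Q \<Gamma>) =
    (Fraction_Field.Fract (var_prod codim \<Gamma>) (neg_var_prod codim_out \<Gamma>) :: ('i, 'k::field) wpoly fract)"
proof -
  have "Fraction_Field.Fract (var_prod codim \<Gamma>) (neg_var_prod codim_out \<Gamma>) =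
      (to_fract (var_prod codim \<Gamma>) / to_fract (neg_var_prod codim_out \<Gamma>) :: ('i, 'k) wpoly fract)"
    by (rule Fract_eq_divide)
  also have "\<dots> = (\<Prod>i\<in>verts Q. \<Prod>r\<in>\<Gamma> i. rescaling (Idx i r))"
    unfolding var_prod_def neg_var_prod_def rescaling_def idx.case ring_map.map_prod[OF ring_map_to_fract]
      prod_dividef ..
  finally show ?thesis by (simp only: exponent_prod_uexp[OF rescaling_nonzero])
qed

text \<open>
  At each vertex the exponents of \<open>w\<^bsub>i,r\<^esub>\<close> on the two sides agree because \<open>w' = w - C v''\<close>
  (\<open>int_w'\<close>).  The sign is the quotient of the sign prefactors of \<open>M\<^sup>-\<close> for \<open>v\<close> and for \<open>v'\<close>.
\<close>

lemma framing_shift: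
  assumes \<Gamma>: "\<Gamma> \<in> subset_tuples Q v' m"
  shows "(neg_var_prod codim_out \<Gamma> * framing w \<Gamma> * var_prod codim_in \<Gamma> :: ('i, 'k::field) wpoly) =
    (- 1) ^ ((\<Sum>i\<in>verts Q. m i * codim i) + (\<Sum>a\<in>arcs Q. m (tail Q a) * codim (head Q a))) *
      (framing w' \<Gamma> * var_prod codim \<Gamma> * neg_var_prod codim \<Gamma>)"
proof -
  have sign: "(\<Prod>i\<in>verts Q. \<Prod>r\<in>\<Gamma> i. (- 1 :: ('i, 'k) wpoly) ^ (codim i + codim_out i)) =
     (- 1) ^ ((\<Sum>i\<in>verts Q. m i * codim i) + (\<Sum>a\<in>arcs Q. m (tail Q a) * codim (head Q a)))"
  proof -
    have "int (\<Sum>a\<in>arcs Q. m (tail Q a) * codim (head Q a)) = int (\<Sum>i\<in>verts Q. m i * codim_out i)"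
      using sum_arcs_group(1)[of "\<lambda>i. int (m i)" "\<lambda>a. int (codim (head Q a))"] by (simp add: codim_out_def)
    then have arcs: "(\<Sum>a\<in>arcs Q. m (tail Q a) * codim (head Q a)) = (\<Sum>i\<in>verts Q. m i * codim_out i)"
      by (simp only: of_nat_eq_iff)
    have "(\<Prod>i\<in>verts Q. \<Prod>r\<in>\<Gamma> i. (- 1 :: ('i, 'k) wpoly) ^ (codim i + codim_out i)) =
      (\<Prod>i\<in>verts Q. (- 1) ^ (m i * codim i + m i * codim_out i))"
      by (intro prod.cong refl) (simp add: subset_tuplesD(2)[OF \<Gamma>] power_mult[symmetric] distrib_left mult.commute)
    then show ?thesis unfolding arcs by (simp add: power_sum[symmetric] sum.distrib)
  qed
  have "(- wvar i r :: ('i, 'k) wpoly) ^ codim_out i * wvar i r ^ w i * wvar i r ^ codim_in i =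
     (- 1) ^ (codim i + codim_out i) * (wvar i r ^ w' i * wvar i r ^ codim i * (- wvar i r) ^ codim i)"
    if "i \<in> verts Q" for i r
  proof -
    let ?x = "wvar i r :: ('i, 'k) wpoly"
    have neg: "(- ?x) ^ k = (- 1) ^ k * ?x ^ k" for k
      by (rule power_minus)
    have exps: "?x ^ codim_out i * ?x ^ w i * ?x ^ codim_in i = ?x ^ w' i * ?x ^ codim i * ?x ^ codim i"
      unfolding power_add[symmetric] using int_w'[OF that] by (simp add: add_ac mult_2)
    have signs: "((- 1) ^ (codim i + codim_out i) * (- 1) ^ codim i :: ('i, 'k) wpoly) = (- 1) ^ codim_out i"
      by (simp add: power_add minus_one_power_iff)
    have "(- ?x) ^ codim_out i * ?x ^ w i * ?x ^ codim_in i =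
        (- 1) ^ codim_out i * (?x ^ codim_out i * ?x ^ w i * ?x ^ codim_in i)"
      unfolding neg by (simp only: mult.assoc)
    also have "\<dots> = (- 1) ^ (codim i + codim_out i) * (- 1) ^ codim i * (?x ^ w' i * ?x ^ codim i * ?x ^ codim i)"
      unfolding exps signs ..
    also have "\<dots> = (- 1) ^ (codim i + codim_out i) * (?x ^ w' i * ?x ^ codim i * (- ?x) ^ codim i)"
      unfolding neg by (simp only: mult_ac)
    finally show ?thesis .
  qed
  then show ?thesis
    unfolding sign[symmetric] neg_var_prod_def framing_def var_prod_def prod.distrib[symmetric]
    by (intro prod.cong refl)
qed

lemma slice_limit_plus_term:
  fixes p :: "('i, 'k::field) wpoly"
  assumes \<Gamma>: "\<Gamma> \<in> subset_tuples Q v m"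
  defines "x \<equiv> Poly_Mapping.single (uexp Q \<Gamma>) (Fraction_Field.Fract (p * plus_arrows v \<Gamma>) (plus_den v \<Gamma>))"
  shows "has_slice_limit x"
    and "\<Gamma> \<notin> subset_tuples Q v' m \<Longrightarrow> slice_limit x = 0"
    and "\<Gamma> \<in> subset_tuples Q v' m \<Longrightarrow> slice_limit x =
      Poly_Mapping.single (uexp Q \<Gamma>) (Fraction_Field.Fract (truncate_poly v' p * plus_arrows v' \<Gamma>) (plus_den v' \<Gamma>))"
proof -
  interpret degeneration "contract v' :: ('i, 'k) wpoly fract \<Rightarrow> _" "exponent_sum charge" "exponent_prod rescaling"
    by (rule degeneration_contract)
  interpret t: ring_map "truncate_poly v' :: ('i, 'k) wpoly \<Rightarrow> _" by (rule ring_map_truncate_poly)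
  let ?c = "Fraction_Field.Fract (p * plus_arrows v \<Gamma>) (plus_den v \<Gamma>)"
  obtain c where c: "leading (excess \<Gamma> - exponent_sum charge (uexp Q \<Gamma>)) (contract v' ?c) c"
    using plus_order[OF \<Gamma>] by blast
  show "has_slice_limit x"
    unfolding x_def using leading_le[OF c, of "- exponent_sum charge (uexp Q \<Gamma>)"] excess_nonneg[OF \<Gamma>] regular_single
    by fastforce
  show "slice_limit x = 0" if "\<Gamma> \<notin> subset_tuples Q v' m"
  proof -
    have "leading (- exponent_sum charge (uexp Q \<Gamma>)) (contract v' ?c) 0"
      using leading_weaken[OF c] excess_hidden[OF \<Gamma> that] by simp
    then show ?thesis unfolding x_def by (simp add: limit_single)
  qed
  show "slice_limit x = Poly_Mapping.single (uexp Q \<Gamma>) (Fraction_Field.Fract (truncate_poly v' p * plus_arrows v' \<Gamma>) (plus_den v' \<Gamma>))"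
    if \<Gamma>': "\<Gamma> \<in> subset_tuples Q v' m"
  proof -
    note [simp] = nonzero_products[OF \<Gamma>']
    have "truncate_poly v' (plus_den v \<Gamma>) \<noteq> (0 :: ('i, 'k) wpoly)"
      unfolding truncate_arrows_den[OF \<Gamma>'] by simp
    then have "leading (0 - 0) (contract v' ?c)
        (to_fract (truncate_poly v' (p * plus_arrows v \<Gamma>)) / to_fract (truncate_poly v' (plus_den v \<Gamma>)))"
      unfolding contract_Fract by (intro leading_divide leading_contract_poly) simp
    then have "leading (- exponent_sum charge (uexp Q \<Gamma>)) (contract v' ?c)
        (Fraction_Field.Fract (truncate_poly v' p * plus_arrows v' \<Gamma> * neg_var_prod codim_out \<Gamma>) (plus_den v' \<Gamma> * var_prod codim \<Gamma>))"
      by (simp add: excess_visible[OF \<Gamma>'] truncate_arrows_den[OF \<Gamma>'] t.map_mult mult.assoc)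
    moreover have "exponent_prod rescaling (uexp Q \<Gamma>) *
        Fraction_Field.Fract (truncate_poly v' p * plus_arrows v' \<Gamma> * neg_var_prod codim_out \<Gamma>) (plus_den v' \<Gamma> * var_prod codim \<Gamma>) =
        Fraction_Field.Fract (truncate_poly v' p * plus_arrows v' \<Gamma>) (plus_den v' \<Gamma>)"
      unfolding exponent_prod_rescaling by (simp add: eq_fract mult_ac)
    ultimately show ?thesis unfolding x_def by (simp only: limit_single)
  qed
qed

lemma slice_limit_minus_term:
  fixes p :: "('i, 'k::field) wpoly"
  assumes \<Gamma>: "\<Gamma> \<in> subset_tuples Q v m"
  defines "x \<equiv> Poly_Mapping.single (- uexp Q \<Gamma>)
    (Fraction_Field.Fract (p * framing w \<Gamma> * minus_arrows v \<Gamma>) (minus_den v \<Gamma>))"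
  shows "has_slice_limit x"
    and "\<Gamma> \<notin> subset_tuples Q v' m \<Longrightarrow> slice_limit x = 0"
    and "\<Gamma> \<in> subset_tuples Q v' m \<Longrightarrow> slice_limit x =
      Poly_Mapping.single (- uexp Q \<Gamma>)
       ((- 1) ^ ((\<Sum>i\<in>verts Q. m i * codim i) + (\<Sum>a\<in>arcs Q. m (tail Q a) * codim (head Q a))) *
        Fraction_Field.Fract (truncate_poly v' p * framing w' \<Gamma> * minus_arrows v' \<Gamma>) (minus_den v' \<Gamma>))"
proof -
  interpret degeneration "contract v' :: ('i, 'k) wpoly fract \<Rightarrow> _" "exponent_sum charge" "exponent_prod rescaling"
    by (rule degeneration_contract)
  interpret t: ring_map "truncate_poly v' :: ('i, 'k) wpoly \<Rightarrow> _" by (rule ring_map_truncate_poly)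
  interpret fr: ring_map "to_fract :: ('i, 'k) wpoly \<Rightarrow> _" by (rule ring_map_to_fract)
  let ?c = "Fraction_Field.Fract (p * framing w \<Gamma> * minus_arrows v \<Gamma>) (minus_den v \<Gamma>)"
  let ?k = "(\<Sum>i\<in>verts Q. m i * codim i) + (\<Sum>a\<in>arcs Q. m (tail Q a) * codim (head Q a))"
  have wt: "exponent_sum charge (- uexp Q \<Gamma>) = - exponent_sum charge (uexp Q \<Gamma>)"
    by (rule exponent_sum_uminus)
  obtain c where c: "leading (excess \<Gamma> - exponent_sum charge (- uexp Q \<Gamma>)) (contract v' ?c) c"
    using minus_order[OF \<Gamma>] unfolding wt by auto
  show "has_slice_limit x"
    unfolding x_def using leading_le[OF c, of "- exponent_sum charge (- uexp Q \<Gamma>)"] excess_nonneg[OF \<Gamma>] regular_single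
    by fastforce
  show "slice_limit x = 0" if "\<Gamma> \<notin> subset_tuples Q v' m"
  proof -
    have "leading (- exponent_sum charge (- uexp Q \<Gamma>)) (contract v' ?c) 0"
      using leading_weaken[OF c] excess_hidden[OF \<Gamma> that] by simp
    then show ?thesis unfolding x_def by (simp add: limit_single)
  qed
  show "slice_limit x = Poly_Mapping.single (- uexp Q \<Gamma>) ((- 1) ^ ?k *
        Fraction_Field.Fract (truncate_poly v' p * framing w' \<Gamma> * minus_arrows v' \<Gamma>) (minus_den v' \<Gamma>))"
    if \<Gamma>': "\<Gamma> \<in> subset_tuples Q v' m"
  proof -
    note [simp] = nonzero_products[OF \<Gamma>']
    let ?A = "var_prod codim \<Gamma> :: ('i, 'k) wpoly" and ?A' = "neg_var_prod codim \<Gamma> :: ('i, 'k) wpoly"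
      and ?B = "neg_var_prod codim_out \<Gamma> :: ('i, 'k) wpoly" and ?C = "var_prod codim_in \<Gamma> :: ('i, 'k) wpoly"
      and ?W = "framing w \<Gamma> :: ('i, 'k) wpoly" and ?W' = "framing w' \<Gamma> :: ('i, 'k) wpoly"
      and ?N = "minus_arrows v' \<Gamma> :: ('i, 'k) wpoly" and ?M = "minus_den v' \<Gamma> :: ('i, 'k) wpoly"
      and ?p = "truncate_poly v' p"
    have "truncate_poly v' (minus_den v \<Gamma>) \<noteq> (0 :: ('i, 'k) wpoly)"
      unfolding truncate_arrows_den[OF \<Gamma>'] by simp
    then have "leading (0 - 0) (contract v' ?c)
        (to_fract (truncate_poly v' (p * framing w \<Gamma> * minus_arrows v \<Gamma>)) / to_fract (truncate_poly v' (minus_den v \<Gamma>)))"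
      unfolding contract_Fract by (intro leading_divide leading_contract_poly) simp
    then have lead: "leading (- exponent_sum charge (- uexp Q \<Gamma>)) (contract v' ?c)
        (Fraction_Field.Fract (?p * ?W * (?N * ?C)) (?M * ?A'))"
      by (simp add: wt excess_visible[OF \<Gamma>'] truncate_arrows_den[OF \<Gamma>'] t.map_mult)
    have "exponent_prod rescaling (- uexp Q \<Gamma>) * Fraction_Field.Fract (?p * ?W * (?N * ?C)) (?M * ?A') =
        Fraction_Field.Fract (?p * ?N * (?B * ?W * ?C)) (?M * (?A * ?A'))"
      unfolding exponent_prod_uminus[OF rescaling_nonzero] exponent_prod_rescaling by (simp add: mult_ac)
    also have "\<dots> = Fraction_Field.Fract ((- 1) ^ ?k * (?p * ?W' * ?N)) ?M"
      unfolding framing_shift[OF \<Gamma>'] by (simp add: eq_fract mult_ac)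
    also have "\<dots> = (- 1) ^ ?k * Fraction_Field.Fract (?p * ?W' * ?N) ?M"
      by (simp add: minus_one_power_iff)
    finally show ?thesis unfolding x_def limit_single[OF lead] by simp
  qed
qed

lemma
  fixes f :: "('i, 'k::field) wpoly"
  assumes f: "f \<in> Lambda_ring Q v m"
  shows regular_fmo_plus: "has_slice_limit (fmo_plus Q v m f)"
    and slice_limit_fmo_plus: "slice_limit (fmo_plus Q v m f) = fmo_plus Q v' m (truncate_poly v' f)"
proof -
  interpret degeneration "contract v' :: ('i, 'k) wpoly fract \<Rightarrow> _" "exponent_sum charge" "exponent_prod rescaling"
    by (rule degeneration_contract)
  let ?x = "\<lambda>x g \<Gamma>. Poly_Mapping.single (uexp Q \<Gamma>)
     (Fraction_Field.Fract (restrict_poly Q x m \<Gamma> g * plus_arrows x \<Gamma>) (plus_den x \<Gamma>))"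
  have fmo: "fmo_plus Q x m g = (\<Sum>\<Gamma>\<in>subset_tuples Q x m. ?x x g \<Gamma>)" for x and g :: "('i, 'k) wpoly"
    by (simp add: fmo_plus_def plus_arrows_def plus_den_def)
  show "has_slice_limit (fmo_plus Q v m f)"
    unfolding fmo by (intro regular_sum slice_limit_plus_term)
  have "slice_limit (fmo_plus Q v m f) = (\<Sum>\<Gamma>\<in>subset_tuples Q v' m. slice_limit (?x v f \<Gamma>))"
    unfolding fmo limit_sum
    by (rule sum.mono_neutral_right) (use subset_tuples_restrict[of Q v' v m] le in \<open>auto simp: finite_subset_tuples slice_limit_plus_term(2)\<close>)
  also have "\<dots> = (\<Sum>\<Gamma>\<in>subset_tuples Q v' m. ?x v' (truncate_poly v' f) \<Gamma>)"
  proof (rule sum.cong)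
    fix \<Gamma> assume \<Gamma>: "\<Gamma> \<in> subset_tuples Q v' m"
    then have \<Gamma>v: "\<Gamma> \<in> subset_tuples Q v m" using subset_tuples_restrict[of Q v' v m] le by blast
    show "slice_limit (?x v f \<Gamma>) = ?x v' (truncate_poly v' f) \<Gamma>"
      by (simp only: slice_limit_plus_term(3)[OF \<Gamma>v \<Gamma>] truncate_restrict_poly[OF f \<Gamma> le])
  qed simp
  finally show "slice_limit (fmo_plus Q v m f) = fmo_plus Q v' m (truncate_poly v' f)"
    unfolding fmo .
qed

lemma
  fixes f :: "('i, 'k::field) wpoly"
  assumes f: "f \<in> Lambda_ring Q v m"
  shows regular_fmo_minus: "has_slice_limit (fmo_minus Q v w m f)"
    and slice_limit_fmo_minus: "slice_limit (fmo_minus Q v w m f) = fmo_minus Q v' w' m (truncate_poly v' f)"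
proof -
  interpret degeneration "contract v' :: ('i, 'k) wpoly fract \<Rightarrow> _" "exponent_sum charge" "exponent_prod rescaling"
    by (rule degeneration_contract)
  let ?x = "\<lambda>x y g \<Gamma>. Poly_Mapping.single (- uexp Q \<Gamma>)
     (Fraction_Field.Fract (restrict_poly Q x m \<Gamma> g * framing y \<Gamma> * minus_arrows x \<Gamma>) (minus_den x \<Gamma>))"
  let ?n = "\<lambda>x. (\<Sum>i\<in>verts Q. m i * x i) + (\<Sum>a\<in>arcs Q. m (tail Q a) * x (head Q a))"
  have fmo: "fmo_minus Q x y m g = (- 1) ^ ?n x * (\<Sum>\<Gamma>\<in>subset_tuples Q x m. ?x x y g \<Gamma>)" for x y and g :: "('i, 'k) wpoly"
    by (simp add: fmo_minus_def framing_def minus_arrows_def minus_den_def)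
  have regular_sign: "has_slice_limit ((- 1) ^ k * z)" if "has_slice_limit z" for k and z :: "('i, 'k) loc"
    using that regular_uminus by (simp add: minus_one_power_iff)
  have slice_limit_sign: "slice_limit ((- 1) ^ k * z) = (- 1) ^ k * slice_limit z" for k and z :: "('i, 'k) loc"
    by (simp add: minus_one_power_iff limit_uminus)
  show "has_slice_limit (fmo_minus Q v w m f)"
    unfolding fmo by (intro regular_sign regular_sum slice_limit_minus_term)
  have sign: "Poly_Mapping.single e ((- 1) ^ k * c) = (- 1) ^ k * Poly_Mapping.single e c"
    for e :: "'i idx \<Rightarrow>\<^sub>0 int" and k and c :: "('i, 'k) wpoly fract"
    by (simp add: minus_one_power_iff single_uminus)
  have "slice_limit (\<Sum>\<Gamma>\<in>subset_tuples Q v m. ?x v w f \<Gamma>) = (\<Sum>\<Gamma>\<in>subset_tuples Q v' m. slice_limit (?x v w f \<Gamma>))"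
    unfolding limit_sum
    by (rule sum.mono_neutral_right) (use subset_tuples_restrict[of Q v' v m] le in \<open>auto simp: finite_subset_tuples slice_limit_minus_term(2)\<close>)
  also have "\<dots> = (\<Sum>\<Gamma>\<in>subset_tuples Q v' m. (- 1) ^ ?n codim * ?x v' w' (truncate_poly v' f) \<Gamma>)"
  proof (rule sum.cong)
    fix \<Gamma> assume \<Gamma>: "\<Gamma> \<in> subset_tuples Q v' m"
    then have \<Gamma>v: "\<Gamma> \<in> subset_tuples Q v m" using subset_tuples_restrict[of Q v' v m] le by blast
    show "slice_limit (?x v w f \<Gamma>) = (- 1) ^ ?n codim * ?x v' w' (truncate_poly v' f) \<Gamma>"
      by (simp only: slice_limit_minus_term(3)[OF \<Gamma>v \<Gamma>] truncate_restrict_poly[OF f \<Gamma> le] sign)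
  qed simp
  also have "\<dots> = (- 1) ^ ?n codim * (\<Sum>\<Gamma>\<in>subset_tuples Q v' m. ?x v' w' (truncate_poly v' f) \<Gamma>)"
    by (simp only: sum_distrib_left)
  finally have limit: "slice_limit (fmo_minus Q v w m f) = (- 1) ^ (?n v + ?n codim) *
      (\<Sum>\<Gamma>\<in>subset_tuples Q v' m. ?x v' w' (truncate_poly v' f) \<Gamma>)"
    unfolding fmo slice_limit_sign by (simp only: power_add mult.assoc)
  have "?n v + ?n codim = ?n v' + 2 * ?n codim"
  proof -
    have v: "v i = v' i + codim i" if "i \<in> verts Q" for i using le[OF that] by (simp add: codim_def)
    have "(\<Sum>i\<in>verts Q. m i * v i) = (\<Sum>i\<in>verts Q. m i * v' i) + (\<Sum>i\<in>verts Q. m i * codim i)"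
      unfolding sum.distrib[symmetric] by (intro sum.cong refl) (simp add: v distrib_left)
    moreover have "(\<Sum>a\<in>arcs Q. m (tail Q a) * v (head Q a)) =
        (\<Sum>a\<in>arcs Q. m (tail Q a) * v' (head Q a)) + (\<Sum>a\<in>arcs Q. m (tail Q a) * codim (head Q a))"
      unfolding sum.distrib[symmetric] by (intro sum.cong refl) (simp add: v distrib_left)
    ultimately show ?thesis by simp
  qed
  then have sign': "(- 1) ^ (?n v + ?n codim) = ((- 1) ^ ?n v' :: ('i, 'k) loc)"
    by (simp only: power_add power_mult) simp
  show "slice_limit (fmo_minus Q v w m f) = fmo_minus Q v' w' m (truncate_poly v' f)"
    unfolding limit sign' by (rule fmo[symmetric])
qed

lemma slice_limit_scalar:
  fixes c :: "'k::field"
  shows "has_slice_limit (scalar c :: ('i, 'k) loc)" "slice_limit (scalar c) = (scalar c :: ('i, 'k) loc)"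
proof -
  interpret degeneration "contract v' :: ('i, 'k) wpoly fract \<Rightarrow> _" "exponent_sum charge" "exponent_prod rescaling"
    by (rule degeneration_contract)
  have lead: "leading (- exponent_sum charge 0) (contract v' (to_fract (pconst c))) (to_fract (pconst c) :: ('i, 'k) wpoly fract)"
    by (simp add: contract_Fract ring_map.map_one[OF ring_map_contract_poly] leading_const)
  show "has_slice_limit (scalar c :: ('i, 'k) loc)" "slice_limit (scalar c) = (scalar c :: ('i, 'k) loc)"
    unfolding scalar_def using regular_single[OF lead] limit_single[OF lead] by simp_all
qed

lemma fmo_vanish:
  assumes "i \<in> verts Q" "v' i < m i"
  shows "fmo_plus Q v' m f = 0" "fmo_minus Q v' w' m f = 0"
  using subset_tuples_empty[of i Q v' m] assms by (simp_all add: fmo_plus_def fmo_minus_def)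

abbreviation fmos :: "('i \<Rightarrow> nat) \<Rightarrow> ('i \<Rightarrow> nat) \<Rightarrow> ('i, 'k::field) loc set" where
  "fmos x y \<equiv> (\<Union>m\<in>{m. \<forall>i\<in>verts Q. m i \<le> x i}.
     fmo_plus Q x m ` Lambda_ring Q x m \<union> fmo_minus Q x y m ` Lambda_ring Q x m)"

text \<open>
  Having a limit is preserved by sums and products, hence it passes from the monopole operators to the
  algebra that they generate; surjectivity is checked on generators.
\<close>

lemma closed_immersion_slice_limit:
  "closed_immersion (slice_ring Q v w) (slice_ring Q v' w' :: ('i, 'k::field) loc ring) slice_limit"
proof -
  interpret degeneration "contract v' :: ('i, 'k) wpoly fract \<Rightarrow> _" "exponent_sum charge" "exponent_prod rescaling"
    by (rule degeneration_contract)
  let ?S = "fmos v w :: ('i, 'k) loc set" and ?T = "fmos v' w' :: ('i, 'k) loc set"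
  have regular: "has_slice_limit x" if "x \<in> subalgebra_gen ?S" for x
    using that
  proof (induction rule: subalgebra_gen.induct)
    case (2 x)
    then show ?case using regular_fmo_plus regular_fmo_minus by blast
  qed (simp_all add: slice_limit_scalar regular_add regular_mult)
  have image: "slice_limit ` subalgebra_gen ?S = subalgebra_gen ?T"
  proof (rule image_subalgebra_gen)
    fix x assume "x \<in> ?S"
    then obtain m f where f: "f \<in> Lambda_ring Q v m" and "x = fmo_plus Q v m f \<or> x = fmo_minus Q v w m f"
      by blast
    then have x: "slice_limit x = fmo_plus Q v' m (truncate_poly v' f) \<or> slice_limit x = fmo_minus Q v' w' m (truncate_poly v' f)"
      using slice_limit_fmo_plus slice_limit_fmo_minus by blast
    show "slice_limit x \<in> subalgebra_gen ?T"
    proof (cases "\<forall>i\<in>verts Q. m i \<le> v' i")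
      case True
      then have "slice_limit x \<in> ?T" using x truncate_poly_Lambda_ring[OF f le] by blast
      then show ?thesis by (rule subalgebra_gen.intros)
    next
      case False
      then have "slice_limit x = scalar 0" using x fmo_vanish by (auto simp: not_le scalar_zero)
      then show ?thesis by (simp only: subalgebra_gen.intros)
    qed
  next
    show "?T \<subseteq> slice_limit ` ?S"
    proof
      fix y assume "y \<in> ?T"
      then obtain m g where m: "\<forall>i\<in>verts Q. m i \<le> v' i" and g: "g \<in> Lambda_ring Q v' m"
        and y: "y = fmo_plus Q v' m g \<or> y = fmo_minus Q v' w' m g"
        by blast
      obtain f where f: "f \<in> Lambda_ring Q v m" "truncate_poly v' f = g"
        using Lambda_ring_lift[OF g] m le by blast
      have "\<forall>i\<in>verts Q. m i \<le> v i" using m le order_trans by blast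
      then have "fmo_plus Q v m f \<in> ?S" "fmo_minus Q v w m f \<in> ?S" using f(1) by blast+
      moreover have "y = slice_limit (fmo_plus Q v m f) \<or> y = slice_limit (fmo_minus Q v w m f)"
        using y f slice_limit_fmo_plus slice_limit_fmo_minus by metis
      ultimately show "y \<in> slice_limit ` ?S" by blast
    qed
  qed (simp_all add: slice_limit_scalar limit_add limit_mult regular)
  let ?A = "slice_ring Q v w :: ('i, 'k) loc ring" and ?B = "slice_ring Q v' w' :: ('i, 'k) loc ring"
  have "slice_limit \<in> ring_hom ?A ?B"
  proof (rule ring_hom_memI)
    show "slice_limit \<one>\<^bsub>?A\<^esub> = \<one>\<^bsub>?B\<^esub>"
      using slice_limit_scalar(2)[of 1] by (simp add: slice_ring_def scalar_one)
  qed (use image in \<open>auto simp: slice_ring_def limit_add limit_mult regular\<close>)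
  then have "ring_hom_cring ?A ?B slice_limit"
    by (intro ring_hom_cring.intro ring_hom_cring_axioms.intro cring_slice_ring)
  moreover have "slice_limit ` carrier ?A = carrier ?B"
    using image by (simp add: slice_ring_def)
  ultimately show ?thesis by (rule ring_hom_cring.closed_immersion_if_surjective)
qed

end


section \<open>The embedding of slices\<close>

lemma nested_slices_if_conic:
  assumes datum: "root_datum Q scale coroot \<alpha> \<Lambda>"
    and dominance: "dominance_le Q scale coroot lam' lam"
    and conic: "conicity Q \<alpha> \<Lambda> lam lam'"
    and v: "\<And>i. i \<in> verts Q \<Longrightarrow> int (v i) = \<Lambda> i (lam - mu)"
    and v': "\<And>i. i \<in> verts Q \<Longrightarrow> int (v' i) = \<Lambda> i (lam' - mu)"
    and w: "\<And>i. i \<in> verts Q \<Longrightarrow> int (w i) = \<alpha> i lam"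
    and w': "\<And>i. i \<in> verts Q \<Longrightarrow> int (w' i) = \<alpha> i lam'"
  shows "nested_slices Q v v' w w'"
proof -
  interpret root_datum Q scale coroot \<alpha> \<Lambda> by fact
  obtain n where n: "\<And>i. i \<in> verts Q \<Longrightarrow> \<Lambda> i (lam - lam') = int (n i)"
    and n\<alpha>: "\<And>i. i \<in> verts Q \<Longrightarrow> \<alpha> i (lam - lam') = (\<Sum>j\<in>verts Q. cartan Q i j * int (n j))"
    using dominance_le_fund_weight[OF datum dominance] by blast
  have vn: "v i = v' i + n i" if i: "i \<in> verts Q" for i
  proof -
    interpret l: module_hom scale "(*)" "\<Lambda> i" by (rule fund_weight_linear) fact
    have "\<Lambda> i (lam - mu) = \<Lambda> i (lam' - mu) + \<Lambda> i (lam - lam')"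
      unfolding l.diff by simp
    then show ?thesis using v[OF i] v'[OF i] n[OF i] by linarith
  qed
  then have codim: "int (v i - v' i) = \<Lambda> i (lam - lam')" if "i \<in> verts Q" for i
    using that n by simp
  show ?thesis
  proof
    show "v' i \<le> v i" if "i \<in> verts Q" for i using vn[OF that] by simp
    show "int (w' i) = int (w i) - (\<Sum>j\<in>verts Q. cartan Q i j * int (v j - v' j))" if i: "i \<in> verts Q" for i
    proof -
      interpret l: module_hom scale "(*)" "\<alpha> i" by (rule simple_root_linear) fact
      have "\<alpha> i lam' = \<alpha> i lam - \<alpha> i (lam - lam')" unfolding l.diff by simp
      then show ?thesis using n\<alpha>[OF i] w[OF i] w'[OF i] by (simp add: vn)
    qed
    show "(\<Sum>i\<in>verts Q. u i * (int (w i) - (\<Sum>j\<in>verts Q. cartan Q i j * int (v j - v' j))))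
        + (\<Sum>i\<in>verts Q. u i * (\<Sum>j\<in>verts Q. cartan Q i j * u j)) \<ge> 1"
      if "\<forall>i\<in>verts Q. 0 \<le> u i \<and> u i \<le> int (v i - v' i)" "\<exists>i\<in>verts Q. u i \<noteq> 0" for u
      using conic that unfolding conicity_def Let_def by (simp add: codim w)
  qed (unfold_locales)
qed

theorem theorem1p4:
  fixes Q :: "('i, 'e) pre_digraph"
    and scale :: "int \<Rightarrow> 'p::ab_group_add \<Rightarrow> 'p"
    and coroot :: "'i \<Rightarrow> 'p"
    and \<alpha> \<Lambda> :: "'i \<Rightarrow> 'p \<Rightarrow> int"
    and lam lam' mu :: 'p
    and v v' w w' :: "'i \<Rightarrow> nat"
  assumes "root_datum Q scale coroot \<alpha> \<Lambda>"
    and "dominant Q \<alpha> lam" and "dominant Q \<alpha> lam'"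
    and "dominance_le Q scale coroot lam' lam" and "dominance_le Q scale coroot mu lam'"
    and "conicity Q \<alpha> \<Lambda> lam lam'"
    and "\<And>i. i \<in> verts Q \<Longrightarrow> int (v i) = \<Lambda> i (lam - mu)"
    and "\<And>i. i \<in> verts Q \<Longrightarrow> int (v' i) = \<Lambda> i (lam' - mu)"
    and "\<And>i. i \<in> verts Q \<Longrightarrow> int (w i) = \<alpha> i lam"
    and "\<And>i. i \<in> verts Q \<Longrightarrow> int (w' i) = \<alpha> i lam'"
  shows "\<exists>\<phi> :: ('i, 'k::field) loc \<Rightarrow> ('i, 'k) loc.
           closed_immersion (slice_ring Q v w) (slice_ring Q v' w') \<phi> \<and>
           (\<forall>c. \<phi> (scalar c) = scalar c) \<and>
           (\<forall>m f. (\<forall>i\<in>verts Q. m i \<le> v i) \<and> f \<in> Lambda_ring Q v m \<longrightarrow>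
              (if \<forall>i\<in>verts Q. m i \<le> v' i
               then truncate_poly v' f \<in> Lambda_ring Q v' m \<and>
                    \<phi> (fmo_plus Q v m f) = fmo_plus Q v' m (truncate_poly v' f) \<and>
                    \<phi> (fmo_minus Q v w m f) = fmo_minus Q v' w' m (truncate_poly v' f)
               else \<phi> (fmo_plus Q v m f) = 0 \<and> \<phi> (fmo_minus Q v w m f) = 0))"
proof -
  interpret nested_slices Q v v' w w'
    by (rule nested_slices_if_conic[OF assms(1,4,6-10)])
  let ?\<phi> = "slice_limit :: ('i, 'k) loc \<Rightarrow> _"
  have "if \<forall>i\<in>verts Q. m i \<le> v' i
      then truncate_poly v' f \<in> Lambda_ring Q v' m \<and>
           ?\<phi> (fmo_plus Q v m f) = fmo_plus Q v' m (truncate_poly v' f) \<and>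
           ?\<phi> (fmo_minus Q v w m f) = fmo_minus Q v' w' m (truncate_poly v' f)
      else ?\<phi> (fmo_plus Q v m f) = 0 \<and> ?\<phi> (fmo_minus Q v w m f) = 0"
    if f: "f \<in> Lambda_ring Q v m" for m and f :: "('i, 'k) wpoly"
  proof (cases "\<forall>i\<in>verts Q. m i \<le> v' i")
    case True
    then show ?thesis
      using truncate_poly_Lambda_ring[OF f le] slice_limit_fmo_plus[OF f] slice_limit_fmo_minus[OF f] by simp
  next
    case False
    then obtain i where "i \<in> verts Q" "v' i < m i" by (auto simp: not_le)
    then show ?thesis
      unfolding if_not_P[OF False] slice_limit_fmo_plus[OF f] slice_limit_fmo_minus[OF f]
      using fmo_vanish by blast
  qed
  then show ?thesis
    using closed_immersion_slice_limit slice_limit_scalar(2) by (intro exI[of _ ?\<phi>] conjI allI impI) auto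
qed


end
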